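(* Fix $p_1,p_2\in(-1,1)$. For all $\epsilon\in(0,1]$, $\ell\in\mathbb Z^+$, $\theta_0\in[0,1)$ and closed convex sets $K_1,K_2\subseteq[0,1]^\ell$, there exist $\tau>0$ and mappings $$T^{(2)}_1:\{f:\{+1,-1\}^n\to K_1\}\to\{F:\mathbb R^n\to K_1\},\qquad T^{(2)}_2:\{g:\{+1,-1\}^n\to K_2\}\to\{G:\mathbb R^n\to K_2\}$$ such that for all $\theta\in[-\theta_0,\theta_0]$ (for which $N_{p_1,p_2,\theta}$ is a valid distribution), if $f:\{+1,-1\}^n\to K_1$ and $g:\{+1,-1\}^n\to K_2$ satisfy $$\max_{i\in[n]}\max\Big(\max_{j\in[\ell]}\mathrm{Inf}_i(f_j),\max_{j\in[\ell]}\mathrm{Inf}_i(g_j)\Big)\le\tau,$$ then for $F=T^{(2)}_1(f)$ and $G=T^{(2)}_2(g)$, $$\Big|\mathbb E_{(x,y)\sim N^{\otimes n}}\langle f(x),g(y)\rangle-\mathbb E_{(X,Y)\sim\mathcal G^{\otimes n}}\langle F(X),G(Y)\rangle\Big|\le\epsilon,$$ where $N=N_{p_1,p_2,\theta}$ and $\mathcal G$ is the bivariate Gaussian distribution matching the first and second moments of $N$.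
   Context: For $p_1,p_2,\theta\in[-1,1]$ (such that all the following are in $[0,1]$), $N_{p_1,p_2,\theta}$ is the distribution on $\{+1,-1\}^2$ giving $(+1,+1)$ probability $\frac{1+\theta}4+\frac{p_1+p_2}4$, $(+1,-1)$ probability $\frac{1-\theta}4+\frac{p_1-p_2}4$, $(-1,+1)$ probability $\frac{1-\theta}4-\frac{p_1-p_2}4$, $(-1,-1)$ probability $\frac{1+\theta}4-\frac{p_1+p_2}4$; so $\mathbb E[x]=p_1$, $\mathbb E[y]=p_2$, $\mathbb E[xy]=\theta$. $\mathcal G$ is the Gaussian distribution of $(X,Y)\in\mathbb R^2$ with $\mathbb E[X]=p_1$, $\mathbb E[Y]=p_2$, $\mathbb E[X^2]=\mathbb E[Y^2]=1$, $\mathbb E[XY]=\theta$. $f_j,g_j$ are coordinate functions; $\langle\cdot,\cdot\rangle$ is the inner product on $\mathbb R^\ell$. Influence: for a distribution $\mu$ on $\{+1,-1\}$ with mean $p\in(-1,1)$, let $\chi(z)=(z-p)/\sqrt{1-p^2}$; every $h:\{+1,-1\}^n\to\mathbb R$ has a unique expansion $h=\sum_{S\subseteq[n]}\hat h(S)\prod_{i\in S}\chi(z_i)$ and $\mathrm{Inf}_i(h)=\sum_{S\ni i}\hat h(S)^2$ (equivalently $\mathbb E_{z_{-i}}[\mathrm{Var}_{z_i}h(z)]$). Influences of $f_j$ are with respect to the product measure with marginals of mean $p_1$, those of $g_j$ with marginals of mean $p_2$. *)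

theory Defs
  imports "HOL-Probability.Probability"
begin

text \<open>
  Vectors indexed by \<open>[n]\<close> are extensional functions on \<open>{..<n}\<close>, so \<open>\<real>\<^sup>n\<close> is
  \<open>{..<n} \<rightarrow>\<^sub>E UNIV\<close>, which is the space of \<open>Pi\<^sub>M {..<n} (\<lambda>_. borel)\<close>.
  The dimension has to be a term rather than a type, because the influence threshold must not
  depend on it.
\<close>

definition cube :: "nat \<Rightarrow> (nat \<Rightarrow> real) set" where
  "cube n = {..<n} \<rightarrow>\<^sub>E {1, -1}"

definition unit_box :: "(real ^ 'l) set" where
  "unit_box = {v. \<forall>j. 0 \<le> v $ j \<and> v $ j \<le> 1}"

text \<open>
  Functions from \<open>\<real>\<^sup>n\<close> to \<open>K\<close> are required to be Borel measurable; the expectation of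
  \<open>\<langle>F(X), G(Y)\<rangle>\<close> presupposes this, and Isabelle's integral of a function that is not
  integrable is 0.
\<close>

definition real_maps :: "nat \<Rightarrow> (real ^ 'l) set \<Rightarrow> ((nat \<Rightarrow> real) \<Rightarrow> real ^ 'l) set" where
  "real_maps n K = {F \<in> borel_measurable (Pi\<^sub>M {..<n} (\<lambda>_. borel)). \<forall>x \<in> {..<n} \<rightarrow>\<^sub>E UNIV. F x \<in> K}"

definition fsts :: "nat \<Rightarrow> (nat \<Rightarrow> real \<times> real) \<Rightarrow> nat \<Rightarrow> real" where
  "fsts n w = (\<lambda>i\<in>{..<n}. fst (w i))"

definition snds :: "nat \<Rightarrow> (nat \<Rightarrow> real \<times> real) \<Rightarrow> nat \<Rightarrow> real" where
  "snds n w = (\<lambda>i\<in>{..<n}. snd (w i))"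

definition N_weights :: "real \<Rightarrow> real \<Rightarrow> real \<Rightarrow> ((real \<times> real) \<times> real) list" where
  "N_weights p1 p2 \<theta> =
     [((1, 1),   (1 + \<theta>) / 4 + (p1 + p2) / 4),
      ((1, -1),  (1 - \<theta>) / 4 + (p1 - p2) / 4),
      ((-1, 1),  (1 - \<theta>) / 4 - (p1 - p2) / 4),
      ((-1, -1), (1 + \<theta>) / 4 - (p1 + p2) / 4)]"

definition N_valid :: "real \<Rightarrow> real \<Rightarrow> real \<Rightarrow> bool" where
  "N_valid p1 p2 \<theta> \<longleftrightarrow> (\<forall>w \<in> set (map snd (N_weights p1 p2 \<theta>)). 0 \<le> w \<and> w \<le> 1)"

definition N_dist :: "real \<Rightarrow> real \<Rightarrow> real \<Rightarrow> (real \<times> real) pmf" where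
  "N_dist p1 p2 \<theta> = pmf_of_list (N_weights p1 p2 \<theta>)"

lemma N_weights_wf:
  assumes "N_valid p1 p2 \<theta>"
  shows "pmf_of_list_wf (N_weights p1 p2 \<theta>)"
proof (rule pmf_of_list_wfI)
  show "x \<ge> 0" if "x \<in> set (map snd (N_weights p1 p2 \<theta>))" for x
    using assms that by (auto simp: N_valid_def)
  show "sum_list (map snd (N_weights p1 p2 \<theta>)) = 1"
    by (simp add: N_weights_def field_simps)
qed

lemma N_dist_moments:
  assumes "N_valid p1 p2 \<theta>"
  shows "measure_pmf.expectation (N_dist p1 p2 \<theta>) fst = p1"
    and "measure_pmf.expectation (N_dist p1 p2 \<theta>) snd = p2"
    and "measure_pmf.expectation (N_dist p1 p2 \<theta>) (\<lambda>w. (fst w)\<^sup>2) = 1"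
    and "measure_pmf.expectation (N_dist p1 p2 \<theta>) (\<lambda>w. (snd w)\<^sup>2) = 1"
    and "measure_pmf.expectation (N_dist p1 p2 \<theta>) (\<lambda>w. fst w * snd w) = \<theta>"
proof -
  have wf: "pmf_of_list_wf (N_weights p1 p2 \<theta>)" by (rule N_weights_wf[OF assms])
  let ?A = "{(1, 1), (1, -1), (-1, 1), (-1, -1)} :: (real \<times> real) set"
  have sub: "set_pmf (N_dist p1 p2 \<theta>) \<subseteq> ?A"
    using set_pmf_of_list[OF wf] by (simp add: N_dist_def N_weights_def)
  have E: "measure_pmf.expectation (N_dist p1 p2 \<theta>) h =
      (\<Sum>w\<in>?A. h w * pmf (N_dist p1 p2 \<theta>) w)" for h :: "real \<times> real \<Rightarrow> real"
    by (rule integral_measure_pmf_real) (use sub in auto)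
  have P: "pmf (N_dist p1 p2 \<theta>) w =
      sum_list (map snd (filter (\<lambda>z. fst z = w) (N_weights p1 p2 \<theta>)))" for w
    unfolding N_dist_def by (rule pmf_pmf_of_list[OF wf])
  show "measure_pmf.expectation (N_dist p1 p2 \<theta>) fst = p1"
    "measure_pmf.expectation (N_dist p1 p2 \<theta>) snd = p2"
    "measure_pmf.expectation (N_dist p1 p2 \<theta>) (\<lambda>w. (fst w)\<^sup>2) = 1"
    "measure_pmf.expectation (N_dist p1 p2 \<theta>) (\<lambda>w. (snd w)\<^sup>2) = 1"
    "measure_pmf.expectation (N_dist p1 p2 \<theta>) (\<lambda>w. fst w * snd w) = \<theta>"
    unfolding E P by (simp_all add: N_weights_def field_simps)
qed

definition std_normal :: "real measure" where
  "std_normal = density lborel std_normal_density"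

text \<open>
  The law of \<open>X = p1 + \<sigma>1 U\<close>, \<open>Y = p2 + \<sigma>2 (\<rho> U + sqrt (1 - \<rho>\<^sup>2) V)\<close> with \<open>U\<close>, \<open>V\<close> independent
  standard normal, where \<open>\<sigma>1\<^sup>2 = 1 - p1\<^sup>2\<close> and \<open>\<sigma>2\<^sup>2 = 1 - p2\<^sup>2\<close> are the variances that give second
  moments 1, and \<open>\<rho>\<close> is the correlation that gives \<open>E[XY] = \<theta>\<close> (see \<open>bigauss_moments\<close>).
\<close>

definition bigauss :: "real \<Rightarrow> real \<Rightarrow> real \<Rightarrow> (real \<times> real) measure" where
  "bigauss p1 p2 \<theta> =
     (let \<sigma>1 = sqrt (1 - p1\<^sup>2); \<sigma>2 = sqrt (1 - p2\<^sup>2); \<rho> = (\<theta> - p1 * p2) / (\<sigma>1 * \<sigma>2)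
      in distr (std_normal \<Otimes>\<^sub>M std_normal) borel
           (\<lambda>(u, v). (p1 + \<sigma>1 * u, p2 + \<sigma>2 * (\<rho> * u + sqrt (1 - \<rho>\<^sup>2) * v))))"

lemma N_valid_correlation:
  assumes "-1 < p1" "p1 < 1" "-1 < p2" "p2 < 1" "N_valid p1 p2 \<theta>"
  shows "((\<theta> - p1 * p2) / (sqrt (1 - p1\<^sup>2) * sqrt (1 - p2\<^sup>2)))\<^sup>2 \<le> 1"
proof -
  define a where "a = (1 + \<theta>) / 4 + (p1 + p2) / 4"
  define b where "b = (1 - \<theta>) / 4 + (p1 - p2) / 4"
  define c where "c = (1 - \<theta>) / 4 - (p1 - p2) / 4"
  define d where "d = (1 + \<theta>) / 4 - (p1 + p2) / 4"
  have nn: "a \<ge> 0" "b \<ge> 0" "c \<ge> 0" "d \<ge> 0"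
    using assms(5) by (auto simp: N_valid_def N_weights_def a_def b_def c_def d_def)
  have "(1 - p1\<^sup>2) * (1 - p2\<^sup>2) - (\<theta> - p1 * p2)\<^sup>2 = 16 * (a*b*c + a*b*d + a*c*d + b*c*d)"
    unfolding a_def b_def c_def d_def by (simp add: field_simps power2_eq_square)
  also have "\<dots> \<ge> 0" using nn by simp
  finally have le: "(\<theta> - p1 * p2)\<^sup>2 \<le> (1 - p1\<^sup>2) * (1 - p2\<^sup>2)" by simp
  have pos: "1 - p1\<^sup>2 > 0" "1 - p2\<^sup>2 > 0"
    using assms(1-4) by (simp_all add: abs_square_less_1 abs_less_iff)
  show ?thesis using le pos
    by (simp add: power_divide power_mult_distrib divide_le_eq)
qed

interpretation std_normal: prob_space std_normal
  unfolding std_normal_def by (rule prob_space_normal_density) simp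

interpretation std_normal_pair: pair_prob_space std_normal std_normal ..

lemma sets_std_normal [simp, measurable_cong]: "sets std_normal = sets borel"
  by (simp add: std_normal_def)

lemma sets_bigauss [simp, measurable_cong]: "sets (bigauss p1 p2 \<theta>) = sets borel"
  by (simp add: bigauss_def Let_def)

lemma std_normal_moments:
  shows "integrable std_normal (\<lambda>u. u)" "integrable std_normal (\<lambda>u. u\<^sup>2)"
    and "(\<integral>u. u \<partial>std_normal) = 0" "(\<integral>u. u\<^sup>2 \<partial>std_normal) = 1"
proof -
  have nn: "AE x in lborel. 0 \<le> std_normal_density x" by simp
  show "integrable std_normal (\<lambda>u. u)"
    unfolding std_normal_def using integrable_std_normal_moment[of 1]
    by (subst integrable_density[OF _ _ nn]) auto
  show "integrable std_normal (\<lambda>u. u\<^sup>2)"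
    unfolding std_normal_def using integrable_std_normal_moment[of 2]
    by (subst integrable_density[OF _ _ nn]) auto
  show "(\<integral>u. u \<partial>std_normal) = 0"
    unfolding std_normal_def using integral_std_normal_moment_odd[of 0]
    by (subst integral_density[OF _ _ nn]) auto
  show "(\<integral>u. u\<^sup>2 \<partial>std_normal) = 1"
    unfolding std_normal_def using integral_std_normal_moment_even[of 1]
    by (subst integral_density[OF _ _ nn]) auto
qed

lemma std_normal_pair_product:
  fixes h k :: "real \<Rightarrow> real"
  assumes [simp]: "integrable std_normal h" "integrable std_normal k"
  shows "integrable (std_normal \<Otimes>\<^sub>M std_normal) (\<lambda>w. h (fst w) * k (snd w))" (is ?int)
    and "(\<integral>w. h (fst w) * k (snd w) \<partial>(std_normal \<Otimes>\<^sub>M std_normal))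
      = (\<integral>u. h u \<partial>std_normal) * (\<integral>v. k v \<partial>std_normal)"
proof -
  have [measurable]: "h \<in> borel_measurable std_normal" "k \<in> borel_measurable std_normal"
    using assms by (blast intro: borel_measurable_integrable)+
  show int: ?int
    by (rule std_normal_pair.Fubini_integrable) (auto simp: abs_mult)
  show "(\<integral>w. h (fst w) * k (snd w) \<partial>(std_normal \<Otimes>\<^sub>M std_normal))
      = (\<integral>u. h u \<partial>std_normal) * (\<integral>v. k v \<partial>std_normal)"
    using std_normal_pair.integral_fst'[OF int] by simp
qed

lemma std_normal_pair_quadratic:
  fixes a b c d e f :: real
  shows "(\<integral>w. a + b * fst w + c * snd w + d * (fst w)\<^sup>2 + e * (fst w * snd w) + f * (snd w)\<^sup>2
            \<partial>(std_normal \<Otimes>\<^sub>M std_normal)) = a + d + f"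
proof -
  note M = std_normal_moments
  note P = std_normal_pair_product
  have [simp]: "integrable std_normal (\<lambda>_. 1 :: real)" by simp
  have u: "integrable (std_normal \<Otimes>\<^sub>M std_normal) fst" "integral\<^sup>L (std_normal \<Otimes>\<^sub>M std_normal) fst = 0"
    using P[of "\<lambda>u. u" "\<lambda>_. 1"] M by (simp_all add: std_normal.prob_space)
  have v: "integrable (std_normal \<Otimes>\<^sub>M std_normal) snd" "integral\<^sup>L (std_normal \<Otimes>\<^sub>M std_normal) snd = 0"
    using P[of "\<lambda>_. 1" "\<lambda>u. u"] M by (simp_all add: std_normal.prob_space)
  have uu: "integrable (std_normal \<Otimes>\<^sub>M std_normal) (\<lambda>w. (fst w)\<^sup>2)"
    "(\<integral>w. (fst w)\<^sup>2 \<partial>(std_normal \<Otimes>\<^sub>M std_normal)) = 1"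
    using P[of "\<lambda>u. u\<^sup>2" "\<lambda>_. 1"] M by (simp_all add: std_normal.prob_space)
  have vv: "integrable (std_normal \<Otimes>\<^sub>M std_normal) (\<lambda>w. (snd w)\<^sup>2)"
    "(\<integral>w. (snd w)\<^sup>2 \<partial>(std_normal \<Otimes>\<^sub>M std_normal)) = 1"
    using P[of "\<lambda>_. 1" "\<lambda>u. u\<^sup>2"] M by (simp_all add: std_normal.prob_space)
  have uv: "integrable (std_normal \<Otimes>\<^sub>M std_normal) (\<lambda>w. fst w * snd w)"
    "(\<integral>w. fst w * snd w \<partial>(std_normal \<Otimes>\<^sub>M std_normal)) = 0"
    using P[of "\<lambda>u. u" "\<lambda>u. u"] M by simp_all
  show ?thesis
    using u v uu vv uv by (simp add: std_normal_pair.prob_space)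
qed

lemma bigauss_moments:
  assumes "-1 < p1" "p1 < 1" "-1 < p2" "p2 < 1" "N_valid p1 p2 \<theta>"
  shows "(\<integral>w. fst w \<partial>bigauss p1 p2 \<theta>) = p1"
    and "(\<integral>w. snd w \<partial>bigauss p1 p2 \<theta>) = p2"
    and "(\<integral>w. (fst w)\<^sup>2 \<partial>bigauss p1 p2 \<theta>) = 1"
    and "(\<integral>w. (snd w)\<^sup>2 \<partial>bigauss p1 p2 \<theta>) = 1"
    and "(\<integral>w. fst w * snd w \<partial>bigauss p1 p2 \<theta>) = \<theta>"
proof -
  define s where "s = sqrt (1 - p1\<^sup>2)"
  define t where "t = sqrt (1 - p2\<^sup>2)"
  define r where "r = (\<theta> - p1 * p2) / (s * t)"
  define q where "q = sqrt (1 - r\<^sup>2)"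
  have pos: "1 - p1\<^sup>2 > 0" "1 - p2\<^sup>2 > 0"
    using assms(1-4) by (simp_all add: abs_square_less_1 abs_less_iff)
  have st: "s > 0" "t > 0" "s\<^sup>2 = 1 - p1\<^sup>2" "t\<^sup>2 = 1 - p2\<^sup>2"
    using pos by (simp_all add: s_def t_def)
  have q2: "q\<^sup>2 = 1 - r\<^sup>2"
    using N_valid_correlation[OF assms] by (simp add: q_def r_def s_def t_def)
  have str: "s * t * r = \<theta> - p1 * p2"
    using st by (simp add: r_def)
  let ?\<phi> = "\<lambda>w :: real \<times> real. (p1 + s * fst w, p2 + t * (r * fst w + q * snd w))"
  have g: "bigauss p1 p2 \<theta> = distr (std_normal \<Otimes>\<^sub>M std_normal) borel ?\<phi>"
    by (simp add: bigauss_def Let_def s_def t_def r_def q_def case_prod_beta')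
  have [measurable]: "?\<phi> \<in> std_normal \<Otimes>\<^sub>M std_normal \<rightarrow>\<^sub>M borel"
    unfolding borel_prod[symmetric] by measurable
  have E: "(\<integral>w. h w \<partial>bigauss p1 p2 \<theta>) = (\<integral>w. h (?\<phi> w) \<partial>(std_normal \<Otimes>\<^sub>M std_normal))"
    if "h \<in> borel_measurable borel" for h :: "real \<times> real \<Rightarrow> real"
    unfolding g by (rule integral_distr) (use that in auto)
  have m: "fst \<in> borel_measurable (borel :: (real \<times> real) measure)"
    "snd \<in> borel_measurable (borel :: (real \<times> real) measure)"
    "(\<lambda>w. (fst w)\<^sup>2) \<in> borel_measurable (borel :: (real \<times> real) measure)"
    "(\<lambda>w. (snd w)\<^sup>2) \<in> borel_measurable (borel :: (real \<times> real) measure)"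
    "(\<lambda>w. fst w * snd w) \<in> borel_measurable (borel :: (real \<times> real) measure)"
    unfolding borel_prod[symmetric] by measurable
  note Q = std_normal_pair_quadratic
  show "(\<integral>w. fst w \<partial>bigauss p1 p2 \<theta>) = p1"
    using Q[of p1 s 0 0 0 0] by (simp add: E m)
  show "(\<integral>w. snd w \<partial>bigauss p1 p2 \<theta>) = p2"
    using Q[of p2 "t * r" "t * q" 0 0 0] by (simp add: E m algebra_simps)
  show "(\<integral>w. (fst w)\<^sup>2 \<partial>bigauss p1 p2 \<theta>) = 1"
  proof -
    have "(\<integral>w. (fst w)\<^sup>2 \<partial>bigauss p1 p2 \<theta>) = p1\<^sup>2 + s\<^sup>2"
      unfolding E[OF m(3)] using Q[of "p1\<^sup>2" "2 * p1 * s" 0 "s\<^sup>2" 0 0]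
      by (simp add: power2_eq_square algebra_simps)
    then show ?thesis using st by simp
  qed
  show "(\<integral>w. (snd w)\<^sup>2 \<partial>bigauss p1 p2 \<theta>) = 1"
  proof -
    have "(\<integral>w. (snd w)\<^sup>2 \<partial>bigauss p1 p2 \<theta>) = p2\<^sup>2 + t\<^sup>2 * r\<^sup>2 + t\<^sup>2 * q\<^sup>2"
      unfolding E[OF m(4)]
      using Q[of "p2\<^sup>2" "2 * p2 * t * r" "2 * p2 * t * q" "t\<^sup>2 * r\<^sup>2" "2 * t\<^sup>2 * r * q" "t\<^sup>2 * q\<^sup>2"]
      by (simp add: power2_eq_square algebra_simps)
    also have "\<dots> = p2\<^sup>2 + t\<^sup>2" by (simp add: q2 algebra_simps)
    finally show ?thesis using st by simp
  qed
  show "(\<integral>w. fst w * snd w \<partial>bigauss p1 p2 \<theta>) = \<theta>"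
  proof -
    have "(\<integral>w. fst w * snd w \<partial>bigauss p1 p2 \<theta>) = p1 * p2 + s * t * r"
      unfolding E[OF m(5)]
      using Q[of "p1 * p2" "p1 * t * r + s * p2" "p1 * t * q" "s * t * r" "s * t * q" 0]
      by (simp add: power2_eq_square algebra_simps)
    then show ?thesis using str by simp
  qed
qed

definition chi :: "real \<Rightarrow> real \<Rightarrow> real" where
  "chi p z = (z - p) / sqrt (1 - p\<^sup>2)"

text \<open>
  The coefficients of the unique expansion; \<open>fourier_ex1\<close> shows that the definite description is
  proper. Requiring \<open>c\<close> to be extensional only fixes its values outside the subsets of \<open>[n]\<close>.
\<close>

definition fourier :: "real \<Rightarrow> nat \<Rightarrow> ((nat \<Rightarrow> real) \<Rightarrow> real) \<Rightarrow> nat set \<Rightarrow> real" where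
  "fourier p n h = (THE c. c \<in> extensional (Pow {..<n}) \<and>
     (\<forall>z \<in> cube n. h z = (\<Sum>S \<in> Pow {..<n}. c S * (\<Prod>i\<in>S. chi p (z i)))))"

definition influence :: "real \<Rightarrow> nat \<Rightarrow> nat \<Rightarrow> ((nat \<Rightarrow> real) \<Rightarrow> real) \<Rightarrow> real" where
  "influence p n i h = (\<Sum>S | S \<subseteq> {..<n} \<and> i \<in> S. (fourier p n h S)\<^sup>2)"

lemma fourier_ex1:
  fixes h :: "(nat \<Rightarrow> real) \<Rightarrow> real"
  assumes p: "-1 < p" "p < 1"
  shows "\<exists>!c. c \<in> extensional (Pow {..<n}) \<and>
     (\<forall>z \<in> cube n. h z = (\<Sum>S \<in> Pow {..<n}. c S * (\<Prod>i\<in>S. chi p (z i))))"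
proof -
  define w where "w z = (\<Prod>i<n. (1 + p * z i) / 2)" for z :: "nat \<Rightarrow> real"
  define X where "X S z = (\<Prod>i\<in>S. chi p (z i))" for S :: "nat set" and z :: "nat \<Rightarrow> real"
  have p2: "1 - p\<^sup>2 > 0" using p by (simp add: abs_square_less_1 abs_less_iff)
  have chi_sq: "chi p a * chi p b = (a - p) * (b - p) / (1 - p\<^sup>2)" for a b
    using p2 by (simp add: chi_def)
  have fin: "finite (cube n)" by (auto simp: cube_def intro!: finite_PiE)
  have two: "(\<Sum>b\<in>{1, -1 :: real}. (1 + p * b) / 2 * (chi p b * chi p b)) = 1"
    "(\<Sum>b\<in>{1, -1 :: real}. (1 + p * b) / 2 * chi p b) = 0"
    "(\<Sum>b\<in>{1, -1 :: real}. (1 + p * b) / 2) = 1"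
  proof -
    have q: "1 + p > 0" "1 - p > 0" using p by auto
    have "chi p 1 * chi p 1 = (1 - p) / (1 + p)" "chi p (-1) * chi p (-1) = (1 + p) / (1 - p)"
      unfolding chi_sq using q p2 by (simp_all add: field_simps power2_eq_square)
    then show "(\<Sum>b\<in>{1, -1 :: real}. (1 + p * b) / 2 * (chi p b * chi p b)) = 1"
      using q by (simp add: field_simps)
    show "(\<Sum>b\<in>{1, -1 :: real}. (1 + p * b) / 2 * chi p b) = 0"
      using p2 by (simp add: chi_def add_divide_distrib[symmetric] algebra_simps)
    show "(\<Sum>b\<in>{1, -1 :: real}. (1 + p * b) / 2) = 1"
      by (simp add: field_simps)
  qed
  have orth: "(\<Sum>z\<in>cube n. w z * (X S z * X T z)) = (if S = T then 1 else 0)"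
    if "S \<subseteq> {..<n}" "T \<subseteq> {..<n}" for S T
  proof -
    define \<psi> where "\<psi> i b = (1 + p * b) / 2 * ((if i \<in> S then chi p b else 1) * (if i \<in> T then chi p b else 1))"
      for i :: nat and b :: real
    have XS: "X R z = (\<Prod>i<n. if i \<in> R then chi p (z i) else 1)" if "R \<subseteq> {..<n}" for R z
      unfolding X_def using that by (simp add: prod.If_cases Int_absorb1)
    have "(\<Sum>z\<in>cube n. w z * (X S z * X T z)) = (\<Sum>z\<in>cube n. \<Prod>i<n. \<psi> i (z i))"
      unfolding \<psi>_def w_def XS[OF that(1)] XS[OF that(2)] prod.distrib ..
    also have "\<dots> = (\<Prod>i<n. \<Sum>b\<in>{1, -1}. \<psi> i b)"
      unfolding cube_def by (rule prod_sum_PiE[symmetric]) auto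
    also have "\<dots> = (\<Prod>i<n. if i \<in> S \<longleftrightarrow> i \<in> T then 1 else 0)"
      by (intro prod.cong refl) (use two in \<open>auto simp: \<psi>_def\<close>)
    also have "\<dots> = (if S = T then 1 else 0)"
      using that by (auto simp: prod_zero_iff)
    finally show ?thesis .
  qed
  have repr: "(\<Sum>S\<in>Pow {..<n}. X S y * X S z) * w y = (if y = z then 1 else 0)"
    if "y \<in> cube n" "z \<in> cube n" for y z
  proof -
    have "(\<Sum>S\<in>Pow {..<n}. X S y * X S z) * w y
        = (\<Prod>i<n. (chi p (y i) * chi p (z i) + 1) * ((1 + p * y i) / 2))"
      unfolding prod.distrib w_def X_def
      by (subst prod_add) (simp_all add: prod.distrib)
    also have "\<dots> = (\<Prod>i<n. if y i = z i then 1 else 0)"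
    proof (intro prod.cong refl)
      fix i assume "i \<in> {..<n}"
      then have "y i \<in> {1, -1}" "z i \<in> {1, -1}"
        using that by (auto simp: cube_def PiE_iff)
      then show "(chi p (y i) * chi p (z i) + 1) * ((1 + p * y i) / 2) = (if y i = z i then 1 else 0)"
        using p2 by (auto simp: chi_sq divide_simps power2_eq_square algebra_simps)
    qed
    also have "\<dots> = (if y = z then 1 else 0)"
    proof (cases "y = z")
      case False
      have "\<exists>i\<in>{..<n}. y i \<noteq> z i"
      proof (rule ccontr)
        assume "\<not> ?thesis"
        then have "y = z"
          using that unfolding cube_def by (intro PiE_ext[of y "{..<n}" "\<lambda>_. {1, -1}" z]) blast+
        with False show False by simp
      qed
      then have "(\<Prod>i<n. if y i = z i then 1 else 0 :: real) = 0"
        by (intro prod_zero) auto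
      then show ?thesis using False by simp
    qed simp
    finally show ?thesis .
  qed
  define c where "c = (\<lambda>S\<in>Pow {..<n}. \<Sum>y\<in>cube n. w y * h y * X S y)"
  show ?thesis
  proof (rule ex1I[of _ c], intro conjI ballI)
    show "c \<in> extensional (Pow {..<n})" by (simp add: c_def)
    fix z assume z: "z \<in> cube n"
    have "(\<Sum>S \<in> Pow {..<n}. c S * X S z) = (\<Sum>S \<in> Pow {..<n}. \<Sum>y\<in>cube n. w y * h y * X S y * X S z)"
      by (intro sum.cong refl) (simp add: c_def sum_distrib_right)
    also have "\<dots> = (\<Sum>y\<in>cube n. \<Sum>S \<in> Pow {..<n}. w y * h y * X S y * X S z)"
      by (rule sum.swap)
    also have "\<dots> = (\<Sum>y\<in>cube n. h y * ((\<Sum>S\<in>Pow {..<n}. X S y * X S z) * w y))"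
      by (intro sum.cong refl) (simp only: sum_distrib_left sum_distrib_right, simp only: mult_ac)
    also have "\<dots> = (\<Sum>y\<in>cube n. if y = z then h y else 0)"
      by (intro sum.cong refl) (simp add: repr z)
    also have "\<dots> = h z" using z fin by simp
    finally show "h z = (\<Sum>S \<in> Pow {..<n}. c S * (\<Prod>i\<in>S. chi p (z i)))"
      by (simp add: X_def)
  next
    fix d
    assume d: "d \<in> extensional (Pow {..<n}) \<and>
      (\<forall>z \<in> cube n. h z = (\<Sum>S \<in> Pow {..<n}. d S * (\<Prod>i\<in>S. chi p (z i))))"
    have "d T = c T" if T: "T \<in> Pow {..<n}" for T
    proof -
      have "c T = (\<Sum>y\<in>cube n. w y * (\<Sum>S \<in> Pow {..<n}. d S * X S y) * X T y)"
        using T d by (simp add: c_def X_def)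
      also have "\<dots> = (\<Sum>y\<in>cube n. \<Sum>S \<in> Pow {..<n}. d S * (w y * (X S y * X T y)))"
        by (intro sum.cong refl) (simp only: sum_distrib_left sum_distrib_right, simp only: mult_ac)
      also have "\<dots> = (\<Sum>S \<in> Pow {..<n}. d S * (\<Sum>y\<in>cube n. w y * (X S y * X T y)))"
        by (subst sum.swap) (simp add: sum_distrib_left)
      also have "\<dots> = (\<Sum>S \<in> Pow {..<n}. if S = T then d S else 0)"
        by (intro sum.cong refl) (use T in \<open>simp add: orth\<close>)
      also have "\<dots> = d T" using T by simp
      finally show ?thesis by simp
    qed
    then show "d = c"
      using d by (intro extensionalityI[of d "Pow {..<n}" c]) (auto simp: c_def)
  qed
qed

end

theory Submission
  imports Defs
begin

text \<open>
  Let \<open>P\<close> be the part of degree at most \<open>d\<close> of the noisy function \<open>T\<^sub>\<gamma> f\<close>, read as a multilinear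
  polynomial in the normalised coordinates \<open>\<chi>(z\<^sub>i)\<close>, and let \<open>F\<close> be the nearest-point projection of
  \<open>P\<close> onto \<open>K\<close>. Correlations of such polynomials depend only on the coefficients and on the
  correlation \<open>\<rho>\<close> of one coordinate pair, so they agree exactly under \<open>N\<close> and under the Gaussian; and
  since \<open>\<bar>\<rho>\<bar>\<close> is bounded away from 1 on \<open>[-\<theta>0, \<theta>0]\<close>, passing from \<open>f\<close> to \<open>P\<close> costs little.

  What remains is that \<open>P\<close> is close to \<open>K\<close> in \<open>L\<^sup>2\<close> under the Gaussian. On the cube \<open>T\<^sub>\<gamma> f\<close> takes values
  in \<open>K\<close>, being an average of values of \<open>f\<close>, and \<open>P\<close> is \<open>L\<^sup>2\<close>-close to it. By compactness the distance
  to \<open>K\<close> is controlled by finitely many half-spaces, so that only scalar polynomials and one smooth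
  scalar test function have to be carried over to the Gaussian. This is the Lindeberg replacement
  argument, where the error of each replacement is bounded by the fourth moment of a partial
  derivative of low degree, hence by the square of an influence.
\<close>

section \<open>Multilinear polynomials and a one-sided test function\<close>

text \<open>The noise is there for the truncation. The weight of \<open>f\<close> above degree
  \<open>d\<close> need not be small for any \<open>d\<close> chosen independently of
  \<open>n\<close>, whereas for the noisy function it is at most \<open>\<gamma> ^ d\<close>.
  Conversely \<gamma> must be so close to 1 that low degrees survive almost unchanged; high degrees
  are suppressed in the correlation by \<open>\<rho> ^ card S\<close> anyway. Both demands are met
  by fixing \<gamma> first, from a bound \<open>r0 < 1\<close> on the correlations, and only then
  taking \<open>d\<close> large.

  The mappings and \<tau> may depend neither on \<theta> nor on the partner function. Closeness to
  \<open>K\<close> is therefore proved for one function at a time, with constants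
  (\<open>r0\<close>, \<open>fourth_bound\<close>) that are uniform in \<theta>; the pair enters
  only through an exact bilinear identity in the Fourier coefficients.

  Independence of \<open>n\<close> comes from the order of choices: \<gamma>, the half-spaces and
  \<open>d\<close> are fixed by \<open>K\<close>, \<epsilon> and \<open>r0\<close>, and \<tau> by
  these and a fourth-moment bound. Constants that grow with \<open>n\<close> occur only in
  integrability proofs.\<close>

definition mlin :: "(nat set \<Rightarrow> real) \<Rightarrow> nat set \<Rightarrow> (nat \<Rightarrow> real) \<Rightarrow> real" where
  "mlin c I x = (\<Sum>S\<in>Pow I. c S * (\<Prod>i\<in>S. x i))"

lemma mlin_cong: "(\<And>i. i \<in> I \<Longrightarrow> x i = y i) \<Longrightarrow> mlin c I x = mlin c I y"
  unfolding mlin_def by (intro sum.cong refl arg_cong2[where f = "(*)"] prod.cong) auto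

lemma sum_Pow_insert:
  assumes "finite I" "i \<notin> I"
  shows "(\<Sum>S\<in>Pow (insert i I). h S) = (\<Sum>S\<in>Pow I. h S) + (\<Sum>S\<in>Pow I. h (insert i S))"
proof -
  have inj: "inj_on (insert i) (Pow I)"
    using assms(2) by (intro inj_onI) (metis PowD insert_ident subsetD)
  have "(\<Sum>S\<in>Pow (insert i I). h S) = (\<Sum>S\<in>Pow I. h S) + (\<Sum>S\<in>insert i ` Pow I. h S)"
    unfolding Pow_insert using assms by (intro sum.union_disjoint) auto
  then show ?thesis by (simp add: sum.reindex[OF inj])
qed

text \<open>The coefficient of \<open>x i\<close> is the partial derivative in direction
  \<open>i\<close>. The shift by \<open>insert i\<close> lowers the degree by one, and its sum of
  squares over \<open>Pow I\<close> is the influence of \<open>i\<close>; the induction for fourth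
  moments and the replacement step both split a polynomial this way.\<close>

lemma mlin_insert:
  assumes "finite I" "i \<notin> I"
  shows "mlin c (insert i I) x = mlin c I x + x i * mlin (\<lambda>S. c (insert i S)) I x"
proof -
  have "(\<Prod>j\<in>insert i S. x j) = x i * (\<Prod>j\<in>S. x j)" if "S \<in> Pow I" for S
    using that assms by (subst prod.insert) (auto intro: finite_subset)
  then have "(\<Sum>S\<in>Pow I. c (insert i S) * (\<Prod>j\<in>insert i S. x j)) =
      (\<Sum>S\<in>Pow I. x i * (c (insert i S) * (\<Prod>j\<in>S. x j)))"
    by (intro sum.cong refl) simp
  then show ?thesis
    unfolding mlin_def sum_Pow_insert[OF assms] by (simp only: sum_distrib_left)
qed

lemma mlin_diff: "mlin (\<lambda>S. c S - d S) I x = mlin c I x - mlin d I x"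
  by (simp add: mlin_def sum_subtractf left_diff_distrib)

lemma mlin_sum: "mlin (\<lambda>S. \<Sum>j\<in>J. a j * c j S) I x = (\<Sum>j\<in>J. a j * mlin (c j) I x)"
  unfolding mlin_def sum_distrib_left sum_distrib_right
  by (subst sum.swap) (simp add: mult_ac)

text \<open>Every monomial occurs in the expanded product. The bound serves integrability only, so
  its constant may depend on the number of coordinates.\<close>

lemma abs_mlin_le:
  assumes "finite I"
  shows "\<bar>mlin c I x\<bar> \<le> (\<Sum>S\<in>Pow I. \<bar>c S\<bar>) * (\<Prod>i\<in>I. 1 + \<bar>x i\<bar>)"
proof -
  have "\<bar>\<Prod>i\<in>S. x i\<bar> \<le> (\<Prod>i\<in>I. 1 + \<bar>x i\<bar>)" if "S \<in> Pow I" for S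
  proof -
    have "\<bar>\<Prod>i\<in>S. x i\<bar> \<le> (\<Prod>i\<in>S. 1 + \<bar>x i\<bar>)"
      unfolding abs_prod by (intro prod_mono) auto
    also have "\<dots> \<le> (\<Prod>i\<in>I. 1 + \<bar>x i\<bar>)"
      using that assms by (intro prod_mono2) auto
    finally show ?thesis .
  qed
  then show ?thesis
    unfolding mlin_def sum_distrib_right
    by (intro order.trans[OF sum_abs] sum_mono) (simp add: abs_mult mult_left_mono)
qed

lemma mlin_correlation:
  assumes "finite I"
    and int: "\<And>S T. S \<subseteq> I \<Longrightarrow> T \<subseteq> I \<Longrightarrow> integrable \<Omega> (\<lambda>w. (\<Prod>i\<in>S. u w i) * (\<Prod>i\<in>T. v w i))"
    and orth: "\<And>S T. S \<subseteq> I \<Longrightarrow> T \<subseteq> I \<Longrightarrow>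
      (\<integral>w. (\<Prod>i\<in>S. u w i) * (\<Prod>i\<in>T. v w i) \<partial>\<Omega>) = (if S = T then r ^ card S else 0)"
  shows "integrable \<Omega> (\<lambda>w. mlin c I (u w) * mlin d I (v w))"
    and "(\<integral>w. mlin c I (u w) * mlin d I (v w) \<partial>\<Omega>) = (\<Sum>S\<in>Pow I. c S * d S * r ^ card S)"
proof -
  have eq: "mlin c I (u w) * mlin d I (v w) =
      (\<Sum>S\<in>Pow I. \<Sum>T\<in>Pow I. c S * d T * ((\<Prod>i\<in>S. u w i) * (\<Prod>i\<in>T. v w i)))" for w
    unfolding mlin_def sum_product by (simp add: mult_ac)
  show "integrable \<Omega> (\<lambda>w. mlin c I (u w) * mlin d I (v w))"
    unfolding eq using int by (intro Bochner_Integration.integrable_sum integrable_mult_right) auto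
  have "(\<integral>w. mlin c I (u w) * mlin d I (v w) \<partial>\<Omega>) =
      (\<Sum>S\<in>Pow I. \<Sum>T\<in>Pow I. c S * d T * (if S = T then r ^ card S else 0))"
    unfolding eq using int
    by (subst Bochner_Integration.integral_sum) (auto simp: orth Bochner_Integration.integral_sum intro!: sum.cong)
  also have "\<dots> = (\<Sum>S\<in>Pow I. \<Sum>T\<in>Pow I. if S = T then c S * d S * r ^ card S else 0)"
    by (intro sum.cong refl) auto
  also have "\<dots> = (\<Sum>S\<in>Pow I. c S * d S * r ^ card S)"
    using assms(1) by (intro sum.cong refl) (simp add: sum.delta)
  finally show "(\<integral>w. mlin c I (u w) * mlin d I (v w) \<partial>\<Omega>) = (\<Sum>S\<in>Pow I. c S * d S * r ^ card S)" .
qed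

text \<open>\<open>E i\<close> is left abstract because the same computation is needed for
  \<open>Pi_pmf\<close> and for \<open>Pi\<^sub>M\<close>. A product of two monomials factorises
  into one of the four listed functions per coordinate, and a coordinate that lies in exactly one of
  \<open>S\<close> and \<open>T\<close> contributes the factor 0.\<close>

lemma mlin_correlation_product:
  fixes u v :: "'a \<Rightarrow> real" and \<Omega> :: "(nat \<Rightarrow> 'a) measure" and E :: "nat \<Rightarrow> ('a \<Rightarrow> real) \<Rightarrow> real"
  assumes I: "finite I"
    and int: "\<And>h. (\<And>i. i \<in> I \<Longrightarrow> h i \<in> {\<lambda>_. 1, u, v, \<lambda>x. u x * v x}) \<Longrightarrow>
      integrable \<Omega> (\<lambda>w. \<Prod>i\<in>I. h i (w i))"
    and prod: "\<And>h. (\<And>i. i \<in> I \<Longrightarrow> h i \<in> {\<lambda>_. 1, u, v, \<lambda>x. u x * v x}) \<Longrightarrow>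
      (\<integral>w. (\<Prod>i\<in>I. h i (w i)) \<partial>\<Omega>) = (\<Prod>i\<in>I. E i (h i))"
    and moments: "\<And>i. i \<in> I \<Longrightarrow> E i (\<lambda>_. 1) = 1" "\<And>i. i \<in> I \<Longrightarrow> E i u = 0" "\<And>i. i \<in> I \<Longrightarrow> E i v = 0"
      "\<And>i. i \<in> I \<Longrightarrow> E i (\<lambda>x. u x * v x) = r"
  shows "integrable \<Omega> (\<lambda>w. mlin c I (\<lambda>i. u (w i)) * mlin d I (\<lambda>i. v (w i)))"
    and "(\<integral>w. mlin c I (\<lambda>i. u (w i)) * mlin d I (\<lambda>i. v (w i)) \<partial>\<Omega>) = (\<Sum>S\<in>Pow I. c S * d S * r ^ card S)"
proof -
  have *: "integrable \<Omega> (\<lambda>w. (\<Prod>i\<in>S. u (w i)) * (\<Prod>i\<in>T. v (w i)))"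
    "(\<integral>w. (\<Prod>i\<in>S. u (w i)) * (\<Prod>i\<in>T. v (w i)) \<partial>\<Omega>) = (if S = T then r ^ card S else 0)"
    if ST: "S \<subseteq> I" "T \<subseteq> I" for S T
  proof -
    define h where "h i = (if i \<in> S then if i \<in> T then \<lambda>x. u x * v x else u else if i \<in> T then v else (\<lambda>_. 1))" for i
    have restr: "(\<Prod>i\<in>R. f i) = (\<Prod>i\<in>I. if i \<in> R then f i else 1)" if "R \<subseteq> I" for R and f :: "nat \<Rightarrow> real"
      using that I by (simp add: prod.If_cases Int_absorb1)
    have eq: "(\<Prod>i\<in>S. u (w i)) * (\<Prod>i\<in>T. v (w i)) = (\<Prod>i\<in>I. h i (w i))" for w
      unfolding restr[OF ST(1)] restr[OF ST(2)] prod.distrib[symmetric] by (intro prod.cong) (auto simp: h_def)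
    have h: "h i \<in> {\<lambda>_. 1, u, v, \<lambda>x. u x * v x}" for i by (simp add: h_def)
    show "integrable \<Omega> (\<lambda>w. (\<Prod>i\<in>S. u (w i)) * (\<Prod>i\<in>T. v (w i)))"
      unfolding eq using h by (rule int)
    have "(\<integral>w. (\<Prod>i\<in>S. u (w i)) * (\<Prod>i\<in>T. v (w i)) \<partial>\<Omega>) = (\<Prod>i\<in>I. E i (h i))"
      unfolding eq using h by (rule prod)
    also have "\<dots> = (\<Prod>i\<in>I. if i \<in> S then if i \<in> T then r else 0 else if i \<in> T then 0 else 1)"
      using moments by (intro prod.cong refl) (simp add: h_def)
    also have "\<dots> = (if S = T then r ^ card S else 0)"
    proof (cases "S = T")
      case True
      then have "(\<Prod>i\<in>I. if i \<in> S then if i \<in> T then r else 0 else if i \<in> T then 0 else 1) = (\<Prod>i\<in>I. if i \<in> S then r else 1)"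
        by (intro prod.cong) auto
      also have "\<dots> = (\<Prod>i\<in>S. r)" using restr[OF ST(1), of "\<lambda>_. r"] by simp
      finally show ?thesis using True by simp
    next
      case False
      then obtain i where "i \<in> I" "(i \<in> S) \<noteq> (i \<in> T)" using ST by blast
      then show ?thesis using I False by (auto intro!: prod_zero)
    qed
    finally show "(\<integral>w. (\<Prod>i\<in>S. u (w i)) * (\<Prod>i\<in>T. v (w i)) \<partial>\<Omega>) = (if S = T then r ^ card S else 0)" .
  qed
  show "integrable \<Omega> (\<lambda>w. mlin c I (\<lambda>i. u (w i)) * mlin d I (\<lambda>i. v (w i)))"
    using I * by (rule mlin_correlation(1)) auto
  show "(\<integral>w. mlin c I (\<lambda>i. u (w i)) * mlin d I (\<lambda>i. v (w i)) \<partial>\<Omega>) = (\<Sum>S\<in>Pow I. c S * d S * r ^ card S)"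
    using I * by (rule mlin_correlation(2)) auto
qed

text \<open>
  The second derivative of \<open>hinge\<close> is the truncation of \<open>t\<close> to \<open>[0, 1]\<close>. It is Lipschitz, which gives
  a cubic Taylor remainder, and bounded, so that \<open>hinge t \<le> t\<^sup>2\<close>: an \<open>L\<^sup>2\<close> error is all that is known
  about the truncation to degree \<open>d\<close>.
\<close>

definition hinge :: "real \<Rightarrow> real" where
  "hinge t = (max 0 t ^ 3 - max 0 (t - 1) ^ 3) / 6"

definition hinge_deriv :: "real \<Rightarrow> real" where
  "hinge_deriv t = (max 0 t ^ 2 - max 0 (t - 1) ^ 2) / 2"

definition hinge_deriv2 :: "real \<Rightarrow> real" where
  "hinge_deriv2 t = max 0 t - max 0 (t - 1)"

lemma hinge_measurable [measurable]:
  "hinge \<in> borel_measurable borel" "hinge_deriv \<in> borel_measurable borel" "hinge_deriv2 \<in> borel_measurable borel"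
  unfolding hinge_def[abs_def] hinge_deriv_def[abs_def] hinge_deriv2_def[abs_def] by measurable

text \<open>If \<open>a\<close> and \<open>a + h\<close> are nonnegative, the remainder is exactly
  \<open>h ^ 3\<close>. If only \<open>a\<close> is, \<open>(a + h) ^ 3\<close> is subtracted from
  this, which has the same sign and smaller modulus; if only \<open>a + h\<close> is, the remainder
  is \<open>(a + h) ^ 3\<close> and lies between 0 and \<open>h ^ 3\<close>.\<close>

lemma pos_part_cube_Taylor:
  fixes a h :: real
  shows "\<bar>max 0 (a + h) ^ 3 - max 0 a ^ 3 - 3 * max 0 a ^ 2 * h - 3 * max 0 a * h ^ 2\<bar> \<le> \<bar>h\<bar> ^ 3"
proof (cases "a \<ge> 0")
  case a: True
  have id: "(a + h) ^ 3 - a ^ 3 - 3 * a ^ 2 * h - 3 * a * h ^ 2 = h ^ 3"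
    by (simp add: power2_eq_square power3_eq_cube algebra_simps)
  show ?thesis
  proof (cases "a + h \<ge> 0")
    case True
    then show ?thesis using a id by (simp add: power_abs)
  next
    case False
    have n: "(- t) ^ 3 = - (t ^ 3)" for t :: real by (simp add: power3_eq_cube)
    have "(- (a + h)) ^ 3 \<le> (- h) ^ 3" using False a by (intro power_mono) auto
    then have 1: "h ^ 3 \<le> (a + h) ^ 3" unfolding n by linarith
    have "(- (a + h)) ^ 3 \<ge> 0" using False by (intro zero_le_power) auto
    then have 2: "(a + h) ^ 3 \<le> 0" unfolding n by linarith
    have 3: "\<bar>h\<bar> ^ 3 = - (h ^ 3)" using False a by (simp add: abs_if n)
    have "max 0 (a + h) = 0" "max 0 a = a" using False a by auto
    then have "max 0 (a + h) ^ 3 - max 0 a ^ 3 - 3 * max 0 a ^ 2 * h - 3 * max 0 a * h ^ 2 = h ^ 3 - (a + h) ^ 3"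
      using id by simp
    then show ?thesis using 1 2 3 by linarith
  qed
next
  case a: False
  show ?thesis
  proof (cases "a + h \<ge> 0")
    case True
    then have "\<bar>h\<bar> = h" "(a + h) ^ 3 \<le> h ^ 3" "(a + h) ^ 3 \<ge> 0" "max 0 (a + h) = a + h" "max 0 a = 0"
      using a by (auto intro!: power_mono)
    then show ?thesis by simp
  next
    case False
    then have "max 0 (a + h) = 0" "max 0 a = 0" using a by auto
    then show ?thesis by simp
  qed
qed

lemma hinge_Taylor:
  "\<bar>hinge (a + h) - hinge a - hinge_deriv a * h - hinge_deriv2 a * h ^ 2 / 2\<bar> \<le> \<bar>h\<bar> ^ 3 / 3"
proof -
  have eq: "hinge (a + h) - hinge a - hinge_deriv a * h - hinge_deriv2 a * h ^ 2 / 2 =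
    ((max 0 (a + h) ^ 3 - max 0 a ^ 3 - 3 * max 0 a ^ 2 * h - 3 * max 0 a * h ^ 2)
     - (max 0 (a - 1 + h) ^ 3 - max 0 (a - 1) ^ 3 - 3 * max 0 (a - 1) ^ 2 * h - 3 * max 0 (a - 1) * h ^ 2)) / 6"
    unfolding hinge_def hinge_deriv_def hinge_deriv2_def by (simp add: algebra_simps diff_divide_distrib add_divide_distrib)
  have "\<bar>(A - B) / 6\<bar> \<le> c / 3" if "\<bar>A\<bar> \<le> c" "\<bar>B\<bar> \<le> c" for A B c :: real
    using that by (simp add: abs_le_iff)
  then show ?thesis
    unfolding eq using pos_part_cube_Taylor by blast
qed

text \<open>AM-GM for \<open>s * h ^ 2\<close> and \<open>h ^ 4 / s\<close>. It trades the
  third-order Taylor error for second and fourth moments, so that hypercontractivity is needed for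
  the exponent 4 only; \<open>s\<close> is later set against the influences.\<close>

lemma abs_cube_le:
  fixes h s :: real
  assumes "s > 0"
  shows "\<bar>h\<bar> ^ 3 \<le> (s * h ^ 2 + h ^ 4 / s) / 2"
proof -
  have "0 \<le> h ^ 2 * (s - \<bar>h\<bar>) ^ 2 / s" using assms by simp
  also have "\<dots> = s * h ^ 2 - 2 * \<bar>h\<bar> ^ 3 + h ^ 4 / s"
  proof -
    have "h ^ 2 = \<bar>h\<bar> ^ 2" "h ^ 4 = \<bar>h\<bar> ^ 4" by simp_all
    then show ?thesis using assms by (simp add: field_simps power2_eq_square power3_eq_cube power4_eq_xxxx)
  qed
  finally show ?thesis by simp
qed

lemma hinge_nonneg: "0 \<le> hinge t"
  unfolding hinge_def by (simp add: power_mono)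

lemma hinge_eq:
  "hinge t = (if t \<le> 0 then 0 else if t \<le> 1 then t ^ 3 / 6 else (3 * t ^ 2 - 3 * t + 1) / 6)"
proof (cases "t \<le> 1")
  case False
  have "t ^ 3 - (t - 1) ^ 3 = 3 * t ^ 2 - 3 * t + 1"
    by (simp add: power2_eq_square power3_eq_cube algebra_simps)
  with False show ?thesis by (simp add: hinge_def)
qed (auto simp: hinge_def max_def)

text \<open>This lets the hinge of a violated half-space pay for a squared distance. The constant
  comes from \<open>9/4 * t ^ 2 - 3 * t + 1 = (3 * t / 2 - 1) ^ 2\<close>.\<close>

lemma hinge_ge: "t \<ge> 1 \<Longrightarrow> t ^ 2 / 8 \<le> hinge t"
proof -
  assume "t \<ge> 1"
  then have "hinge t = (3 * t ^ 2 - 3 * t + 1) / 6"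
    by (cases "t = 1") (auto simp: hinge_eq)
  moreover have "0 \<le> (3 * t / 2 - 1) ^ 2" by simp
  then have "3 * t ^ 2 / 4 \<le> 3 * t ^ 2 - 3 * t + 1"
    by (simp add: power2_eq_square algebra_simps)
  ultimately show ?thesis by simp
qed

text \<open>In the application \<open>t\<close> is the amount by which the truncated polynomial
  violates a half-space and \<open>u\<close> is the truncation error, whose square can be
  integrated. The sign of \<open>u\<close> is free because \<open>hinge\<close> vanishes on the
  negative axis.\<close>

lemma hinge_le:
  assumes "t \<le> u"
  shows "hinge t \<le> u ^ 2"
proof (cases "t \<le> 0")
  case False
  have "hinge t \<le> t ^ 2"
  proof (cases "t \<le> 1")
    case True
    have "t ^ 3 = t ^ 2 * t" by (simp add: power2_eq_square power3_eq_cube)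
    also have "\<dots> \<le> t ^ 2 * 1" using True False by (intro mult_left_mono) auto
    finally have "t ^ 3 \<le> t ^ 2" by simp
    then have "t ^ 3 / 6 \<le> t ^ 2" using False zero_le_power2[of t] by linarith
    then show ?thesis using True False by (simp add: hinge_eq)
  next
    case gt: False
    have "(3 * t ^ 2 - 3 * t + 1) / 6 \<le> t ^ 2" using gt zero_le_power2[of t] by argo
    then show ?thesis using gt False by (simp add: hinge_eq)
  qed
  also have "t ^ 2 \<le> u ^ 2" using False assms by (intro power_mono) auto
  finally show ?thesis .
qed (simp add: hinge_eq)

lemma hinge_deriv2_bounds: "0 \<le> hinge_deriv2 t" "hinge_deriv2 t \<le> 1"
  unfolding hinge_deriv2_def by auto

lemma abs_hinge_deriv_le: "\<bar>hinge_deriv t\<bar> \<le> 1 + t ^ 2"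
proof -
  have "max 0 (t - 1) ^ 2 \<le> max 0 t ^ 2" by (intro power_mono) auto
  moreover have "max 0 t ^ 2 \<le> t ^ 2" by (auto simp: max_def)
  moreover have "0 \<le> max 0 (t - 1) ^ 2" by simp
  ultimately show ?thesis unfolding hinge_deriv_def using zero_le_power2[of t] by (simp only: abs_le_iff) argo
qed

section \<open>Products of normalised coordinates\<close>

text \<open>The measure may vary with the coordinate while \<open>X\<close> is fixed, which admits
  the hybrid products of the replacement argument. \<open>B\<close> bounds the fourth moments
  uniformly over the coordinates.\<close>

locale std_coords =
  fixes M :: "nat \<Rightarrow> 'a measure" and X :: "'a \<Rightarrow> real" and B :: real
  assumes prob: "\<And>i. prob_space (M i)"
    and X_measurable [measurable]: "\<And>i. X \<in> borel_measurable (M i)"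
    and X4: "\<And>i. integrable (M i) (\<lambda>w. X w ^ 4)"
    and mean: "\<And>i. (\<integral>w. X w \<partial>M i) = 0"
    and variance: "\<And>i. (\<integral>w. X w ^ 2 \<partial>M i) = 1"
    and fourth: "\<And>i. (\<integral>w. X w ^ 4 \<partial>M i) \<le> B"

sublocale std_coords \<subseteq> M?: prob_space "M i" for i
  by (rule prob)

sublocale std_coords \<subseteq> product_sigma_finite M
  by unfold_locales

context std_coords
begin

section \<open>Integrability through polynomial growth\<close>

lemma integrable_X_power:
  assumes "k \<le> 4"
  shows "integrable (M i) (\<lambda>w. \<bar>X w\<bar> ^ k)"
proof (rule Bochner_Integration.integrable_bound)
  show "integrable (M i) (\<lambda>w. 1 + X w ^ 4)" using X4 by simp
  have "\<bar>t\<bar> ^ k \<le> 1 + t ^ 4" for t :: real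
  proof (cases "\<bar>t\<bar> \<le> 1")
    case True
    then have "\<bar>t\<bar> ^ k \<le> 1" by (simp add: power_le_one)
    also have "1 \<le> 1 + t ^ 4" by simp
    finally show ?thesis .
  next
    case False
    then have "\<bar>t\<bar> ^ k \<le> \<bar>t\<bar> ^ 4" using assms by (intro power_increasing) auto
    then show ?thesis by simp
  qed
  then show "AE w in M i. norm (\<bar>X w\<bar> ^ k) \<le> norm (1 + X w ^ 4)" by simp
qed measurable

text \<open>
  The fourth power of the envelope is integrable, and every integrand below is bounded by a
  multiple of a power at most 4 of it.
\<close>

definition envelope :: "nat set \<Rightarrow> (nat \<Rightarrow> 'a) \<Rightarrow> real" where
  "envelope I w = (\<Prod>i\<in>I. 1 + \<bar>X (w i)\<bar>)"

definition grows :: "nat set \<Rightarrow> nat \<Rightarrow> ((nat \<Rightarrow> 'a) \<Rightarrow> real) \<Rightarrow> bool" where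
  "grows I k F \<longleftrightarrow> F \<in> borel_measurable (Pi\<^sub>M I M) \<and> (\<exists>C. \<forall>w. \<bar>F w\<bar> \<le> C * envelope I w ^ k)"

lemma envelope_ge_1: "1 \<le> envelope I w"
  unfolding envelope_def by (intro prod_ge_1) auto

lemma growsI:
  "F \<in> borel_measurable (Pi\<^sub>M I M) \<Longrightarrow> (\<And>w. \<bar>F w\<bar> \<le> C * envelope I w ^ k) \<Longrightarrow> grows I k F"
  unfolding grows_def by blast

lemma growsE:
  assumes "grows I k F"
  shows "\<exists>C\<ge>0. \<forall>w. \<bar>F w\<bar> \<le> C * envelope I w ^ k"
proof -
  obtain C where C: "\<And>w. \<bar>F w\<bar> \<le> C * envelope I w ^ k" using assms unfolding grows_def by blast
  have "\<bar>F w\<bar> \<le> \<bar>C\<bar> * envelope I w ^ k" for w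
    using envelope_ge_1[of I w] by (intro order.trans[OF C] mult_right_mono) auto
  then show ?thesis by (intro exI[of _ "\<bar>C\<bar>"]) auto
qed

lemma grows_measurable: "grows I k F \<Longrightarrow> F \<in> borel_measurable (Pi\<^sub>M I M)"
  unfolding grows_def by blast

lemma grows_le:
  assumes "grows I k F" "k \<le> l"
  shows "grows I l F"
proof -
  obtain C where C: "C \<ge> 0" "\<And>w. \<bar>F w\<bar> \<le> C * envelope I w ^ k" using growsE[OF assms(1)] by auto
  have "\<bar>F w\<bar> \<le> C * envelope I w ^ l" for w
    using C assms(2) envelope_ge_1[of I w]
    by (intro order.trans[OF C(2)] mult_left_mono power_increasing) auto
  then show ?thesis by (rule growsI[OF grows_measurable[OF assms(1)]])
qed

lemma grows_mult:
  assumes F: "grows I k F" and G: "grows I l G"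
  shows "grows I (k + l) (\<lambda>w. F w * G w)"
proof -
  obtain C where C: "C \<ge> 0" "\<And>w. \<bar>F w\<bar> \<le> C * envelope I w ^ k" using growsE[OF F] by auto
  obtain D where D: "D \<ge> 0" "\<And>w. \<bar>G w\<bar> \<le> D * envelope I w ^ l" using growsE[OF G] by auto
  have "\<bar>F w * G w\<bar> \<le> (C * envelope I w ^ k) * (D * envelope I w ^ l)" for w
    unfolding abs_mult using C D envelope_ge_1[of I w] by (intro mult_mono) auto
  then have "\<bar>F w * G w\<bar> \<le> (C * D) * envelope I w ^ (k + l)" for w
    by (simp add: power_add mult_ac)
  then show ?thesis
    by (rule growsI[OF borel_measurable_times[OF grows_measurable[OF F] grows_measurable[OF G]]])
qed

lemma grows_add:
  assumes F: "grows I k F" and G: "grows I k G"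
  shows "grows I k (\<lambda>w. F w + G w)"
proof -
  obtain C where C: "C \<ge> 0" "\<And>w. \<bar>F w\<bar> \<le> C * envelope I w ^ k" using growsE[OF F] by auto
  obtain D where D: "D \<ge> 0" "\<And>w. \<bar>G w\<bar> \<le> D * envelope I w ^ k" using growsE[OF G] by auto
  have "\<bar>F w + G w\<bar> \<le> (C + D) * envelope I w ^ k" for w
    using C(2)[of w] D(2)[of w] by (simp add: distrib_right)
  then show ?thesis
    by (rule growsI[OF borel_measurable_add[OF grows_measurable[OF F] grows_measurable[OF G]]])
qed

lemma grows_const: "grows I k (\<lambda>w. a)"
proof (rule growsI)
  fix w :: "nat \<Rightarrow> 'a"
  have "\<bar>a\<bar> * 1 \<le> \<bar>a\<bar> * envelope I w ^ k"
    using envelope_ge_1[of I w] by (intro mult_left_mono one_le_power) auto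
  then show "\<bar>a\<bar> \<le> \<bar>a\<bar> * envelope I w ^ k" by simp
qed simp

lemma grows_cmult: "grows I k F \<Longrightarrow> grows I k (\<lambda>w. a * F w)"
  using grows_mult[OF grows_const[of I 0 a]] by auto

lemma grows_diff: "grows I k F \<Longrightarrow> grows I k G \<Longrightarrow> grows I k (\<lambda>w. F w - G w)"
  using grows_add[of I k F "\<lambda>w. -1 * G w"] grows_cmult[of I k G "-1"] by simp

lemma grows_power: "grows I k F \<Longrightarrow> grows I (m * k) (\<lambda>w. F w ^ m)"
  by (induction m) (auto intro: grows_const grows_mult)

lemma grows_mlin:
  assumes "finite I" "J \<subseteq> I"
  shows "grows I 1 (\<lambda>w. mlin c J (\<lambda>i. X (w i)))"
proof (rule growsI)
  show "(\<lambda>w. mlin c J (\<lambda>i. X (w i))) \<in> borel_measurable (Pi\<^sub>M I M)"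
  proof -
    have "(\<lambda>w. X (w i)) \<in> borel_measurable (Pi\<^sub>M I M)" if "i \<in> I" for i
      using that by measurable
    then show ?thesis
      unfolding mlin_def using assms(2)
      by (intro borel_measurable_sum borel_measurable_times borel_measurable_prod) auto
  qed
  fix w
  have "\<bar>mlin c J (\<lambda>i. X (w i))\<bar> \<le> (\<Sum>S\<in>Pow J. \<bar>c S\<bar>) * (\<Prod>i\<in>J. 1 + \<bar>X (w i)\<bar>)"
    using assms by (intro abs_mlin_le) (auto intro: finite_subset)
  also have "\<dots> \<le> (\<Sum>S\<in>Pow J. \<bar>c S\<bar>) * envelope I w ^ 1"
    unfolding envelope_def power_one_right using assms
    by (intro mult_left_mono prod_mono2 sum_nonneg) auto
  finally show "\<bar>mlin c J (\<lambda>i. X (w i))\<bar> \<le> (\<Sum>S\<in>Pow J. \<bar>c S\<bar>) * envelope I w ^ 1" .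
qed

lemma integrable_grows:
  assumes "finite I" "grows I k F" "k \<le> 4"
  shows "integrable (Pi\<^sub>M I M) F"
proof -
  obtain C where C: "C \<ge> 0" "\<And>w. \<bar>F w\<bar> \<le> C * envelope I w ^ 4"
    using growsE[OF grows_le[OF assms(2,3)]] by auto
  show ?thesis
  proof (rule Bochner_Integration.integrable_bound)
    have "integrable (M i) (\<lambda>x. (1 + \<bar>X x\<bar>) ^ 4)" for i
    proof (rule Bochner_Integration.integrable_bound)
      show "integrable (M i) (\<lambda>x. 8 * (1 + X x ^ 4))" using X4 by simp
      have "(1 + t) ^ 4 \<le> 8 * (1 + t ^ 4)" if "t \<ge> 0" for t :: real
      proof -
        have "(1 + t) ^ 2 \<le> 2 * (1 + t ^ 2)"
          using zero_le_power2[of "1 - t"] by (simp add: power2_eq_square algebra_simps)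
        then have "((1 + t) ^ 2) ^ 2 \<le> (2 * (1 + t ^ 2)) ^ 2" by (intro power_mono) auto
        also have "\<dots> = 4 * (1 + t ^ 2) ^ 2" by (simp add: power2_eq_square algebra_simps)
        also have "(1 + t ^ 2) ^ 2 \<le> 2 * (1 + (t ^ 2) ^ 2)"
          using zero_le_power2[of "1 - t ^ 2"] by (simp add: power2_eq_square algebra_simps)
        finally show ?thesis by simp
      qed
      from this[of "\<bar>X x\<bar>" for x]
      show "AE x in M i. norm ((1 + \<bar>X x\<bar>) ^ 4) \<le> norm (8 * (1 + X x ^ 4))" by simp
    qed measurable
    then show "integrable (Pi\<^sub>M I M) (\<lambda>w. C * envelope I w ^ 4)"
      unfolding envelope_def prod_power_distrib
      using product_integrable_prod[of I "\<lambda>i x. (1 + \<bar>X x\<bar>) ^ 4"] assms(1) by simp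
    show "AE w in Pi\<^sub>M I M. norm (F w) \<le> norm (C * envelope I w ^ 4)"
      using C by (intro AE_I2) (metis abs_ge_self order.trans real_norm_def)
  qed (rule grows_measurable[OF assms(2)])
qed

text \<open>
  Coordinate \<open>k\<close> and the function \<open>H\<close> of the other coordinates may each use up the exponent 4,
  because the envelope factorises.
\<close>

lemma grows_factor:
  assumes J: "finite J" "k \<notin> J" and m: "m \<le> 4"
    and H: "grows J 4 H" "\<And>w. H (restrict w J) = H w"
  shows "grows (insert k J) 4 (\<lambda>w. X (w k) ^ m * H w)"
proof -
  obtain C where C: "C \<ge> 0" "\<And>w. \<bar>H w\<bar> \<le> C * envelope J w ^ 4" using growsE[OF H(1)] by auto
  have "(\<lambda>w. H (restrict w J)) \<in> borel_measurable (Pi\<^sub>M (insert k J) M)"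
    using measurable_compose[OF measurable_restrict_subset grows_measurable[OF H(1)], of "insert k J"]
    by auto
  then have "H \<in> borel_measurable (Pi\<^sub>M (insert k J) M)" by (simp add: H(2))
  moreover have "\<bar>X (w k) ^ m * H w\<bar> \<le> C * envelope (insert k J) w ^ 4" for w
  proof -
    have "\<bar>X (w k)\<bar> ^ m \<le> (1 + \<bar>X (w k)\<bar>) ^ m" by (intro power_mono) auto
    also have "\<dots> \<le> (1 + \<bar>X (w k)\<bar>) ^ 4" using m by (intro power_increasing) auto
    finally have "\<bar>X (w k) ^ m * H w\<bar> \<le> (1 + \<bar>X (w k)\<bar>) ^ 4 * (C * envelope J w ^ 4)"
      unfolding abs_mult power_abs using C envelope_ge_1[of J w] by (intro mult_mono) auto
    also have "\<dots> = C * envelope (insert k J) w ^ 4"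
      using J by (simp add: envelope_def power_mult_distrib)
    finally show ?thesis .
  qed
  ultimately show ?thesis by (intro growsI) measurable
qed

lemma integral_factor:
  assumes J: "finite J" "k \<notin> J" and m: "m \<le> 4"
    and H: "grows J 4 H" "\<And>w. H (restrict w J) = H w"
  shows "(\<integral>w. X (w k) ^ m * H w \<partial>Pi\<^sub>M (insert k J) M) = (\<integral>x. X x ^ m \<partial>M k) * (\<integral>w. H w \<partial>Pi\<^sub>M J M)"
proof -
  have "H (w(k := y)) = H w" for w y
    using J H(2)[of "w(k := y)"] H(2)[of w] by (simp add: restrict_upd)
  then have upd: "X ((w(k := y)) k) ^ m * H (w(k := y)) = X y ^ m * H w" for w y by simp
  have "integrable (Pi\<^sub>M (insert k J) M) (\<lambda>w. X (w k) ^ m * H w)"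
    using J by (intro integrable_grows[OF _ grows_factor[OF assms]]) auto
  then show ?thesis unfolding product_integral_insert[OF J \<open>integrable _ _\<close>] upd by simp
qed

lemma mlin_correlation_PiM:
  fixes u v :: "'a \<Rightarrow> real"
  assumes I: "finite I"
    and int: "\<And>i. i \<in> I \<Longrightarrow> integrable (M i) u" "\<And>i. i \<in> I \<Longrightarrow> integrable (M i) v"
      "\<And>i. i \<in> I \<Longrightarrow> integrable (M i) (\<lambda>x. u x * v x)"
    and moments: "\<And>i. i \<in> I \<Longrightarrow> (\<integral>x. u x \<partial>M i) = 0" "\<And>i. i \<in> I \<Longrightarrow> (\<integral>x. v x \<partial>M i) = 0"
      "\<And>i. i \<in> I \<Longrightarrow> (\<integral>x. u x * v x \<partial>M i) = r"
  shows "integrable (Pi\<^sub>M I M) (\<lambda>w. mlin c I (\<lambda>i. u (w i)) * mlin d I (\<lambda>i. v (w i)))"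
    and "(\<integral>w. mlin c I (\<lambda>i. u (w i)) * mlin d I (\<lambda>i. v (w i)) \<partial>Pi\<^sub>M I M) = (\<Sum>S\<in>Pow I. c S * d S * r ^ card S)"
proof -
  have 1: "integrable (Pi\<^sub>M I M) (\<lambda>w. \<Prod>i\<in>I. h i (w i))"
    "(\<integral>w. (\<Prod>i\<in>I. h i (w i)) \<partial>Pi\<^sub>M I M) = (\<Prod>i\<in>I. integral\<^sup>L (M i) (h i))"
    if h: "\<And>i. i \<in> I \<Longrightarrow> h i \<in> {\<lambda>_. 1, u, v, \<lambda>x. u x * v x}" for h
  proof -
    have "integrable (M i) (h i)" if "i \<in> I" for i using h[OF that] int[OF that] by auto
    then show "integrable (Pi\<^sub>M I M) (\<lambda>w. \<Prod>i\<in>I. h i (w i))"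
      "(\<integral>w. (\<Prod>i\<in>I. h i (w i)) \<partial>Pi\<^sub>M I M) = (\<Prod>i\<in>I. integral\<^sup>L (M i) (h i))"
      using I by (auto intro: product_integrable_prod product_integral_prod)
  qed
  show "integrable (Pi\<^sub>M I M) (\<lambda>w. mlin c I (\<lambda>i. u (w i)) * mlin d I (\<lambda>i. v (w i)))"
    by (rule mlin_correlation_product(1)[where E = "\<lambda>i. integral\<^sup>L (M i)", OF I 1])
      (auto simp: moments prob_space)
  show "(\<integral>w. mlin c I (\<lambda>i. u (w i)) * mlin d I (\<lambda>i. v (w i)) \<partial>Pi\<^sub>M I M) = (\<Sum>S\<in>Pow I. c S * d S * r ^ card S)"
    by (rule mlin_correlation_product(2)[where E = "\<lambda>i. integral\<^sup>L (M i)", OF I 1])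
      (auto simp: moments prob_space)
qed

lemma integrable_X: "integrable (M i) X" "integrable (M i) (\<lambda>x. X x * X x)"
proof -
  have "integrable (M i) (\<lambda>x. \<bar>X x\<bar>)" using integrable_X_power[of 1] by simp
  then show "integrable (M i) X" by (subst (asm) integrable_abs_iff) auto
  show "integrable (M i) (\<lambda>x. X x * X x)" using integrable_X_power[of 2] by (simp add: power2_eq_square)
qed

lemma mlin_second_moment:
  assumes "finite I"
  shows "(\<integral>w. mlin c I (\<lambda>i. X (w i)) ^ 2 \<partial>Pi\<^sub>M I M) = (\<Sum>S\<in>Pow I. c S ^ 2)"
  using mlin_correlation_PiM(2)[OF assms integrable_X(1) integrable_X(1) integrable_X(2) mean mean, of 1 c c]
    variance by (simp add: power2_eq_square)

end

section \<open>Hypercontractivity and the invariance principle\<close>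

context std_coords
begin

text \<open>Induction on the coordinates with \<open>P = A + X k * D\<close>, where \<open>D\<close>
  has degree one less. With \<open>a\<close> and \<open>b\<close> the squared norms of
  \<open>A\<close> and \<open>D\<close>, the three surviving terms are bounded by the three terms of
  \<open>C ^ d * (a + b) ^ 2\<close>: the mixed one requires \<open>C \<ge> 16\<close> and the one
  with \<open>D ^ 4\<close> requires \<open>C \<ge> 3 * B\<close>.\<close>

lemma fourth_moment:
  assumes C: "C \<ge> 16" "C \<ge> 3 * B"
    and I: "finite I"
    and deg: "\<And>S. S \<subseteq> I \<Longrightarrow> card S > d \<Longrightarrow> c S = 0"
  shows "(\<integral>w. mlin c I (\<lambda>i. X (w i)) ^ 4 \<partial>Pi\<^sub>M I M) \<le> C ^ d * (\<Sum>S\<in>Pow I. c S ^ 2) ^ 2"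
  using I deg
proof (induction I arbitrary: c d rule: finite_induct)
  case empty
  interpret E: prob_space "Pi\<^sub>M {} M" by (intro prob_space_PiM prob)
  have "mlin c {} x = c {}" for x by (simp add: mlin_def)
  moreover have "c {} ^ 4 \<le> C ^ d * c {} ^ 4"
    using C mult_right_mono[of 1 "C ^ d" "c {} ^ 4"] by simp
  ultimately show ?case by (simp add: E.prob_space flip: power_mult)
next
  case (insert k J)
  define e where "e S = c (insert k S)" for S
  let ?P = "\<lambda>w. mlin c (insert k J) (\<lambda>i. X (w i))"
  let ?A = "\<lambda>w. mlin c J (\<lambda>i. X (w i))"
  let ?D = "\<lambda>w. mlin e J (\<lambda>i. X (w i))"
  define a where "a = (\<Sum>S\<in>Pow J. c S ^ 2)"
  define b where "b = (\<Sum>S\<in>Pow J. e S ^ 2)"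
  let ?F = "Pi\<^sub>M (insert k J) M" and ?G = "Pi\<^sub>M J M"
  have norm: "(\<Sum>S\<in>Pow (insert k J). c S ^ 2) = a + b"
    unfolding a_def b_def e_def by (rule sum_Pow_insert[OF insert(1,2)])
  have ab: "a \<ge> 0" "b \<ge> 0" unfolding a_def b_def by (auto intro: sum_nonneg)
  have A: "(\<integral>w. ?A w ^ 4 \<partial>?G) \<le> C ^ d * a ^ 2"
    unfolding a_def using insert.prems by (intro insert.IH) auto
  have gJ: "grows J 1 ?A" "grows J 1 ?D" using insert(1) by (auto intro: grows_mlin simp del: One_nat_def)
  note gp = grows_power[OF gJ(1)] grows_power[OF gJ(2)]
  have res: "mlin h J (\<lambda>i. X (if i \<in> J then w i else undefined)) = mlin h J (\<lambda>i. X (w i))" for h w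
    by (rule mlin_cong) simp
  have g: "grows J 4 (\<lambda>w. ?A w ^ 4)" "grows J 4 (\<lambda>w. ?A w ^ 3 * ?D w)"
    "grows J 4 (\<lambda>w. ?A w ^ 2 * ?D w ^ 2)" "grows J 4 (\<lambda>w. ?D w ^ 4)"
    using gp(1)[of 4] grows_mult[OF gp(1)[of 3] gJ(2)] grows_mult[OF gp(1)[of 2] gp(2)[of 2]] gp(2)[of 4]
    by simp_all
  have int: "integrable ?F (\<lambda>w. X (w k) ^ m * H w)"
    if "m \<le> 4" "grows J 4 H" "\<And>w. H (restrict w J) = H w" for m H
    using insert(1) by (intro integrable_grows[OF _ grows_factor[OF insert(1,2) that]]) auto
  have int1: "integrable ?F (\<lambda>w. ?A w ^ 4)"
    using int[of 0 "\<lambda>w. ?A w ^ 4"] g by (simp add: res)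
  have int2: "integrable ?F (\<lambda>w. X (w k) * (?A w ^ 3 * ?D w))"
    using int[of 1 "\<lambda>w. ?A w ^ 3 * ?D w"] g by (simp add: res)
  have int3: "integrable ?F (\<lambda>w. X (w k) ^ 2 * (?A w ^ 2 * ?D w ^ 2))"
    using int[of 2 "\<lambda>w. ?A w ^ 2 * ?D w ^ 2"] g by (simp add: res)
  have int4: "integrable ?F (\<lambda>w. X (w k) ^ 4 * ?D w ^ 4)"
    using int[of 4 "\<lambda>w. ?D w ^ 4"] g by (simp add: res)
  note fac = integral_factor[OF insert(1,2)]
  have E1: "(\<integral>w. ?A w ^ 4 \<partial>?F) = (\<integral>w. ?A w ^ 4 \<partial>?G)"
    using fac[of 0 "\<lambda>w. ?A w ^ 4"] g by (simp add: res M.prob_space)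
  have E2: "(\<integral>w. X (w k) * (?A w ^ 3 * ?D w) \<partial>?F) = 0"
    using fac[of 1 "\<lambda>w. ?A w ^ 3 * ?D w"] g by (simp add: res mean)
  have E3: "(\<integral>w. X (w k) ^ 2 * (?A w ^ 2 * ?D w ^ 2) \<partial>?F) = (\<integral>w. ?A w ^ 2 * ?D w ^ 2 \<partial>?G)"
    using fac[of 2 "\<lambda>w. ?A w ^ 2 * ?D w ^ 2"] g by (simp add: res variance)
  have E4: "(\<integral>w. X (w k) ^ 4 * ?D w ^ 4 \<partial>?F) = (\<integral>x. X x ^ 4 \<partial>M k) * (\<integral>w. ?D w ^ 4 \<partial>?G)"
    using fac[of 4 "\<lambda>w. ?D w ^ 4"] g by (simp add: res)
  have intJ: "integrable ?G (\<lambda>w. ?A w ^ 4)" "integrable ?G (\<lambda>w. ?D w ^ 4)" "integrable ?G (\<lambda>w. ?A w ^ 2 * ?D w ^ 2)"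
    using insert(1) g by (auto intro: integrable_grows)
  have expand: "?P w ^ 4 \<le> ?A w ^ 4 + 4 * (X (w k) * (?A w ^ 3 * ?D w)) +
      8 * (X (w k) ^ 2 * (?A w ^ 2 * ?D w ^ 2)) + 3 * (X (w k) ^ 4 * ?D w ^ 4)" for w
  proof -
    have "?P w = ?A w + X (w k) * ?D w"
      unfolding e_def by (rule mlin_insert[OF insert(1,2)])
    moreover have "(p + x * q) ^ 4 \<le> p ^ 4 + 4 * (x * (p ^ 3 * q)) + 8 * (x ^ 2 * (p ^ 2 * q ^ 2)) + 3 * (x ^ 4 * q ^ 4)"
      for p q x :: real
    proof -
      \<comment> \<open>The term \<open>4 * x ^ 3 * p * q ^ 3\<close> would bring in the third
        moment of \<open>X\<close>, which need not vanish. It is absorbed into its neighbours, which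
        raises their coefficients from 6 and 1 to 8 and 3.\<close>
      have "0 \<le> 2 * (x * p * q - x ^ 2 * q ^ 2) ^ 2" by simp
      also have "\<dots> = p ^ 4 + 4 * (x * (p ^ 3 * q)) + 8 * (x ^ 2 * (p ^ 2 * q ^ 2)) + 3 * (x ^ 4 * q ^ 4) - (p + x * q) ^ 4"
        by (simp add: power2_eq_square power3_eq_cube power4_eq_xxxx algebra_simps)
      finally show ?thesis by simp
    qed
    ultimately show ?thesis by simp
  qed
  have "grows (insert k J) 4 (\<lambda>w. ?P w ^ 4)"
    using grows_power[OF grows_mlin[of "insert k J" "insert k J" c], of 4] insert(1) by simp
  then have "integrable ?F (\<lambda>w. ?P w ^ 4)"
    using insert(1) by (intro integrable_grows) auto
  then have "(\<integral>w. ?P w ^ 4 \<partial>?F) \<le> (\<integral>w. ?A w ^ 4 + 4 * (X (w k) * (?A w ^ 3 * ?D w)) +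
      8 * (X (w k) ^ 2 * (?A w ^ 2 * ?D w ^ 2)) + 3 * (X (w k) ^ 4 * ?D w ^ 4) \<partial>?F)"
    using int1 int2 int3 int4 expand by (intro integral_mono) auto
  also have "\<dots> = (\<integral>w. ?A w ^ 4 \<partial>?G) + 8 * (\<integral>w. ?A w ^ 2 * ?D w ^ 2 \<partial>?G) +
      3 * ((\<integral>x. X x ^ 4 \<partial>M k) * (\<integral>w. ?D w ^ 4 \<partial>?G))"
    using int1 int2 int3 int4 by (simp add: E1 E2 E3 E4)
  finally have main: "(\<integral>w. ?P w ^ 4 \<partial>?F) \<le> (\<integral>w. ?A w ^ 4 \<partial>?G) + 8 * (\<integral>w. ?A w ^ 2 * ?D w ^ 2 \<partial>?G) +
      3 * ((\<integral>x. X x ^ 4 \<partial>M k) * (\<integral>w. ?D w ^ 4 \<partial>?G))" .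
  have zero: "mlin h J x = 0" if "(\<Sum>S\<in>Pow J. h S ^ 2) = 0" for h x
    using that insert(1) by (simp add: mlin_def sum_nonneg_eq_0_iff)
  have D0: "?D w = 0" if "b = 0" for w using zero[of e] that by (simp add: b_def)
  have A0: "?A w = 0" if "a = 0" for w using zero[of c] that by (simp add: a_def)
  \<comment> \<open>The exponent drops by one for \<open>D\<close>, and the factor \<open>C\<close>
    gained in this way pays for the constants 16 and \<open>3 * B\<close>. In degree 0 there is no
    \<open>D\<close> at all, hence the premise on \<open>b\<close>.\<close>
  have D: "\<exists>d'. d = Suc d' \<and> (\<integral>w. ?D w ^ 4 \<partial>?G) \<le> C ^ d' * b ^ 2" if "b \<noteq> 0"
  proof (cases d)
    case 0
    have "e S = 0" if "S \<in> Pow J" for S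
      unfolding e_def using that insert(1,2) 0 finite_subset[of S J]
      by (intro insert.prems) (auto simp: card_gt_0_iff)
    then have "b = 0" by (simp add: b_def)
    with that show ?thesis by simp
  next
    case (Suc d')
    have "e S = 0" if "S \<subseteq> J" "card S > d'" for S
      unfolding e_def using that insert(1,2) Suc finite_subset[of S J] 
      by (intro insert.prems) (auto simp: card_insert_if)
    then show ?thesis unfolding b_def using Suc by (intro exI[of _ d'] conjI insert.IH) auto
  qed
  have m4: "0 \<le> (\<integral>x. X x ^ 4 \<partial>M k)" "(\<integral>x. X x ^ 4 \<partial>M k) \<le> B" using fourth by auto
  have D4: "3 * ((\<integral>x. X x ^ 4 \<partial>M k) * (\<integral>w. ?D w ^ 4 \<partial>?G)) \<le> C ^ d * b ^ 2"
  proof (cases "b = 0")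
    case False
    then obtain d' where d': "d = Suc d'" "(\<integral>w. ?D w ^ 4 \<partial>?G) \<le> C ^ d' * b ^ 2" using D by blast
    have "(3 * (\<integral>x. X x ^ 4 \<partial>M k)) * (\<integral>w. ?D w ^ 4 \<partial>?G) \<le> C * (C ^ d' * b ^ 2)"
      using m4 C d' by (intro mult_mono) auto
    then show ?thesis using d' by (simp add: mult_ac)
  qed (simp add: D0)
  have AD: "8 * (\<integral>w. ?A w ^ 2 * ?D w ^ 2 \<partial>?G) \<le> 2 * C ^ d * a * b"
  proof (cases "a = 0 \<or> b = 0")
    case False
    then have pos: "a > 0" "b > 0" using ab by auto
    obtain d' where d': "d = Suc d'" "(\<integral>w. ?D w ^ 4 \<partial>?G) \<le> C ^ d' * b ^ 2" using D False by blast
    \<comment> \<open>The weights \<open>b / a\<close> and \<open>16 * (a / b)\<close> turn the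
      bounds of order \<open>a ^ 2\<close> and \<open>b ^ 2\<close> into multiples of
      \<open>a * b\<close>; they have product 16, as the coefficient 8 demands.\<close>
    have "8 * (p ^ 2 * q ^ 2) \<le> (b / a) * p ^ 4 + 16 * (a / b) * q ^ 4" for p q :: real
    proof -
      have "0 \<le> (b * p ^ 2 - 4 * a * q ^ 2) ^ 2 / (a * b)" using pos by simp
      also have "\<dots> = (b / a) * p ^ 4 + 16 * (a / b) * q ^ 4 - 8 * (p ^ 2 * q ^ 2)"
        using pos by (simp add: field_simps power2_eq_square power4_eq_xxxx)
      finally show ?thesis by simp
    qed
    then have "8 * (\<integral>w. ?A w ^ 2 * ?D w ^ 2 \<partial>?G) \<le> (\<integral>w. (b / a) * ?A w ^ 4 + 16 * (a / b) * ?D w ^ 4 \<partial>?G)"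
      using intJ unfolding integral_mult_right_zero[symmetric] by (intro integral_mono) auto
    also have "\<dots> = (b / a) * (\<integral>w. ?A w ^ 4 \<partial>?G) + 16 * (a / b) * (\<integral>w. ?D w ^ 4 \<partial>?G)"
      using intJ by simp
    also have "\<dots> \<le> (b / a) * (C ^ d * a ^ 2) + 16 * (a / b) * (C ^ d' * b ^ 2)"
      using pos A d' by (intro add_mono mult_left_mono) auto
    also have "\<dots> = C ^ d * a * b + 16 * (C ^ d' * a * b)"
      using pos by (simp add: power2_eq_square)
    also have "\<dots> \<le> C ^ d * a * b + C * (C ^ d' * a * b)"
      using pos C by (intro add_left_mono mult_right_mono) auto
    finally show ?thesis using d' by simp
  qed (use A0 D0 in auto)
  have "(\<integral>w. ?P w ^ 4 \<partial>?F) \<le> C ^ d * a ^ 2 + 2 * C ^ d * a * b + C ^ d * b ^ 2"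
    using main A AD D4 by linarith
  then show ?case unfolding norm by (simp add: power2_sum algebra_simps)
qed

section \<open>Replacement of a single coordinate\<close>

lemma grows_hinge:
  assumes H: "grows I 1 H"
  shows "grows I 2 (\<lambda>w. hinge (H w))"
proof -
  obtain C where C: "C \<ge> 0" "\<And>w. \<bar>H w\<bar> \<le> C * envelope I w" using growsE[OF H] by auto
  show ?thesis
  proof (rule growsI)
    fix w
    have "hinge (H w) \<le> (H w) ^ 2" by (rule hinge_le) simp
    also have "\<dots> = \<bar>H w\<bar> ^ 2" by simp
    also have "\<dots> \<le> (C * envelope I w) ^ 2" using C by (intro power_mono) auto
    finally show "\<bar>hinge (H w)\<bar> \<le> C ^ 2 * envelope I w ^ 2" by (simp add: hinge_nonneg power_mult_distrib)
  qed (rule measurable_compose[OF grows_measurable[OF H] hinge_measurable(1)])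
qed

text \<open>The second integral is a reference value that does not see the law of coordinate
  \<open>k\<close>: the linear Taylor term vanishes and the quadratic one has \<open>X ^ 2\<close>
  averaged to 1. Two laws of that coordinate can thus be compared through it. The denominator 6
  combines the 3 of \<open>hinge_Taylor\<close> with the 2 of \<open>abs_cube_le\<close>.\<close>

lemma single_coordinate:
  fixes c :: "nat set \<Rightarrow> real" and b :: real
  assumes J: "finite J" "k \<notin> J" and s: "s > 0"
  defines "A \<equiv> \<lambda>w. mlin c J (\<lambda>i. X (w i)) - b"
    and "D \<equiv> \<lambda>w. mlin (\<lambda>S. c (insert k S)) J (\<lambda>i. X (w i))"
  shows "\<bar>(\<integral>w. hinge (mlin c (insert k J) (\<lambda>i. X (w i)) - b) \<partial>Pi\<^sub>M (insert k J) M)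
      - (\<integral>w. hinge (A w) + hinge_deriv2 (A w) * D w ^ 2 / 2 \<partial>Pi\<^sub>M J M)\<bar>
    \<le> (s * (\<integral>w. D w ^ 2 \<partial>Pi\<^sub>M J M) + B * (\<integral>w. D w ^ 4 \<partial>Pi\<^sub>M J M) / s) / 6"
proof -
  let ?P = "\<lambda>w. mlin c (insert k J) (\<lambda>i. X (w i)) - b"
  let ?F = "Pi\<^sub>M (insert k J) M" and ?G = "Pi\<^sub>M J M"
  have gJ: "grows J 1 A" "grows J 1 D" unfolding A_def D_def
    using J(1) by (auto intro!: grows_diff grows_mlin grows_const simp del: One_nat_def)
  have res: "A (restrict w J) = A w" "D (restrict w J) = D w" for w
    unfolding A_def D_def by (auto intro: mlin_cong)
  have g1: "grows J 2 (\<lambda>w. hinge_deriv (A w))"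
  proof -
    obtain C where C: "C \<ge> 0" "\<And>w. \<bar>A w\<bar> \<le> C * envelope J w" using growsE[OF gJ(1)] by auto
    show ?thesis
    proof (rule growsI)
      fix w
      have "\<bar>hinge_deriv (A w)\<bar> \<le> 1 ^ 2 + \<bar>A w\<bar> ^ 2" using abs_hinge_deriv_le[of "A w"] by simp
      also have "\<dots> \<le> envelope J w ^ 2 + (C * envelope J w) ^ 2"
        using C envelope_ge_1[of J w] by (intro add_mono power_mono) auto
      finally show "\<bar>hinge_deriv (A w)\<bar> \<le> (1 + C ^ 2) * envelope J w ^ 2"
        by (simp add: algebra_simps power_mult_distrib)
    qed (rule measurable_compose[OF grows_measurable[OF gJ(1)] hinge_measurable(2)])
  qed
  have g2: "grows J 0 (\<lambda>w. hinge_deriv2 (A w))"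
    using hinge_deriv2_bounds
    by (intro growsI[where C = 1] measurable_compose[OF grows_measurable[OF gJ(1)] hinge_measurable(3)]) (simp add: abs_le_iff)
  have g: "grows J 4 (\<lambda>w. hinge (A w))" "grows J 4 (\<lambda>w. hinge_deriv (A w) * D w)"
    "grows J 4 (\<lambda>w. hinge_deriv2 (A w) * D w ^ 2 / 2)" "grows J 4 (\<lambda>w. D w ^ 2)" "grows J 4 (\<lambda>w. D w ^ 4)"
  proof -
    show "grows J 4 (\<lambda>w. hinge (A w))" by (rule grows_le[OF grows_hinge[OF gJ(1)]]) simp
    show "grows J 4 (\<lambda>w. hinge_deriv (A w) * D w)" by (rule grows_le[OF grows_mult[OF g1 gJ(2)]]) simp
    show "grows J 4 (\<lambda>w. hinge_deriv2 (A w) * D w ^ 2 / 2)"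
      using grows_le[OF grows_cmult[OF grows_mult[OF g2 grows_power[OF gJ(2), of 2]], of "1/2"], of 4] by simp
    show "grows J 4 (\<lambda>w. D w ^ 2)" by (rule grows_le[OF grows_power[OF gJ(2), of 2]]) simp
    show "grows J 4 (\<lambda>w. D w ^ 4)" by (rule grows_le[OF grows_power[OF gJ(2), of 4]]) simp
  qed
  have int: "integrable ?F (\<lambda>w. X (w k) ^ m * H w)"
    if "m \<le> 4" "grows J 4 H" "\<And>w. H (restrict w J) = H w" for m H
    using J by (intro integrable_grows[OF _ grows_factor[OF J that]]) auto
  have int1: "integrable ?F (\<lambda>w. hinge (A w))"
    using int[of 0 "\<lambda>w. hinge (A w)"] g by (simp add: res)
  have int2: "integrable ?F (\<lambda>w. X (w k) * (hinge_deriv (A w) * D w))"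
    using int[of 1 "\<lambda>w. hinge_deriv (A w) * D w"] g by (simp add: res)
  have int3: "integrable ?F (\<lambda>w. X (w k) ^ 2 * (hinge_deriv2 (A w) * D w ^ 2 / 2))"
    using int[of 2 "\<lambda>w. hinge_deriv2 (A w) * D w ^ 2 / 2"] g by (simp add: res)
  have int4: "integrable ?F (\<lambda>w. X (w k) ^ 2 * D w ^ 2)"
    using int[of 2 "\<lambda>w. D w ^ 2"] g by (simp add: res)
  have int5: "integrable ?F (\<lambda>w. X (w k) ^ 4 * D w ^ 4)"
    using int[of 4 "\<lambda>w. D w ^ 4"] g by (simp add: res)
  note fac = integral_factor[OF J]
  have E1: "(\<integral>w. hinge (A w) \<partial>?F) = (\<integral>w. hinge (A w) \<partial>?G)"
    using fac[of 0 "\<lambda>w. hinge (A w)"] g by (simp add: res M.prob_space)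
  have E2: "(\<integral>w. X (w k) * (hinge_deriv (A w) * D w) \<partial>?F) = 0"
    using fac[of 1 "\<lambda>w. hinge_deriv (A w) * D w"] g by (simp add: res mean)
  have E3: "(\<integral>w. X (w k) ^ 2 * (hinge_deriv2 (A w) * D w ^ 2 / 2) \<partial>?F) = (\<integral>w. hinge_deriv2 (A w) * D w ^ 2 / 2 \<partial>?G)"
    using fac[of 2 "\<lambda>w. hinge_deriv2 (A w) * D w ^ 2 / 2"] g by (simp add: res variance)
  have E4: "(\<integral>w. X (w k) ^ 2 * D w ^ 2 \<partial>?F) = (\<integral>w. D w ^ 2 \<partial>?G)"
    using fac[of 2 "\<lambda>w. D w ^ 2"] g by (simp add: res variance)
  have E5: "(\<integral>w. X (w k) ^ 4 * D w ^ 4 \<partial>?F) = (\<integral>x. X x ^ 4 \<partial>M k) * (\<integral>w. D w ^ 4 \<partial>?G)"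
    using fac[of 4 "\<lambda>w. D w ^ 4"] g by (simp add: res)
  define R where "R w = hinge (?P w) - hinge (A w) - X (w k) * (hinge_deriv (A w) * D w) -
    X (w k) ^ 2 * (hinge_deriv2 (A w) * D w ^ 2 / 2)" for w
  have intP: "integrable ?F (\<lambda>w. hinge (?P w))"
    using J(1) by (intro integrable_grows[OF _ grows_hinge] grows_diff grows_mlin grows_const) auto
  have intR: "integrable ?F R"
    unfolding R_def using intP int1 int2 int3 by simp
  have "integral\<^sup>L ?F R = (\<integral>w. hinge (?P w) \<partial>?F) - (\<integral>w. hinge (A w) \<partial>?G) - (\<integral>w. hinge_deriv2 (A w) * D w ^ 2 / 2 \<partial>?G)"
    unfolding R_def using intP int1 int2 int3 by (simp add: E1 E2 E3[simplified])
  also have "\<dots> = (\<integral>w. hinge (?P w) \<partial>?F) - (\<integral>w. hinge (A w) + hinge_deriv2 (A w) * D w ^ 2 / 2 \<partial>?G)"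
    using J(1) integrable_grows[OF _ g(1)] integrable_grows[OF _ g(3)] by simp
  finally have R: "(\<integral>w. hinge (?P w) \<partial>?F) - (\<integral>w. hinge (A w) + hinge_deriv2 (A w) * D w ^ 2 / 2 \<partial>?G) = integral\<^sup>L ?F R" ..
  have "\<bar>R w\<bar> \<le> s / 6 * (X (w k) ^ 2 * D w ^ 2) + 1 / (6 * s) * (X (w k) ^ 4 * D w ^ 4)" for w
  proof -
    have P: "?P w = A w + X (w k) * D w"
      unfolding A_def D_def mlin_insert[OF J] by simp
    have "\<bar>R w\<bar> \<le> \<bar>X (w k) * D w\<bar> ^ 3 / 3"
      using hinge_Taylor[of "A w" "X (w k) * D w"] unfolding R_def P
      by (simp add: power_mult_distrib mult_ac)
    also have "\<dots> \<le> (s * (X (w k) * D w) ^ 2 + (X (w k) * D w) ^ 4 / s) / 2 / 3"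
      by (intro divide_right_mono abs_cube_le s) simp
    also have "\<dots> = s / 6 * (X (w k) ^ 2 * D w ^ 2) + 1 / (6 * s) * (X (w k) ^ 4 * D w ^ 4)"
      by (simp add: power_mult_distrib add_divide_distrib)
    finally show ?thesis .
  qed
  then have "(\<integral>w. \<bar>R w\<bar> \<partial>?F) \<le> (\<integral>w. s / 6 * (X (w k) ^ 2 * D w ^ 2) + 1 / (6 * s) * (X (w k) ^ 4 * D w ^ 4) \<partial>?F)"
    using intR int4 int5 by (intro integral_mono) auto
  also have "\<dots> = s / 6 * (\<integral>w. D w ^ 2 \<partial>?G) + 1 / (6 * s) * ((\<integral>x. X x ^ 4 \<partial>M k) * (\<integral>w. D w ^ 4 \<partial>?G))"
    using int4 int5 by (simp add: E4 E5)
  also have "\<dots> \<le> s / 6 * (\<integral>w. D w ^ 2 \<partial>?G) + 1 / (6 * s) * (B * (\<integral>w. D w ^ 4 \<partial>?G))"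
    using s fourth by (intro add_left_mono mult_left_mono mult_right_mono) auto
  also have "\<dots> = (s * (\<integral>w. D w ^ 2 \<partial>?G) + B * (\<integral>w. D w ^ 4 \<partial>?G) / s) / 6"
    by (simp add: add_divide_distrib)
  finally show ?thesis
    unfolding R using integral_abs_bound[of ?F R] by linarith
qed

end

text \<open>A telescope over the hybrids \<open>Q k\<close>, whose first \<open>k\<close>
  coordinates follow \<nu> and the others \<mu>. The hypothesis \<open>inf\<close> is what makes the
  fourth-moment part of each step no larger than the second-moment part, so that a step costs at
  most \<open>s\<close> times an influence.\<close>

lemma invariance:
  assumes \<mu>: "std_coords (\<lambda>_. \<mu>) X B" and \<nu>: "std_coords (\<lambda>_. \<nu>) X B"
    and C: "C \<ge> 16" "C \<ge> 3 * B"
    and deg: "\<And>S. S \<subseteq> {..<n} \<Longrightarrow> card S > d \<Longrightarrow> c S = 0"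
    and s: "s > 0"
    and inf: "\<And>k. k < n \<Longrightarrow> B * C ^ d * (\<Sum>S | S \<subseteq> {..<n} \<and> k \<in> S. c S ^ 2) \<le> s ^ 2"
  shows "\<bar>(\<integral>w. hinge (mlin c {..<n} (\<lambda>i. X (w i)) - b) \<partial>Pi\<^sub>M {..<n} (\<lambda>_. \<mu>))
      - (\<integral>w. hinge (mlin c {..<n} (\<lambda>i. X (w i)) - b) \<partial>Pi\<^sub>M {..<n} (\<lambda>_. \<nu>))\<bar>
    \<le> s * d * (\<Sum>S\<in>Pow {..<n}. c S ^ 2)"
proof -
  define Q where "Q k = (\<lambda>i::nat. if i < k then \<nu> else \<mu>)" for k :: nat
  have Q: "std_coords (Q k) X B" for k
    using \<mu> \<nu> unfolding std_coords_def Q_def by auto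
  define H where "H k = (\<integral>w. hinge (mlin c {..<n} (\<lambda>i. X (w i)) - b) \<partial>Pi\<^sub>M {..<n} (Q k))" for k
  define V where "V k = (\<Sum>S | S \<subseteq> {..<n} \<and> k \<in> S. c S ^ 2)" for k
  have step: "\<bar>H k - H (Suc k)\<bar> \<le> s * V k" if k: "k < n" for k
  proof -
    define J where "J = {..<n} - {k}"
    have J: "finite J" "k \<notin> J" "{..<n} = insert k J" using k by (auto simp: J_def)
    define e where "e S = c (insert k S)" for S
    define L where "L M = (\<integral>w. hinge (mlin c J (\<lambda>i. X (w i)) - b) +
      hinge_deriv2 (mlin c J (\<lambda>i. X (w i)) - b) * mlin e J (\<lambda>i. X (w i)) ^ 2 / 2 \<partial>Pi\<^sub>M J M)" for M
    have "{S. S \<subseteq> {..<n} \<and> k \<in> S} = insert k ` Pow J"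
    proof (intro equalityI subsetI)
      fix S assume "S \<in> {S. S \<subseteq> {..<n} \<and> k \<in> S}"
      then have "S = insert k (S - {k})" "S - {k} \<in> Pow J" by (auto simp: J_def)
      then show "S \<in> insert k ` Pow J" by blast
    qed (use J in auto)
    moreover have "inj_on (insert k) (Pow J)"
      using J(2) by (intro inj_onI) (metis PowD insert_ident subsetD)
    ultimately have Vk: "V k = (\<Sum>S\<in>Pow J. e S ^ 2)"
      by (simp add: V_def e_def sum.reindex)
    have V0: "V k \<ge> 0" unfolding V_def by (intro sum_nonneg) auto
    have est: "\<bar>(\<integral>w. hinge (mlin c {..<n} (\<lambda>i. X (w i)) - b) \<partial>Pi\<^sub>M {..<n} M) - L M\<bar> \<le> s * V k / 3"
      if M: "std_coords M X B" for M
    proof -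
      interpret std_coords M X B by (rule M)
      have "0 \<le> (\<integral>x. X x ^ 4 \<partial>M 0)" by simp
      then have B: "B \<ge> 0" using fourth[of 0] by linarith
      have "(\<integral>w. mlin e J (\<lambda>i. X (w i)) ^ 4 \<partial>Pi\<^sub>M J M) \<le> C ^ d * V k ^ 2"
        unfolding Vk
      proof (rule fourth_moment[OF C J(1)])
        fix S assume S: "S \<subseteq> J" "card S > d"
        then show "e S = 0" unfolding e_def using J finite_subset[OF S(1)]
          by (intro deg) (auto simp: card_insert_if)
      qed
      then have "B * (\<integral>w. mlin e J (\<lambda>i. X (w i)) ^ 4 \<partial>Pi\<^sub>M J M) \<le> (B * C ^ d * V k) * V k"
        using B by (simp add: power2_eq_square mult_left_mono mult.assoc)
      \<comment> \<open>Of the two factors \<open>V k\<close> that hypercontractivity gives, one is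
        traded for \<open>s ^ 2\<close>; the other must stay, because the sum over \<open>k\<close>
        has to be bounded independently of \<open>n\<close>.\<close>
      also have "\<dots> \<le> s ^ 2 * V k"
        using inf[OF k] V0 unfolding V_def by (rule mult_right_mono)
      finally have "B * (\<integral>w. mlin e J (\<lambda>i. X (w i)) ^ 4 \<partial>Pi\<^sub>M J M) / s \<le> s * V k"
        using s by (simp add: field_simps power2_eq_square)
      moreover have "(\<integral>w. mlin e J (\<lambda>i. X (w i)) ^ 2 \<partial>Pi\<^sub>M J M) = V k"
        unfolding Vk by (rule mlin_second_moment[OF J(1)])
      ultimately show ?thesis
        using single_coordinate[OF J(1,2) s, of c b] unfolding J(3) L_def e_def[abs_def] by simp
    qed
    \<comment> \<open>Consecutive hybrids differ only in coordinate \<open>k\<close>, which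
      \<open>J\<close> omits, so they share the reference value.\<close>
    have "Pi\<^sub>M J (Q k) = Pi\<^sub>M J (Q (Suc k))"
      by (rule PiM_cong) (auto simp: Q_def J_def less_Suc_eq)
    then have "L (Q k) = L (Q (Suc k))" by (simp add: L_def)
    then show ?thesis
      using est[OF Q[of k]] est[OF Q[of "Suc k"]] s V0 mult_nonneg_nonneg[of s "V k"] unfolding H_def by linarith
  qed
  have tele: "m \<le> n \<Longrightarrow> \<bar>H 0 - H m\<bar> \<le> (\<Sum>k<m. s * V k)" for m
  proof (induction m)
    case (Suc m)
    then have "\<bar>H 0 - H m\<bar> \<le> (\<Sum>k<m. s * V k)" by simp
    then show ?case using step[of m] Suc.prems by simp
  qed simp
  \<comment> \<open>Double counting: the set \<open>S\<close> occurs once for each of its elements,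
    hence at most \<open>d\<close> times.\<close>
  have "(\<Sum>k<n. V k) = (\<Sum>k<n. \<Sum>S\<in>Pow {..<n}. if k \<in> S then c S ^ 2 else 0)"
  proof (rule sum.cong)
    fix k
    have eq: "{S. S \<subseteq> {..<n} \<and> k \<in> S} = {S \<in> Pow {..<n}. k \<in> S}" by auto
    show "V k = (\<Sum>S\<in>Pow {..<n}. if k \<in> S then c S ^ 2 else 0)"
      unfolding V_def eq by (rule sum.inter_filter) simp
  qed simp
  also have "\<dots> = (\<Sum>S\<in>Pow {..<n}. \<Sum>k<n. if k \<in> S then c S ^ 2 else 0)"
    by (rule sum.swap)
  also have "\<dots> \<le> (\<Sum>S\<in>Pow {..<n}. d * c S ^ 2)"
  proof (rule sum_mono)
    fix S assume S: "S \<in> Pow {..<n}"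
    then have "(\<Sum>k<n. if k \<in> S then c S ^ 2 else 0) = card S * c S ^ 2"
      by (simp add: sum.If_cases Int_absorb1)
    also have "\<dots> \<le> d * c S ^ 2"
    proof (cases "card S > d")
      case True
      then show ?thesis using deg S by simp
    next
      case False
      then show ?thesis by (intro mult_right_mono) auto
    qed
    finally show "(\<Sum>k<n. if k \<in> S then c S ^ 2 else 0) \<le> d * c S ^ 2" .
  qed
  finally have "s * (\<Sum>k<n. V k) \<le> s * (d * (\<Sum>S\<in>Pow {..<n}. c S ^ 2))"
    using s unfolding sum_distrib_left[symmetric] by (intro mult_left_mono) auto
  moreover have "Pi\<^sub>M {..<n} (Q 0) = Pi\<^sub>M {..<n} (\<lambda>_. \<mu>)" "Pi\<^sub>M {..<n} (Q n) = Pi\<^sub>M {..<n} (\<lambda>_. \<nu>)"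
    by (auto intro!: PiM_cong simp: Q_def)
  ultimately show ?thesis
    using tele[of n] by (simp add: H_def sum_distrib_left[symmetric] mult.assoc)
qed

section \<open>Half-spaces, correlations and noise\<close>

text \<open>The points at distance exactly \<delta> from \<open>K\<close> form a compact set
  \<open>Z\<close>, and each of them is cut off by the supporting half-space at its projection;
  finitely many of these suffice for all of \<open>Z\<close>. A point farther away is reached along
  the ray from its projection through \<open>Z\<close>, on which the violation grows at least
  linearly. The summand 1 accounts for points nearer than \<delta>.\<close>

lemma halfspaces:
  fixes K :: "'a::euclidean_space set"
  assumes K: "closed K" "convex K" "K \<noteq> {}" "bounded K" and \<delta>: "\<delta> > 0"
  obtains H :: "('a \<times> real) set" where "finite H"
    "\<And>h v. h \<in> H \<Longrightarrow> v \<in> K \<Longrightarrow> fst h \<bullet> v \<le> snd h"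
    "\<And>v. dist v (closest_point K v) ^ 2 \<le> \<delta>\<^sup>2 * (1 + 8 * (\<Sum>h\<in>H. hinge (fst h \<bullet> v - snd h)))"
proof -
  define g where "g z = dist z (closest_point K z)" for z
  have cont: "continuous_on UNIV g"
    unfolding g_def by (intro continuous_intros continuous_on_closest_point K)
  define Z where "Z = {z. g z = \<delta>}"
  have "closed Z" unfolding Z_def
    by (intro closed_Collect_eq cont continuous_intros)
  moreover have "bounded Z"
  proof -
    obtain R where R: "\<And>x. x \<in> K \<Longrightarrow> norm x \<le> R" using K(4) unfolding bounded_iff by blast
    have "norm z \<le> \<delta> + R" if "z \<in> Z" for z
    proof -
      have "norm z \<le> norm (z - closest_point K z) + norm (closest_point K z)"
        using norm_triangle_ineq[of "z - closest_point K z" "closest_point K z"] by simp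
      then show ?thesis
        using that R[OF closest_point_in_set[OF K(1,3)], of z] by (simp add: Z_def g_def dist_norm)
    qed
    then show ?thesis unfolding bounded_iff by blast
  qed
  ultimately have cZ: "compact Z" by (simp add: compact_eq_bounded_closed)
  \<comment> \<open>The normal is scaled so that \<open>z\<close> itself violates its half-space by
    2. This leaves a margin above 1, the threshold from which \<open>hinge_ge\<close> applies, and
    the neighbours of \<open>z\<close> within that margin form the open cover.\<close>
  define a where "a z = (2 / \<delta>\<^sup>2) *\<^sub>R (z - closest_point K z)" for z
  define b where "b z = a z \<bullet> closest_point K z" for z
  have valid: "a z \<bullet> v \<le> b z" if "v \<in> K" for z v
  proof -
    have "(2 / \<delta>\<^sup>2) * ((z - closest_point K z) \<bullet> (v - closest_point K z)) \<le> 0"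
      using closest_point_dot[OF K(2,1) that, of z] by (intro mult_nonneg_nonpos) auto
    then show ?thesis by (simp add: a_def b_def inner_diff_right right_diff_distrib)
  qed
  have two: "a z \<bullet> z - b z = 2" if "z \<in> Z" for z
  proof -
    have "a z \<bullet> z - b z = a z \<bullet> (z - closest_point K z)" by (simp add: b_def inner_diff_right)
    also have "\<dots> = (2 / \<delta>\<^sup>2) * (norm (z - closest_point K z))\<^sup>2"
      by (simp add: a_def power2_norm_eq_inner)
    finally have "a z \<bullet> z - b z = (2 / \<delta>\<^sup>2) * (norm (z - closest_point K z))\<^sup>2" .
    then show ?thesis using that \<delta> by (simp add: Z_def g_def dist_norm)
  qed
  have op: "open {v. 1 < a z \<bullet> v - b z}" for z
    by (intro open_Collect_less continuous_intros)
  have cov: "Z \<subseteq> (\<Union>z\<in>Z. {v. 1 < a z \<bullet> v - b z})"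
    using two by force
  obtain D where D: "D \<subseteq> Z" "finite D" "Z \<subseteq> (\<Union>z\<in>D. {v. 1 < a z \<bullet> v - b z})"
    by (rule compactE_image[OF cZ op cov])
  define H where "H = (\<lambda>z. (a z, b z)) ` D"
  show thesis
  proof (rule that)
    show fin: "finite H" using D by (simp add: H_def)
    show "fst h \<bullet> v \<le> snd h" if "h \<in> H" "v \<in> K" for h v
      using that valid by (auto simp: H_def)
    fix v
    define p where "p = closest_point K v"
    define r where "r = dist v p"
    have pK: "p \<in> K" unfolding p_def using K by (intro closest_point_in_set)
    show "dist v (closest_point K v) ^ 2 \<le> \<delta>\<^sup>2 * (1 + 8 * (\<Sum>h\<in>H. hinge (fst h \<bullet> v - snd h)))"
    proof (cases "r < \<delta>")
      case True
      have "r\<^sup>2 \<le> \<delta>\<^sup>2 * 1" using True by (simp add: r_def power_mono)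
      also have "\<dots> \<le> \<delta>\<^sup>2 * (1 + 8 * (\<Sum>h\<in>H. hinge (fst h \<bullet> v - snd h)))"
        using hinge_nonneg by (intro mult_left_mono) (auto intro: sum_nonneg)
      finally show ?thesis by (simp add: r_def p_def)
    next
      case False
      define t where "t = \<delta> / r"
      have t: "0 < t" "t \<le> 1" "t * r = \<delta>" using False \<delta> by (auto simp: t_def)
      \<comment> \<open>The point of the segment from \<open>p\<close> to \<open>v\<close> at
        distance \<delta> from \<open>p\<close>. A point of \<open>K\<close> nearer to
        \<open>z\<close> than \<open>p\<close> would also be nearer to \<open>v\<close>, so
        \<open>p\<close> is the projection of \<open>z\<close> too.\<close>
      define z where "z = p + t *\<^sub>R (v - p)"
      have dzp: "dist z p = t * r" using t by (simp add: z_def r_def dist_norm)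
      have "v - z = (1 - t) *\<^sub>R (v - p)" by (simp add: z_def algebra_simps)
      then have dvz: "dist v z = (1 - t) * r" using t by (simp add: r_def dist_norm)
      have "p = closest_point K z"
      proof (rule closest_point_unique[OF K(2,1) pK], rule ballI)
        fix x assume "x \<in> K"
        then have "r \<le> dist v x" unfolding r_def p_def by (rule closest_point_le[OF K(1)])
        also have "\<dots> \<le> dist v z + dist z x" by (rule dist_triangle)
        finally show "dist z p \<le> dist z x" using dvz dzp by (simp add: algebra_simps)
      qed
      then have "z \<in> Z" using dzp t by (simp add: Z_def g_def)
      then obtain y where y: "y \<in> D" "1 < a y \<bullet> z - b y" using D(3) by blast
      \<comment> \<open>The affine function is at most 0 at \<open>p\<close> and exceeds 1 at the
        fraction \<open>t = \<delta> / r\<close> of the way, so at \<open>v\<close> it is at least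
        \<open>1 / t\<close>.\<close>
      have "a y \<bullet> z - b y = (1 - t) * (a y \<bullet> p - b y) + t * (a y \<bullet> v - b y)"
        by (simp add: z_def inner_add_right inner_diff_right algebra_simps)
      also have "\<dots> \<le> t * (a y \<bullet> v - b y)"
        using valid[OF pK, of y] t by (simp add: mult_nonneg_nonpos)
      finally have "1 < t * (a y \<bullet> v - b y)" using y by simp
      then have big: "r / \<delta> \<le> a y \<bullet> v - b y"
        using t \<delta> False by (simp add: t_def field_simps)
      moreover have "1 \<le> r / \<delta>" using False \<delta> by simp
      ultimately have "(r / \<delta>)\<^sup>2 \<le> (a y \<bullet> v - b y)\<^sup>2" "1 \<le> a y \<bullet> v - b y"
        by (auto intro: power_mono)
      then have "(r / \<delta>)\<^sup>2 / 8 \<le> hinge (a y \<bullet> v - b y)"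
        using hinge_ge[of "a y \<bullet> v - b y"] by simp
      also have "\<dots> \<le> (\<Sum>h\<in>H. hinge (fst h \<bullet> v - snd h))"
        using member_le_sum[of "(a y, b y)" H "\<lambda>h. hinge (fst h \<bullet> v - snd h)"] y fin hinge_nonneg
        by (auto simp: H_def)
      finally have "r\<^sup>2 \<le> \<delta>\<^sup>2 * (8 * (\<Sum>h\<in>H. hinge (fst h \<bullet> v - snd h)))"
        using \<delta> by (simp add: field_simps)
      also have "\<dots> \<le> \<delta>\<^sup>2 * (1 + 8 * (\<Sum>h\<in>H. hinge (fst h \<bullet> v - snd h)))"
        by (intro mult_left_mono) auto
      finally show ?thesis by (simp add: r_def p_def)
    qed
  qed
qed

text \<open>Up to a positive factor, \<open>1 - \<rho>\<^sup>2\<close> is the sum of the products of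
  three of the four weights of the pair law. Any two weights have a positive sum, by the strict
  bounds on \<open>p1\<close>, \<open>p2\<close> and \<theta>, so at most one weight vanishes and
  that sum is positive. Compactness of the set of admissible \<theta> makes the bound
  uniform.\<close>

lemma correlation_bounded_away_from_1:
  assumes p: "-1 < p1" "p1 < 1" "-1 < p2" "p2 < 1" and \<theta>0: "\<theta>0 < 1"
  obtains r0 where "0 \<le> r0" "r0 < 1"
    "\<And>\<theta>. \<theta> \<in> {-\<theta>0..\<theta>0} \<Longrightarrow> N_valid p1 p2 \<theta> \<Longrightarrow>
      \<bar>(\<theta> - p1 * p2) / (sqrt (1 - p1\<^sup>2) * sqrt (1 - p2\<^sup>2))\<bar> \<le> r0"
proof -
  define \<rho> where "\<rho> \<theta> = \<bar>(\<theta> - p1 * p2) / (sqrt (1 - p1\<^sup>2) * sqrt (1 - p2\<^sup>2))\<bar>" for \<theta>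
  define S where "S = {\<theta>. -\<theta>0 \<le> \<theta> \<and> \<theta> \<le> \<theta>0 \<and> N_valid p1 p2 \<theta>}"
  have pos: "1 - p1\<^sup>2 > 0" "1 - p2\<^sup>2 > 0"
    using p by (simp_all add: abs_square_less_1 abs_less_iff)
  have lt: "\<rho> \<theta> < 1" if \<theta>: "\<theta> \<in> S" for \<theta>
  proof -
    define a where "a = (1 + \<theta>) / 4 + (p1 + p2) / 4"
    define b where "b = (1 - \<theta>) / 4 + (p1 - p2) / 4"
    define c where "c = (1 - \<theta>) / 4 - (p1 - p2) / 4"
    define d where "d = (1 + \<theta>) / 4 - (p1 + p2) / 4"
    have nn: "a \<ge> 0" "b \<ge> 0" "c \<ge> 0" "d \<ge> 0"
      using \<theta> by (auto simp: S_def N_valid_def N_weights_def a_def b_def c_def d_def)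
    have pairs: "a + b > 0" "a + c > 0" "a + d > 0" "b + c > 0" "b + d > 0" "c + d > 0"
      using \<theta> \<theta>0 p unfolding S_def a_def b_def c_def d_def by (auto simp: field_simps)
    have nn3: "a*b*c \<ge> 0" "a*b*d \<ge> 0" "a*c*d \<ge> 0" "b*c*d \<ge> 0" using nn by auto
    have "a*b*c > 0 \<or> a*b*d > 0 \<or> a*c*d > 0 \<or> b*c*d > 0"
    proof (rule ccontr)
      assume "\<not> ?thesis"
      then have "a*b*c = 0" "a*b*d = 0" "a*c*d = 0" "b*c*d = 0" using nn3 by linarith+
      then show False using pairs by auto
    qed
    then have "a*b*c + a*b*d + a*c*d + b*c*d > 0" using nn3 by linarith
    moreover have "(1 - p1\<^sup>2) * (1 - p2\<^sup>2) - (\<theta> - p1 * p2)\<^sup>2 = 16 * (a*b*c + a*b*d + a*c*d + b*c*d)"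
      unfolding a_def b_def c_def d_def by (simp add: field_simps power2_eq_square)
    ultimately have "(\<theta> - p1 * p2)\<^sup>2 < (1 - p1\<^sup>2) * (1 - p2\<^sup>2)" by simp
    then have "(\<rho> \<theta>)\<^sup>2 < 1"
      using pos by (simp add: \<rho>_def power_divide power_mult_distrib divide_less_eq)
    then show ?thesis by (simp add: abs_square_less_1 \<rho>_def)
  qed
  have "closed S"
    unfolding S_def N_valid_def N_weights_def
    by (auto intro!: closed_Collect_conj closed_Collect_le continuous_intros)
  moreover have "bounded S" by (rule bounded_subset[of "{-\<theta>0..\<theta>0}"]) (auto simp: S_def)
  ultimately have cS: "compact S" by (simp add: compact_eq_bounded_closed)
  show thesis
  proof (cases "S = {}")
    case True
    then show thesis by (intro that[of 0]) (auto simp: S_def)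
  next
    case False
    have "continuous_on S \<rho>" unfolding \<rho>_def using pos by (intro continuous_intros) auto
    then obtain t where t: "t \<in> S" "\<forall>\<theta>\<in>S. \<rho> \<theta> \<le> \<rho> t"
      using continuous_attains_sup[OF cS False] by blast
    show thesis
      using t lt[OF t(1)] by (intro that[of "\<rho> t"]) (auto simp: S_def \<rho>_def)
  qed
qed

section \<open>Fourier expansion and noise on the cube\<close>

lemma fourier_expansion:
  assumes "-1 < p" "p < 1" "z \<in> cube n"
  shows "h z = mlin (fourier p n h) {..<n} (\<lambda>i. chi p (z i))"
proof -
  have "fourier p n h \<in> extensional (Pow {..<n}) \<and>
     (\<forall>z \<in> cube n. h z = (\<Sum>S \<in> Pow {..<n}. fourier p n h S * (\<Prod>i\<in>S. chi p (z i))))"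
    unfolding fourier_def by (rule theI'[OF fourier_ex1[OF assms(1,2)]])
  with assms(3) show ?thesis unfolding mlin_def by blast
qed

text \<open>One family of weights serves every \<open>h\<close>, in particular all components of a
  vector-valued \<open>f\<close> at once; the noisy vector is therefore a single convex combination
  of values of \<open>f\<close>, and a half-space containing \<open>K\<close> also contains
  it.\<close>

lemma noise_average:
  assumes p: "-1 < p" "p < 1" and \<gamma>: "0 \<le> \<gamma>" "\<gamma> \<le> 1" and x: "\<And>i. i < n \<Longrightarrow> x i \<in> {1, -1}"
  obtains W where "\<And>y. 0 \<le> W y" "(\<Sum>y\<in>cube n. W y) = 1"
    "\<And>h. mlin (\<lambda>S. \<gamma> ^ card S * fourier p n h S) {..<n} (\<lambda>i. chi p (x i)) = (\<Sum>y\<in>cube n. W y * h y)"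
proof -
  \<comment> \<open>Keep \<open>x i\<close> with probability \<open>\<gamma>\<close> and resample it otherwise; the absolute value makes the
     weights nonnegative off the cube as well.\<close>
  define \<kappa> where "\<kappa> i b = (if b = x i then \<gamma> else 0) + (1 - \<gamma>) * (\<bar>1 + p * b\<bar> / 2)" for i and b :: real
  define W where "W y = (\<Prod>i<n. \<kappa> i (y i))" for y
  have absp: "\<bar>1 + p\<bar> = 1 + p" "\<bar>1 - p\<bar> = 1 - p" using p by auto
  have k1: "(\<Sum>b\<in>{1, -1}. \<kappa> i b) = 1" if "i < n" for i
  proof -
    have "x i = 1 \<or> x i = -1" using x[OF that] by auto
    then show ?thesis
      unfolding \<kappa>_def by (elim disjE) (simp_all add: absp, simp_all add: field_simps)
  qed
  \<comment> \<open>The resampled part contributes the mean of \<open>chi p\<close>, which is 0.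
    This is the source of the factor \<open>\<gamma> ^ card S\<close>.\<close>
  have k2: "(\<Sum>b\<in>{1, -1}. \<kappa> i b * chi p b) = \<gamma> * chi p (x i)" if "i < n" for i
  proof -
    define r where "r = 1 / sqrt (1 - p\<^sup>2)"
    have chi: "chi p b = (b - p) * r" for b by (simp add: chi_def r_def)
    have "x i = 1 \<or> x i = -1" using x[OF that] by auto
    then show ?thesis
      unfolding \<kappa>_def chi by (elim disjE) (simp_all add: absp, simp_all add: field_simps)
  qed
  have prods: "(\<Sum>y\<in>cube n. \<Prod>i<n. \<psi> i (y i)) = (\<Prod>i<n. \<Sum>b\<in>{1, -1}. \<psi> i b)" for \<psi> :: "nat \<Rightarrow> real \<Rightarrow> real"
    unfolding cube_def by (rule prod_sum_PiE[symmetric]) auto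
  have W1: "(\<Sum>y\<in>cube n. W y) = 1"
    unfolding W_def prods using k1 by simp
  have WS: "(\<Sum>y\<in>cube n. W y * (\<Prod>i\<in>S. chi p (y i))) = \<gamma> ^ card S * (\<Prod>i\<in>S. chi p (x i))"
    if S: "S \<subseteq> {..<n}" for S
  proof -
    have restr: "(\<Prod>i\<in>S. f i) = (\<Prod>i<n. if i \<in> S then f i else 1)" for f :: "nat \<Rightarrow> real"
      using S by (simp add: prod.If_cases Int_absorb1)
    have "(\<Sum>y\<in>cube n. W y * (\<Prod>i\<in>S. chi p (y i)))
        = (\<Sum>y\<in>cube n. \<Prod>i<n. \<kappa> i (y i) * (if i \<in> S then chi p (y i) else 1))"
      unfolding restr W_def prod.distrib ..
    also have "\<dots> = (\<Prod>i<n. \<Sum>b\<in>{1, -1}. \<kappa> i b * (if i \<in> S then chi p b else 1))"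
      by (rule prods)
    also have "\<dots> = (\<Prod>i<n. if i \<in> S then \<gamma> * chi p (x i) else 1)"
    proof (rule prod.cong)
      fix i assume "i \<in> {..<n}"
      then show "(\<Sum>b\<in>{1, -1}. \<kappa> i b * (if i \<in> S then chi p b else 1)) = (if i \<in> S then \<gamma> * chi p (x i) else 1)"
        using k1[of i] k2[of i] by (cases "i \<in> S") auto
    qed simp
    also have "\<dots> = \<gamma> ^ card S * (\<Prod>i\<in>S. chi p (x i))"
      unfolding restr[symmetric] by (simp add: prod.distrib)
    finally show ?thesis .
  qed
  show thesis
  proof (rule that)
    show "0 \<le> W y" for y
      unfolding W_def \<kappa>_def using \<gamma> by (intro prod_nonneg) auto
    show "(\<Sum>y\<in>cube n. W y) = 1" by (rule W1)
    fix h :: "(nat \<Rightarrow> real) \<Rightarrow> real"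
    have "(\<Sum>y\<in>cube n. W y * h y) = (\<Sum>y\<in>cube n. \<Sum>S\<in>Pow {..<n}. fourier p n h S * (W y * (\<Prod>i\<in>S. chi p (y i))))"
      by (intro sum.cong refl) (subst fourier_expansion[OF p], auto simp: mlin_def sum_distrib_left mult_ac)
    also have "\<dots> = (\<Sum>S\<in>Pow {..<n}. \<Sum>y\<in>cube n. fourier p n h S * (W y * (\<Prod>i\<in>S. chi p (y i))))"
      by (rule sum.swap)
    also have "\<dots> = (\<Sum>S\<in>Pow {..<n}. fourier p n h S * (\<gamma> ^ card S * (\<Prod>i\<in>S. chi p (x i))))"
      unfolding sum_distrib_left[symmetric] by (intro sum.cong refl) (simp add: WS)
    finally show "mlin (\<lambda>S. \<gamma> ^ card S * fourier p n h S) {..<n} (\<lambda>i. chi p (x i)) = (\<Sum>y\<in>cube n. W y * h y)"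
      by (simp add: mlin_def mult_ac)
  qed
qed

section \<open>Rounding into a convex set\<close>

definition lowdeg :: "real \<Rightarrow> nat \<Rightarrow> real \<Rightarrow> nat \<Rightarrow> ((nat \<Rightarrow> real) \<Rightarrow> real) \<Rightarrow> nat set \<Rightarrow> real" where
  "lowdeg p n \<gamma> d h S = (if card S \<le> d then \<gamma> ^ card S * fourier p n h S else 0)"

definition smoothed :: "real \<Rightarrow> nat \<Rightarrow> real \<Rightarrow> nat \<Rightarrow> ((nat \<Rightarrow> real) \<Rightarrow> real ^ 'l) \<Rightarrow> (nat \<Rightarrow> real) \<Rightarrow> real ^ 'l" where
  "smoothed p n \<gamma> d f x = (\<chi> j. mlin (lowdeg p n \<gamma> d (\<lambda>z. f z $ j)) {..<n} (\<lambda>i. chi p (x i)))"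

lemma lowdeg_square_le:
  assumes "0 \<le> \<gamma>" "\<gamma> \<le> 1"
  shows "(lowdeg p n \<gamma> d h S)\<^sup>2 \<le> (fourier p n h S)\<^sup>2"
proof -
  have "(\<gamma> ^ card S)\<^sup>2 \<le> 1" using assms by (simp add: power_le_one)
  then have "(\<gamma> ^ card S)\<^sup>2 * (fourier p n h S)\<^sup>2 \<le> 1 * (fourier p n h S)\<^sup>2"
    by (rule mult_right_mono) simp
  then show ?thesis by (simp add: lowdeg_def power_mult_distrib)
qed

lemma sum_inner_square_le:
  fixes a :: "real ^ 'l"
  shows "(\<Sum>j\<in>UNIV. a $ j * l j)\<^sup>2 \<le> (norm a)\<^sup>2 * (\<Sum>j\<in>UNIV. (l j)\<^sup>2)"
proof -
  have "(norm a)\<^sup>2 = (\<Sum>j\<in>UNIV. (a $ j)\<^sup>2)"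
    unfolding power2_norm_eq_inner inner_vec_def by (simp add: power2_eq_square)
  then show ?thesis using Cauchy_Schwarz_ineq_sum[of "\<lambda>j. a $ j" l UNIV] by simp
qed

lemma AE_PiM_signs:
  fixes n :: nat
  assumes "prob_space \<mu>" "AE w in \<mu>. X w \<in> {1, -1 :: real}"
  shows "AE w in Pi\<^sub>M {..<n} (\<lambda>_. \<mu>). \<forall>i\<in>{..<n}. X (w i) \<in> {1, -1}"
proof (rule eventually_ball_finite)
  show "\<forall>i\<in>{..<n}. AE w in Pi\<^sub>M {..<n} (\<lambda>_. \<mu>). X (w i) \<in> {1, -1}"
    using assms by (intro ballI AE_PiM_component[where P = "\<lambda>w. X w \<in> {1, -1}"]) auto
qed simp

text \<open>Parseval: under a sign-valued law the expansion equals \<open>h\<close> almost surely,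
  so its second moment is at most 1.\<close>

lemma sum_fourier_square_le_1:
  assumes p: "-1 < p" "p < 1"
    and \<mu>: "std_coords (\<lambda>_. \<mu>) (\<lambda>w. chi p (X w)) B" "AE w in \<mu>. X w \<in> {1, -1}"
    and h: "\<And>z. z \<in> cube n \<Longrightarrow> 0 \<le> h z" "\<And>z. z \<in> cube n \<Longrightarrow> h z \<le> 1"
  shows "(\<Sum>S\<in>Pow {..<n}. (fourier p n h S)\<^sup>2) \<le> 1"
proof -
  interpret std_coords "\<lambda>_. \<mu>" "\<lambda>w. chi p (X w)" B by (rule \<mu>)
  interpret P: prob_space "Pi\<^sub>M {..<n} (\<lambda>_. \<mu>)" by (intro prob_space_PiM prob)
  let ?F = "\<lambda>w. mlin (fourier p n h) {..<n} (\<lambda>i. chi p (X (w i)))"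
  have "(\<Sum>S\<in>Pow {..<n}. (fourier p n h S)\<^sup>2) = (\<integral>w. (?F w)\<^sup>2 \<partial>Pi\<^sub>M {..<n} (\<lambda>_. \<mu>))"
    by (rule mlin_second_moment[symmetric]) simp
  also have "\<dots> \<le> (\<integral>w. 1 \<partial>Pi\<^sub>M {..<n} (\<lambda>_. \<mu>))"
  proof (rule integral_mono_AE)
    show "integrable (Pi\<^sub>M {..<n} (\<lambda>_. \<mu>)) (\<lambda>w. (?F w)\<^sup>2)"
      by (rule integrable_grows[OF _ grows_power[OF grows_mlin]]) auto
    show "AE w in Pi\<^sub>M {..<n} (\<lambda>_. \<mu>). (?F w)\<^sup>2 \<le> 1"
      using AE_PiM_signs[OF prob \<mu>(2), of n]
    proof eventually_elim
      case (elim w)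
      \<comment> \<open>\<open>cube n\<close> contains only extensional functions, so the sample has
        to be restricted before the expansion of \<open>h\<close> applies.\<close>
      define z where "z = (\<lambda>i\<in>{..<n}. X (w i))"
      have z: "z \<in> cube n" using elim by (auto simp: z_def cube_def)
      have "?F w = mlin (fourier p n h) {..<n} (\<lambda>i. chi p (z i))"
        by (rule mlin_cong) (simp add: z_def)
      also have "\<dots> = h z" by (rule fourier_expansion[OF p z, symmetric])
      finally show ?case using h[OF z] by (simp add: power_le_one)
    qed
  qed simp
  also have "\<dots> = 1" by (simp add: P.prob_space)
  finally show ?thesis .
qed

lemma rounding:
  fixes K :: "(real ^ 'l) set" and p \<gamma> \<delta> B :: real
  assumes p: "-1 < p" "p < 1"
    and K: "closed K" "convex K" "K \<noteq> {}" "K \<subseteq> unit_box"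
    and \<delta>: "\<delta> > 0" and \<gamma>: "0 < \<gamma>" "\<gamma> < 1" and B: "0 \<le> B"
  shows "\<exists>d0. \<forall>d\<ge>d0. \<exists>\<tau>>0. \<forall>n. \<forall>f \<in> cube n \<rightarrow>\<^sub>E K. \<forall>(\<mu> :: 'a measure) (\<nu> :: 'a measure) X.
    std_coords (\<lambda>_. \<mu>) (\<lambda>w. chi p (X w)) B \<longrightarrow> (AE w in \<mu>. X w \<in> {1, -1}) \<longrightarrow>
    std_coords (\<lambda>_. \<nu>) (\<lambda>w. chi p (X w)) B \<longrightarrow>
    (\<forall>i<n. \<forall>j. influence p n i (\<lambda>z. f z $ j) \<le> \<tau>) \<longrightarrow>
    (\<integral>w. (dist (smoothed p n \<gamma> d f (\<lambda>i. X (w i)))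
      (closest_point K (smoothed p n \<gamma> d f (\<lambda>i. X (w i)))))\<^sup>2 \<partial>Pi\<^sub>M {..<n} (\<lambda>_. \<nu>)) \<le> 2 * \<delta>\<^sup>2"
proof -
  have bdd: "bounded K"
  proof (rule bounded_subset[OF _ K(4)])
    have "norm v \<le> CARD('l)" if "v \<in> unit_box" for v :: "real ^ 'l"
    proof -
      have "norm v \<le> (\<Sum>j\<in>UNIV. \<bar>v $ j\<bar>)" by (rule norm_le_l1_cart)
      also have "\<dots> \<le> (\<Sum>j\<in>(UNIV :: 'l set). 1)"
        using that by (intro sum_mono) (auto simp: unit_box_def)
      finally show ?thesis by simp
    qed
    then show "bounded (unit_box :: (real ^ 'l) set)" unfolding bounded_iff by blast
  qed
  obtain H :: "((real ^ 'l) \<times> real) set" where H: "finite H"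
    "\<And>h v. h \<in> H \<Longrightarrow> v \<in> K \<Longrightarrow> fst h \<bullet> v \<le> snd h"
    "\<And>v. dist v (closest_point K v) ^ 2 \<le> \<delta>\<^sup>2 * (1 + 8 * (\<Sum>h\<in>H. hinge (fst h \<bullet> v - snd h)))"
    by (rule halfspaces[OF K(1-3) bdd \<delta>]) blast
  \<comment> \<open>\<open>L\<close> bounds the loss in passing from the components of
    \<open>f\<close> to the scalar \<open>fst h \<bullet> f\<close>, by Cauchy-Schwarz, for every
    half-space; \<open>R\<close> also accounts for their number. The added ones keep both at least
    1, even if \<open>H\<close> is empty.\<close>
  define L where "L = ((\<Sum>h\<in>H. (norm (fst h))\<^sup>2) + 1) * CARD('l)"
  define R where "R = (card H + 1) * L"
  define C where "C = max 16 (3 * B)"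
  have sq: "0 \<le> (\<Sum>h\<in>H. (norm (fst h))\<^sup>2)" by (intro sum_nonneg) auto
  have L1: "1 \<le> L"
    unfolding L_def using sq mult_mono[of 1 "(\<Sum>h\<in>H. (norm (fst h))\<^sup>2) + 1" 1 "real CARD('l)"] by auto
  have R1: "1 \<le> R" unfolding R_def using L1 mult_mono[of 1 "real (card H + 1)" 1 L] by auto
  have normL: "(norm (fst h))\<^sup>2 * CARD('l) \<le> L" if "h \<in> H" for h
    unfolding L_def using member_le_sum[of h H "\<lambda>h. (norm (fst h))\<^sup>2"] that H(1)
    by (intro mult_right_mono) auto
  \<comment> \<open>The hinges may sum to 1/8, which makes the final factor
    \<open>1 + 8 * (1 / 8) = 2\<close>. One half of this is reserved for truncation, hence
    \<open>16 * R\<close>, the other for the replacement error.\<close>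
  obtain d0 where d0: "\<gamma> ^ d0 < 1 / (16 * R)"
    using real_arch_pow_inv[of "1 / (16 * R)" \<gamma>] R1 \<gamma> by auto
  show ?thesis
  proof (intro exI[of _ d0] allI impI)
    fix d assume d: "d0 \<le> d"
    \<comment> \<open>\<open>s * d\<close> stays below the other share \<open>1 / (16 * R)\<close>.
      Then \<tau> is the influence at which the hypothesis of \<open>invariance\<close> holds for
      this \<open>s\<close>; \<open>B + 1\<close> in place of \<open>B\<close> keeps the quotient
      meaningful for \<open>B = 0\<close>.\<close>
    define s where "s = 1 / (16 * R * (d + 1))"
    define \<tau> where "\<tau> = s\<^sup>2 / ((B + 1) * C ^ d * L)"
    have s: "s > 0" using R1 by (simp add: s_def)
    have C: "C \<ge> 16" "C \<ge> 3 * B" by (auto simp: C_def)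
    have \<tau>: "\<tau> > 0" using s B C L1 by (simp add: \<tau>_def)
    show "\<exists>\<tau>>0. \<forall>n. \<forall>f \<in> cube n \<rightarrow>\<^sub>E K. \<forall>(\<mu> :: 'a measure) (\<nu> :: 'a measure) X.
      std_coords (\<lambda>_. \<mu>) (\<lambda>w. chi p (X w)) B \<longrightarrow> (AE w in \<mu>. X w \<in> {1, -1}) \<longrightarrow>
      std_coords (\<lambda>_. \<nu>) (\<lambda>w. chi p (X w)) B \<longrightarrow>
      (\<forall>i<n. \<forall>j. influence p n i (\<lambda>z. f z $ j) \<le> \<tau>) \<longrightarrow>
      (\<integral>w. (dist (smoothed p n \<gamma> d f (\<lambda>i. X (w i)))
        (closest_point K (smoothed p n \<gamma> d f (\<lambda>i. X (w i)))))\<^sup>2 \<partial>Pi\<^sub>M {..<n} (\<lambda>_. \<nu>)) \<le> 2 * \<delta>\<^sup>2"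
    proof (intro exI[of _ \<tau>] conjI \<tau> allI ballI impI)
      fix n f and \<mu> \<nu> :: "'a measure" and X
      assume f: "f \<in> cube n \<rightarrow>\<^sub>E K"
        and \<mu>: "std_coords (\<lambda>_. \<mu>) (\<lambda>w. chi p (X w)) B" and signs: "AE w in \<mu>. X w \<in> {1, -1}"
        and \<nu>: "std_coords (\<lambda>_. \<nu>) (\<lambda>w. chi p (X w)) B"
        and inf: "\<forall>i<n. \<forall>j. influence p n i (\<lambda>z. f z $ j) \<le> \<tau>"
      interpret \<mu>: std_coords "\<lambda>_. \<mu>" "\<lambda>w. chi p (X w)" B by (rule \<mu>)
      interpret \<nu>: std_coords "\<lambda>_. \<nu>" "\<lambda>w. chi p (X w)" B by (rule \<nu>)
      interpret P\<nu>: prob_space "Pi\<^sub>M {..<n} (\<lambda>_. \<nu>)" by (intro prob_space_PiM \<nu>.prob)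
      let ?fh = "\<lambda>j. fourier p n (\<lambda>z. f z $ j)" and ?ld = "\<lambda>j. lowdeg p n \<gamma> d (\<lambda>z. f z $ j)"
      let ?I = "Pow {..<n}"
      have f01: "0 \<le> f z $ j" "f z $ j \<le> 1" if "z \<in> cube n" for z j
        using that f K(4) by (auto simp: unit_box_def)
      have pars: "(\<Sum>S\<in>?I. (?fh j S)\<^sup>2) \<le> 1" for j
        using f01 by (intro sum_fourier_square_le_1[OF p \<mu> signs]) auto
      have combine: "(\<Sum>S\<in>\<A>. (\<Sum>j\<in>UNIV. fst h $ j * l j S)\<^sup>2) \<le> L * t"
        if "h \<in> H" "0 \<le> t" "\<And>j. (\<Sum>S\<in>\<A>. (l j S)\<^sup>2) \<le> t" for h \<A> l t
      proof -
        have "(\<Sum>S\<in>\<A>. (\<Sum>j\<in>UNIV. fst h $ j * l j S)\<^sup>2) \<le> (\<Sum>S\<in>\<A>. (norm (fst h))\<^sup>2 * (\<Sum>j\<in>UNIV. (l j S)\<^sup>2))"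
          by (intro sum_mono sum_inner_square_le)
        also have "\<dots> = (norm (fst h))\<^sup>2 * (\<Sum>j\<in>UNIV. \<Sum>S\<in>\<A>. (l j S)\<^sup>2)"
          unfolding sum_distrib_left[symmetric] by (subst sum.swap) simp
        also have "\<dots> \<le> (norm (fst h))\<^sup>2 * (\<Sum>j\<in>(UNIV :: 'l set). t)"
          using that by (intro mult_left_mono sum_mono) auto
        also have "\<dots> = ((norm (fst h))\<^sup>2 * CARD('l)) * t" by simp
        also have "\<dots> \<le> L * t" using that by (intro mult_right_mono normL)
        finally show ?thesis .
      qed
      define c where "c h S = (\<Sum>j\<in>UNIV. fst h $ j * ?ld j S)" for h :: "(real ^ 'l) \<times> real" and S
      define P where "P h w = mlin (c h) {..<n} (\<lambda>i. chi p (X (w i)))" for h w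
      have Pe: "fst h \<bullet> smoothed p n \<gamma> d f (\<lambda>i. X (w i)) = P h w" for h w
        unfolding P_def c_def[abs_def] smoothed_def mlin_sum by (simp add: inner_vec_def)
      have bound: "(\<integral>w. hinge (P h w - snd h) \<partial>Pi\<^sub>M {..<n} (\<lambda>_. \<nu>)) \<le> L * \<gamma> ^ d + s * d * L" if h: "h \<in> H" for h
      proof -
        \<comment> \<open>The noisy functional before truncation. Its values at sign vectors are
          averages of \<open>fst h \<bullet> f\<close> and so at most \<open>snd h\<close>; the
          violation by \<open>P h\<close> is therefore at most the discarded part
          \<open>c h - g\<close>.\<close>
        define g where "g S = (\<Sum>j\<in>UNIV. fst h $ j * (\<gamma> ^ card S * ?fh j S))" for S
        have cg: "c h S - g S = (\<Sum>j\<in>UNIV. fst h $ j * (if card S \<le> d then 0 else - (\<gamma> ^ card S * ?fh j S)))" for S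
          unfolding c_def g_def sum_subtractf[symmetric] by (intro sum.cong) (auto simp: lowdeg_def)
        have "(\<integral>w. hinge (P h w - snd h) \<partial>Pi\<^sub>M {..<n} (\<lambda>_. \<mu>))
            \<le> (\<integral>w. (mlin (\<lambda>S. c h S - g S) {..<n} (\<lambda>i. chi p (X (w i))))\<^sup>2 \<partial>Pi\<^sub>M {..<n} (\<lambda>_. \<mu>))"
        proof (rule integral_mono_AE)
          show "integrable (Pi\<^sub>M {..<n} (\<lambda>_. \<mu>)) (\<lambda>w. hinge (P h w - snd h))"
            unfolding P_def by (rule \<mu>.integrable_grows[OF _ \<mu>.grows_hinge]) (auto intro!: \<mu>.grows_diff \<mu>.grows_mlin \<mu>.grows_const simp del: One_nat_def)
          show "integrable (Pi\<^sub>M {..<n} (\<lambda>_. \<mu>)) (\<lambda>w. (mlin (\<lambda>S. c h S - g S) {..<n} (\<lambda>i. chi p (X (w i))))\<^sup>2)"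
            by (rule \<mu>.integrable_grows[OF _ \<mu>.grows_power[OF \<mu>.grows_mlin]]) auto
          show "AE w in Pi\<^sub>M {..<n} (\<lambda>_. \<mu>). hinge (P h w - snd h)
              \<le> (mlin (\<lambda>S. c h S - g S) {..<n} (\<lambda>i. chi p (X (w i))))\<^sup>2"
            using AE_PiM_signs[OF \<mu>.prob signs, of n]
          proof eventually_elim
            case (elim w)
            obtain W where W: "\<And>y. 0 \<le> W y" "(\<Sum>y\<in>cube n. W y) = 1"
              "\<And>h. mlin (\<lambda>S. \<gamma> ^ card S * fourier p n h S) {..<n} (\<lambda>i. chi p (X (w i))) = (\<Sum>y\<in>cube n. W y * h y)"
              using noise_average[OF p, of \<gamma> n "\<lambda>i. X (w i)"] \<gamma> elim by auto
            have "mlin g {..<n} (\<lambda>i. chi p (X (w i))) = (\<Sum>j\<in>UNIV. fst h $ j * (\<Sum>y\<in>cube n. W y * f y $ j))"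
              unfolding g_def[abs_def] mlin_sum W(3) ..
            also have "\<dots> = (\<Sum>y\<in>cube n. W y * (fst h \<bullet> f y))"
              unfolding inner_vec_def sum_distrib_left by (subst sum.swap) (simp add: mult_ac)
            also have "\<dots> \<le> (\<Sum>y\<in>cube n. W y * snd h)"
              using f by (intro sum_mono mult_left_mono W(1) H(2)[OF h]) auto
            also have "\<dots> = snd h" by (simp add: sum_distrib_right[symmetric] W(2))
            finally have "P h w - snd h \<le> mlin (\<lambda>S. c h S - g S) {..<n} (\<lambda>i. chi p (X (w i)))"
              unfolding P_def mlin_diff by simp
            then show ?case by (rule hinge_le)
          qed
        qed
        also have "\<dots> = (\<Sum>S\<in>?I. (c h S - g S)\<^sup>2)" by (rule \<mu>.mlin_second_moment) simp
        also have "\<dots> \<le> L * \<gamma> ^ d"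
          unfolding cg
        proof (rule combine[OF h])
          fix j
          have "(\<Sum>S\<in>?I. (if card S \<le> d then 0 else - (\<gamma> ^ card S * ?fh j S))\<^sup>2) \<le> (\<Sum>S\<in>?I. \<gamma> ^ d * (?fh j S)\<^sup>2)"
          proof (rule sum_mono)
            fix S
            show "(if card S \<le> d then 0 else - (\<gamma> ^ card S * ?fh j S))\<^sup>2 \<le> \<gamma> ^ d * (?fh j S)\<^sup>2"
            proof (cases "card S \<le> d")
              case False
              have "(\<gamma> ^ card S)\<^sup>2 \<le> \<gamma> ^ d"
                unfolding power_mult[symmetric] using \<gamma> False by (intro power_decreasing) auto
              then show ?thesis using False by (simp add: power_mult_distrib mult_right_mono)
            qed (use \<gamma> in simp)
          qed
          also have "\<dots> \<le> \<gamma> ^ d * 1"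
            unfolding sum_distrib_left[symmetric] using pars[of j] \<gamma> by (intro mult_left_mono) auto
          finally show "(\<Sum>S\<in>?I. (if card S \<le> d then 0 else - (\<gamma> ^ card S * ?fh j S))\<^sup>2) \<le> \<gamma> ^ d" by simp
        qed (use \<gamma> in simp)
        finally have E\<mu>: "(\<integral>w. hinge (P h w - snd h) \<partial>Pi\<^sub>M {..<n} (\<lambda>_. \<mu>)) \<le> L * \<gamma> ^ d" .
        have "\<bar>(\<integral>w. hinge (P h w - snd h) \<partial>Pi\<^sub>M {..<n} (\<lambda>_. \<mu>)) - (\<integral>w. hinge (P h w - snd h) \<partial>Pi\<^sub>M {..<n} (\<lambda>_. \<nu>))\<bar>
            \<le> s * d * (\<Sum>S\<in>?I. c h S ^ 2)"
          unfolding P_def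
        proof (rule invariance[OF \<mu> \<nu> C _ s])
          show "c h S = 0" if "S \<subseteq> {..<n}" "d < card S" for S
            using that by (simp add: c_def lowdeg_def)
          fix k assume k: "k < n"
          have "(\<Sum>S | S \<subseteq> {..<n} \<and> k \<in> S. (c h S)\<^sup>2) \<le> L * \<tau>"
            unfolding c_def
          proof (rule combine[OF h])
            fix j
            have "(\<Sum>S | S \<subseteq> {..<n} \<and> k \<in> S. (?ld j S)\<^sup>2) \<le> influence p n k (\<lambda>z. f z $ j)"
              unfolding influence_def using \<gamma> by (intro sum_mono lowdeg_square_le) auto
            also have "\<dots> \<le> \<tau>" using inf k by blast
            finally show "(\<Sum>S | S \<subseteq> {..<n} \<and> k \<in> S. (?ld j S)\<^sup>2) \<le> \<tau>" .
          qed (use \<tau> in simp)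
          then have "B * C ^ d * (\<Sum>S | S \<subseteq> {..<n} \<and> k \<in> S. (c h S)\<^sup>2) \<le> B * C ^ d * (L * \<tau>)"
            using B C by (intro mult_left_mono) auto
          also have "\<dots> = (B / (B + 1)) * s\<^sup>2"
            using B C L1 by (simp add: \<tau>_def)
          also have "\<dots> \<le> 1 * s\<^sup>2" using B by (intro mult_right_mono) auto
          finally show "B * C ^ d * (\<Sum>S | S \<subseteq> {..<n} \<and> k \<in> S. (c h S)\<^sup>2) \<le> s\<^sup>2" by simp
        qed
        also have "\<dots> \<le> s * d * (L * 1)"
        proof -
          have "(\<Sum>S\<in>?I. (c h S)\<^sup>2) \<le> L * 1"
            unfolding c_def
          proof (rule combine[OF h])
            fix j
            have "(\<Sum>S\<in>?I. (?ld j S)\<^sup>2) \<le> (\<Sum>S\<in>?I. (?fh j S)\<^sup>2)"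
              using \<gamma> by (intro sum_mono lowdeg_square_le) auto
            also have "\<dots> \<le> 1" by (rule pars)
            finally show "(\<Sum>S\<in>?I. (?ld j S)\<^sup>2) \<le> 1" .
          qed simp
          then show ?thesis using s by (intro mult_left_mono) auto
        qed
        finally show ?thesis using E\<mu> by simp
      qed
      let ?s = "\<lambda>w. smoothed p n \<gamma> d f (\<lambda>i. X (w i))"
      have int_hinge: "integrable (Pi\<^sub>M {..<n} (\<lambda>_. \<nu>)) (\<lambda>w. hinge (P h w - snd h))" for h
        unfolding P_def by (rule \<nu>.integrable_grows[OF _ \<nu>.grows_hinge]) (auto intro!: \<nu>.grows_diff \<nu>.grows_mlin \<nu>.grows_const simp del: One_nat_def)
      have "(\<integral>w. (dist (?s w) (closest_point K (?s w)))\<^sup>2 \<partial>Pi\<^sub>M {..<n} (\<lambda>_. \<nu>))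
          \<le> (\<integral>w. \<delta>\<^sup>2 * (1 + 8 * (\<Sum>h\<in>H. hinge (P h w - snd h))) \<partial>Pi\<^sub>M {..<n} (\<lambda>_. \<nu>))"
      proof (rule integral_mono')
        show "integrable (Pi\<^sub>M {..<n} (\<lambda>_. \<nu>)) (\<lambda>w. \<delta>\<^sup>2 * (1 + 8 * (\<Sum>h\<in>H. hinge (P h w - snd h))))"
          using int_hinge by auto
        show "(dist (?s w) (closest_point K (?s w)))\<^sup>2 \<le> \<delta>\<^sup>2 * (1 + 8 * (\<Sum>h\<in>H. hinge (P h w - snd h)))" for w
          using H(3)[of "?s w"] unfolding Pe .
        show "0 \<le> \<delta>\<^sup>2 * (1 + 8 * (\<Sum>h\<in>H. hinge (P h w - snd h)))" for w
          using hinge_nonneg by (intro mult_nonneg_nonneg add_nonneg_nonneg sum_nonneg) auto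
      qed
      also have "\<dots> = \<delta>\<^sup>2 * (1 + 8 * (\<Sum>h\<in>H. (\<integral>w. hinge (P h w - snd h) \<partial>Pi\<^sub>M {..<n} (\<lambda>_. \<nu>))))"
        using int_hinge by (simp add: Bochner_Integration.integral_sum P\<nu>.prob_space)
      also have "\<dots> \<le> \<delta>\<^sup>2 * (1 + 8 * (1 / 8))"
      proof (intro mult_left_mono add_left_mono)
        have "(\<Sum>h\<in>H. (\<integral>w. hinge (P h w - snd h) \<partial>Pi\<^sub>M {..<n} (\<lambda>_. \<nu>))) \<le> (\<Sum>h\<in>H. L * \<gamma> ^ d + s * d * L)"
          by (intro sum_mono bound)
        also have "\<dots> = (card H * L) * (\<gamma> ^ d + s * d)" by (simp add: algebra_simps)
        also have "\<dots> \<le> R * (\<gamma> ^ d0 + s * d)"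
        proof (rule mult_mono)
          show "card H * L \<le> R" using L1 by (simp add: R_def algebra_simps)
          show "\<gamma> ^ d + s * d \<le> \<gamma> ^ d0 + s * d"
            using d \<gamma> by (intro add_right_mono power_decreasing) auto
        qed (use R1 \<gamma> s in auto)
        also have "\<dots> \<le> R * (1 / (16 * R) + 1 / (16 * R))"
        proof (intro mult_left_mono add_mono)
          have "s * d = 1 / (16 * R) * (d / (d + 1))" by (simp add: s_def)
          also have "\<dots> \<le> 1 / (16 * R)" using R1 by (intro mult_left_le) auto
          finally show "s * d \<le> 1 / (16 * R)" .
        qed (use d0 R1 in auto)
        also have "\<dots> = 1 / 8" using R1 by simp
        finally show "(\<Sum>h\<in>H. (\<integral>w. hinge (P h w - snd h) \<partial>Pi\<^sub>M {..<n} (\<lambda>_. \<nu>))) \<le> 1 / 8" .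
      qed auto
      also have "\<dots> = 2 * \<delta>\<^sup>2" by simp
      finally show "(\<integral>w. (dist (?s w) (closest_point K (?s w)))\<^sup>2 \<partial>Pi\<^sub>M {..<n} (\<lambda>_. \<nu>)) \<le> 2 * \<delta>\<^sup>2" .
    qed
  qed
qed

section \<open>The two laws of a coordinate pair\<close>

text \<open>Mean \<open>p\<close> and second moment 1 mean variance \<open>1 - p\<^sup>2\<close>,
  which is what \<open>chi\<close> normalises. Integrability of the lower powers follows from that
  of the fourth.\<close>

lemma std_coords_chi:
  assumes p: "-1 < p" "p < 1" and M: "prob_space M" and X [measurable]: "X \<in> borel_measurable M"
    and moments: "(\<integral>w. X w \<partial>M) = p" "(\<integral>w. (X w)\<^sup>2 \<partial>M) = 1"
    and chi4: "integrable M (\<lambda>w. chi p (X w) ^ 4)" "(\<integral>w. chi p (X w) ^ 4 \<partial>M) \<le> B"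
  shows "std_coords (\<lambda>_. M) (\<lambda>w. chi p (X w)) B"
proof -
  interpret prob_space M by (rule M)
  define \<sigma> where "\<sigma> = sqrt (1 - p\<^sup>2)"
  have "1 - p\<^sup>2 > 0" using p by (simp add: abs_square_less_1 abs_less_iff)
  then have \<sigma>: "\<sigma> > 0" "\<sigma>\<^sup>2 = 1 - p\<^sup>2" by (simp_all add: \<sigma>_def)
  define Z where "Z w = chi p (X w)" for w
  have Xe: "X w = p + \<sigma> * Z w" for w using \<sigma> by (simp add: Z_def chi_def \<sigma>_def[symmetric])
  have Zm [measurable]: "Z \<in> borel_measurable M" unfolding Z_def chi_def by measurable
  have Z4: "integrable M (\<lambda>w. Z w ^ 4)" using chi4 by (simp add: Z_def)
  have Z2: "integrable M (\<lambda>w. (Z w)\<^sup>2)"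
  proof (rule Bochner_Integration.integrable_bound)
    show "integrable M (\<lambda>w. 1 + Z w ^ 4)" using Z4 by simp
    have "t\<^sup>2 \<le> 1 + t ^ 4" for t :: real
      using zero_le_power2[of "t\<^sup>2 - 1"] zero_le_power2[of "t\<^sup>2"]
      by (simp add: power2_eq_square power4_eq_xxxx algebra_simps)
    then show "AE w in M. norm ((Z w)\<^sup>2) \<le> norm (1 + Z w ^ 4)" by simp
  qed measurable
  have Z1: "integrable M Z" by (rule square_integrable_imp_integrable[OF Zm Z2])
  have mean: "(\<integral>w. Z w \<partial>M) = 0"
    using moments(1) Z1 \<sigma> unfolding Xe by (simp add: prob_space)
  have "(\<integral>w. (X w)\<^sup>2 \<partial>M) = (\<integral>w. p\<^sup>2 + 2 * p * \<sigma> * Z w + \<sigma>\<^sup>2 * (Z w)\<^sup>2 \<partial>M)"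
    unfolding Xe by (simp add: power2_eq_square algebra_simps)
  also have "\<dots> = p\<^sup>2 + \<sigma>\<^sup>2 * (\<integral>w. (Z w)\<^sup>2 \<partial>M)"
    using Z1 Z2 by (simp add: mean prob_space)
  finally have "\<sigma>\<^sup>2 * (\<integral>w. (Z w)\<^sup>2 \<partial>M) = \<sigma>\<^sup>2 * 1" using moments(2) \<sigma>(2) by linarith
  then have "(\<integral>w. (Z w)\<^sup>2 \<partial>M) = 1" using \<sigma>(1) by simp
  then show ?thesis
    using M Zm chi4 mean Z4 unfolding std_coords_def Z_def by simp
qed

text \<open>Only moments enter, so that \<open>N_borel\<close> and \<open>bigauss\<close> get the
  same value; this is the exact agreement on which the comparison of correlations rests.\<close>

lemma chi_correlation:
  assumes p: "-1 < p1" "p1 < 1" "-1 < p2" "p2 < 1"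
    and u: "std_coords (\<lambda>_. M) (\<lambda>w. chi p1 (fst w)) B" and v: "std_coords (\<lambda>_. M) (\<lambda>w. chi p2 (snd w)) B"
    and \<theta>: "(\<integral>w. fst w * snd w \<partial>M) = \<theta>"
  shows "integrable M (\<lambda>w. chi p1 (fst w) * chi p2 (snd w))"
    and "(\<integral>w. chi p1 (fst w) * chi p2 (snd w) \<partial>M) = (\<theta> - p1 * p2) / (sqrt (1 - p1\<^sup>2) * sqrt (1 - p2\<^sup>2))"
proof -
  interpret u: std_coords "\<lambda>_. M" "\<lambda>w. chi p1 (fst w)" B by (rule u)
  interpret v: std_coords "\<lambda>_. M" "\<lambda>w. chi p2 (snd w)" B by (rule v)
  define s where "s = sqrt (1 - p1\<^sup>2)"
  define t where "t = sqrt (1 - p2\<^sup>2)"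
  have "1 - p1\<^sup>2 > 0" "1 - p2\<^sup>2 > 0" using p by (simp_all add: abs_square_less_1 abs_less_iff)
  then have st: "s > 0" "t > 0" by (simp_all add: s_def t_def)
  have e: "fst w = p1 + s * chi p1 (fst w)" "snd w = p2 + t * chi p2 (snd w)" for w :: "real \<times> real"
    using st by (simp_all add: chi_def s_def[symmetric] t_def[symmetric])
  show int: "integrable M (\<lambda>w. chi p1 (fst w) * chi p2 (snd w))"
  proof (rule Bochner_Integration.integrable_bound)
    show "integrable M (\<lambda>w. chi p1 (fst w) * chi p1 (fst w) + chi p2 (snd w) * chi p2 (snd w))"
      using u.integrable_X(2) v.integrable_X(2) by simp
    show "AE w in M. norm (chi p1 (fst w) * chi p2 (snd w)) \<le>
        norm (chi p1 (fst w) * chi p1 (fst w) + chi p2 (snd w) * chi p2 (snd w))"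
    proof (rule AE_I2)
      fix w
      have "\<bar>a * b\<bar> \<le> a * a + b * b" for a b :: real
        using zero_le_square[of "a + b"] zero_le_square[of "a - b"] zero_le_square[of a] zero_le_square[of b]
        by (simp add: algebra_simps abs_le_iff)
      then show "norm (chi p1 (fst w) * chi p2 (snd w)) \<le>
          norm (chi p1 (fst w) * chi p1 (fst w) + chi p2 (snd w) * chi p2 (snd w))" by simp
    qed
  qed (use u.X_measurable v.X_measurable in measurable)
  have "fst w * snd w = p1 * p2 + p1 * t * chi p2 (snd w) + s * p2 * chi p1 (fst w)
      + s * t * (chi p1 (fst w) * chi p2 (snd w))" for w :: "real \<times> real"
    by (subst e(1), subst e(2)) (simp add: algebra_simps)
  then have "\<theta> = p1 * p2 + s * t * (\<integral>w. chi p1 (fst w) * chi p2 (snd w) \<partial>M)"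
    using \<theta> int u.integrable_X(1) v.integrable_X(1) u.mean v.mean by (simp add: u.prob_space)
  then show "(\<integral>w. chi p1 (fst w) * chi p2 (snd w) \<partial>M) = (\<theta> - p1 * p2) / (sqrt (1 - p1\<^sup>2) * sqrt (1 - p2\<^sup>2))"
    using st by (simp add: s_def[symmetric] t_def[symmetric])
qed

text \<open>
  The first term serves the Gaussian, where \<open>(r u + q v)\<^sup>4 \<le> 8 (u\<^sup>4 + v\<^sup>4)\<close>, and the other two the
  cube, where \<open>\<bar>z - p\<bar> \<le> 2\<close>.
\<close>

definition fourth_bound :: "real \<Rightarrow> real \<Rightarrow> real" where
  "fourth_bound p1 p2 = 48 + 16 / (1 - p1\<^sup>2)\<^sup>2 + 16 / (1 - p2\<^sup>2)\<^sup>2"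

section \<open>The discrete pair law\<close>

lemma set_N_dist:
  assumes "N_valid p1 p2 \<theta>"
  shows "set_pmf (N_dist p1 p2 \<theta>) \<subseteq> {1, -1} \<times> {1, -1}"
  using set_pmf_of_list[OF N_weights_wf[OF assms]] by (auto simp: N_dist_def N_weights_def)

lemma finite_N_dist: "N_valid p1 p2 \<theta> \<Longrightarrow> finite (set_pmf (N_dist p1 p2 \<theta>))"
  by (rule finite_subset[OF set_N_dist]) auto

text \<open>Transferred to the Borel sets, so that both coordinate laws share one sigma-algebra in
  the mixed products.\<close>

definition N_borel :: "real \<Rightarrow> real \<Rightarrow> real \<Rightarrow> (real \<times> real) measure" where
  "N_borel p1 p2 \<theta> = distr (measure_pmf (N_dist p1 p2 \<theta>)) borel (\<lambda>w. w)"

lemma sets_N_borel [simp, measurable_cong]: "sets (N_borel p1 p2 \<theta>) = sets borel"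
  by (simp add: N_borel_def)

lemma measurable_fst_snd_borel:
  "fst \<in> borel_measurable (borel :: (real \<times> real) measure)"
  "snd \<in> borel_measurable (borel :: (real \<times> real) measure)"
  unfolding borel_prod[symmetric] by measurable

lemma
  assumes p: "-1 < p1" "p1 < 1" "-1 < p2" "p2 < 1" and \<theta>: "N_valid p1 p2 \<theta>"
  shows std_coords_N_fst: "std_coords (\<lambda>_. N_borel p1 p2 \<theta>) (\<lambda>w. chi p1 (fst w)) (fourth_bound p1 p2)"
    and std_coords_N_snd: "std_coords (\<lambda>_. N_borel p1 p2 \<theta>) (\<lambda>w. chi p2 (snd w)) (fourth_bound p1 p2)"
    and AE_N_fst: "AE w in N_borel p1 p2 \<theta>. fst w \<in> {1, -1}"
    and AE_N_snd: "AE w in N_borel p1 p2 \<theta>. snd w \<in> {1, -1}"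
proof -
  let ?N = "N_dist p1 p2 \<theta>" and ?M = "N_borel p1 p2 \<theta>"
  note [measurable] = measurable_fst_snd_borel
  have prob: "prob_space ?M" unfolding N_borel_def by (rule prob_space.prob_space_distr) (auto intro: prob_space_measure_pmf)
  have E: "(\<integral>w. h w \<partial>?M) = measure_pmf.expectation ?N h" if "h \<in> borel_measurable borel" for h :: "real \<times> real \<Rightarrow> real"
    unfolding N_borel_def using that by (subst integral_distr) auto
  have int: "integrable ?M h" if "h \<in> borel_measurable borel" for h :: "real \<times> real \<Rightarrow> real"
    unfolding N_borel_def using that integrable_measure_pmf_finite[OF finite_N_dist[OF \<theta>], of h]
    by (subst integrable_distr_eq) auto
  have AE: "AE w in ?M. P w" if "Measurable.pred borel P" "\<And>w. w \<in> {1, -1} \<times> {1, -1} \<Longrightarrow> P w" for P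
    unfolding N_borel_def using that set_N_dist[OF \<theta>] by (subst AE_distr_iff) (auto simp: AE_measure_pmf_iff)
  show fs: "AE w in ?M. fst w \<in> {1, -1}" by (rule AE) auto
  show sn: "AE w in ?M. snd w \<in> {1, -1}" by (rule AE) auto
  have chi4: "chi q z ^ 4 \<le> 16 / (1 - q\<^sup>2)\<^sup>2" if q: "-1 < q" "q < 1" and z: "z \<in> {1, -1}" for q z
  proof -
    have pos: "1 - q\<^sup>2 > 0" using q by (simp add: abs_square_less_1 abs_less_iff)
    have "\<bar>z - q\<bar> ^ 4 \<le> 2 ^ 4" using q z by (intro power_mono) auto
    then have "(z - q) ^ 4 \<le> 16" by simp
    moreover have "sqrt (1 - q\<^sup>2) ^ 4 = (1 - q\<^sup>2)\<^sup>2"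
      using pos by (metis mult_2 numeral_Bit0 power_mult real_sqrt_pow2 less_imp_le)
    ultimately show ?thesis by (simp add: chi_def power_divide divide_right_mono)
  qed
  have chi_m: "(\<lambda>w. chi q (fst w) ^ 4) \<in> borel_measurable (borel :: (real \<times> real) measure)"
      "(\<lambda>w. chi q (snd w) ^ 4) \<in> borel_measurable (borel :: (real \<times> real) measure)" for q
    unfolding chi_def by measurable
  interpret prob_space ?M by (rule prob)
  have le: "(\<integral>w. h w \<partial>?M) \<le> b" if "h \<in> borel_measurable borel" "AE w in ?M. h w \<le> b" for h :: "real \<times> real \<Rightarrow> real" and b
    using integral_mono_AE[OF int[OF that(1)] _ that(2)] by (simp add: prob_space)
  have meas: "fst \<in> borel_measurable ?M" "snd \<in> borel_measurable ?M" by measurable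
  have fb: "16 / (1 - p1\<^sup>2)\<^sup>2 \<le> fourth_bound p1 p2" "16 / (1 - p2\<^sup>2)\<^sup>2 \<le> fourth_bound p1 p2"
    by (auto simp: fourth_bound_def)
  show "std_coords (\<lambda>_. ?M) (\<lambda>w. chi p1 (fst w)) (fourth_bound p1 p2)"
  proof (rule std_coords_chi[OF p(1,2) prob])
    show "(\<integral>w. chi p1 (fst w) ^ 4 \<partial>?M) \<le> fourth_bound p1 p2"
    proof (rule order.trans[OF le[OF chi_m(1)] fb(1)])
      show "AE w in ?M. chi p1 (fst w) ^ 4 \<le> 16 / (1 - p1\<^sup>2)\<^sup>2"
        using fs by eventually_elim (rule chi4[OF p(1,2)])
    qed
  qed (use N_dist_moments[OF \<theta>] in \<open>auto simp: E int chi_m meas\<close>)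
  show "std_coords (\<lambda>_. ?M) (\<lambda>w. chi p2 (snd w)) (fourth_bound p1 p2)"
  proof (rule std_coords_chi[OF p(3,4) prob])
    show "(\<integral>w. chi p2 (snd w) ^ 4 \<partial>?M) \<le> fourth_bound p1 p2"
    proof (rule order.trans[OF le[OF chi_m(2)] fb(2)])
      show "AE w in ?M. chi p2 (snd w) ^ 4 \<le> 16 / (1 - p2\<^sup>2)\<^sup>2"
        using sn by eventually_elim (rule chi4[OF p(3,4)])
    qed
  qed (use N_dist_moments[OF \<theta>] in \<open>auto simp: E int chi_m meas\<close>)
qed

section \<open>The Gaussian pair law\<close>

lemma
  assumes p: "-1 < p1" "p1 < 1" "-1 < p2" "p2 < 1" and \<theta>: "N_valid p1 p2 \<theta>"
  shows std_coords_bigauss_fst: "std_coords (\<lambda>_. bigauss p1 p2 \<theta>) (\<lambda>w. chi p1 (fst w)) (fourth_bound p1 p2)"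
    and std_coords_bigauss_snd: "std_coords (\<lambda>_. bigauss p1 p2 \<theta>) (\<lambda>w. chi p2 (snd w)) (fourth_bound p1 p2)"
proof -
  define s where "s = sqrt (1 - p1\<^sup>2)"
  define t where "t = sqrt (1 - p2\<^sup>2)"
  define r where "r = (\<theta> - p1 * p2) / (s * t)"
  define q where "q = sqrt (1 - r\<^sup>2)"
  have "1 - p1\<^sup>2 > 0" "1 - p2\<^sup>2 > 0" using p by (simp_all add: abs_square_less_1 abs_less_iff)
  then have st: "s > 0" "t > 0" by (simp_all add: s_def t_def)
  have r1: "r\<^sup>2 \<le> 1" using N_valid_correlation[OF p \<theta>] by (simp add: r_def s_def t_def)
  then have q1: "q\<^sup>2 \<le> 1" by (simp add: q_def)
  let ?\<phi> = "\<lambda>w :: real \<times> real. (p1 + s * fst w, p2 + t * (r * fst w + q * snd w))"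
  let ?S = "std_normal \<Otimes>\<^sub>M std_normal"
  note [measurable] = measurable_fst_snd_borel
  have g: "bigauss p1 p2 \<theta> = distr ?S borel ?\<phi>"
    by (simp add: bigauss_def Let_def s_def t_def r_def q_def case_prod_beta')
  have \<phi> [measurable]: "?\<phi> \<in> ?S \<rightarrow>\<^sub>M borel"
    unfolding borel_prod[symmetric] by measurable
  have prob: "prob_space (bigauss p1 p2 \<theta>)"
    unfolding g by (rule prob_space.prob_space_distr[OF _ \<phi>]) unfold_locales
  have E: "(\<integral>w. h w \<partial>bigauss p1 p2 \<theta>) = (\<integral>w. h (?\<phi> w) \<partial>?S)"
    "integrable (bigauss p1 p2 \<theta>) h = integrable ?S (\<lambda>w. h (?\<phi> w))"
    if "h \<in> borel_measurable borel" for h :: "real \<times> real \<Rightarrow> real"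
    unfolding g using that by (auto intro!: integral_distr integrable_distr_eq)
  have n4: "integrable std_normal (\<lambda>u. u ^ 4)" "(\<integral>u. u ^ 4 \<partial>std_normal) = 3"
  proof -
    have nn: "AE x in lborel. 0 \<le> std_normal_density x" by simp
    show "integrable std_normal (\<lambda>u. u ^ 4)"
      unfolding std_normal_def using integrable_std_normal_moment[of 4]
      by (subst integrable_density[OF _ _ nn]) auto
    show "(\<integral>u. u ^ 4 \<partial>std_normal) = 3"
      unfolding std_normal_def using integral_std_normal_moment_even[of 2]
      by (subst integral_density[OF _ _ nn]) (auto simp: fact_numeral)
  qed
  have one: "integrable std_normal (\<lambda>_. 1 :: real)" by simp
  have u4: "integrable ?S (\<lambda>w. fst w ^ 4)" "(\<integral>w. fst w ^ 4 \<partial>?S) = 3"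
    using std_normal_pair_product[OF n4(1) one] n4 by (simp_all add: std_normal.prob_space)
  have v4: "integrable ?S (\<lambda>w. snd w ^ 4)" "(\<integral>w. snd w ^ 4 \<partial>?S) = 3"
    using std_normal_pair_product[OF one n4(1)] n4 by (simp_all add: std_normal.prob_space)
  have chi_m: "(\<lambda>w. chi q (fst w) ^ 4) \<in> borel_measurable (borel :: (real \<times> real) measure)"
      "(\<lambda>w. chi q (snd w) ^ 4) \<in> borel_measurable (borel :: (real \<times> real) measure)" for q
    unfolding chi_def by measurable
  have c1: "chi p1 (fst (?\<phi> w)) = fst w" and c2: "chi p2 (snd (?\<phi> w)) = r * fst w + q * snd w" for w
    using st by (simp_all add: chi_def s_def t_def)
  have le: "(r * u + q * v) ^ 4 \<le> 8 * (u ^ 4 + v ^ 4)" for u v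
  proof -
    have "(r * u + q * v)\<^sup>2 \<le> 2 * ((r * u)\<^sup>2 + (q * v)\<^sup>2)"
      using zero_le_power2[of "r * u - q * v"] by (simp add: power2_eq_square algebra_simps)
    also have "\<dots> \<le> 2 * (1 * u\<^sup>2 + 1 * v\<^sup>2)"
      unfolding power_mult_distrib using r1 q1 by (intro mult_left_mono add_mono mult_right_mono) auto
    finally have "((r * u + q * v)\<^sup>2)\<^sup>2 \<le> (2 * (u\<^sup>2 + v\<^sup>2))\<^sup>2" by (intro power_mono) auto
    also have "\<dots> \<le> 8 * ((u\<^sup>2)\<^sup>2 + (v\<^sup>2)\<^sup>2)"
      using zero_le_power2[of "u\<^sup>2 - v\<^sup>2"] by (simp add: power2_eq_square algebra_simps)
    finally show ?thesis by simp
  qed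
  have int2: "integrable ?S (\<lambda>w. (r * fst w + q * snd w) ^ 4)"
  proof (rule Bochner_Integration.integrable_bound)
    show "integrable ?S (\<lambda>w. 8 * (fst w ^ 4 + snd w ^ 4))" using u4 v4 by simp
  qed (use le in auto)
  have "(\<integral>w. (r * fst w + q * snd w) ^ 4 \<partial>?S) \<le> (\<integral>w. 8 * (fst w ^ 4 + snd w ^ 4) \<partial>?S)"
    using int2 u4 v4 le by (intro integral_mono) auto
  also have "\<dots> = 48" using u4 v4 by simp
  finally have b2: "(\<integral>w. (r * fst w + q * snd w) ^ 4 \<partial>?S) \<le> 48" .
  have fb: "48 \<le> fourth_bound p1 p2" by (simp add: fourth_bound_def)
  show "std_coords (\<lambda>_. bigauss p1 p2 \<theta>) (\<lambda>w. chi p1 (fst w)) (fourth_bound p1 p2)"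
  proof (rule std_coords_chi[OF p(1,2) prob])
    show "integrable (bigauss p1 p2 \<theta>) (\<lambda>w. chi p1 (fst w) ^ 4)"
      using u4 unfolding E(2)[OF chi_m(1)] c1 by simp
    show "(\<integral>w. chi p1 (fst w) ^ 4 \<partial>bigauss p1 p2 \<theta>) \<le> fourth_bound p1 p2"
      using u4 fb unfolding E(1)[OF chi_m(1)] c1 by simp
  qed (use bigauss_moments[OF p \<theta>] in auto)
  show "std_coords (\<lambda>_. bigauss p1 p2 \<theta>) (\<lambda>w. chi p2 (snd w)) (fourth_bound p1 p2)"
  proof (rule std_coords_chi[OF p(3,4) prob])
    show "integrable (bigauss p1 p2 \<theta>) (\<lambda>w. chi p2 (snd w) ^ 4)"
      using int2 unfolding E(2)[OF chi_m(2)] c2 by simp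
    show "(\<integral>w. chi p2 (snd w) ^ 4 \<partial>bigauss p1 p2 \<theta>) \<le> fourth_bound p1 p2"
      using b2 fb unfolding E(1)[OF chi_m(2)] c2 by simp
  qed (use bigauss_moments[OF p \<theta>] in auto)
qed

lemma expectation_Pi_pmf_prod:
  fixes h :: "nat \<Rightarrow> 'a \<Rightarrow> real"
  assumes "finite I" "finite (set_pmf N)"
  shows "measure_pmf.expectation (Pi_pmf I dflt (\<lambda>_. N)) (\<lambda>w. \<Prod>i\<in>I. h i (w i)) =
    (\<Prod>i\<in>I. measure_pmf.expectation N (h i))"
proof (cases "I = {}")
  case False
  let ?P = "measure_pmf (Pi_pmf I dflt (\<lambda>_. N))"
  have fin: "finite (set_pmf (Pi_pmf I dflt (\<lambda>_. N)))"
    using assms by (simp add: set_Pi_pmf finite_PiE_dflt)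
  have "prob_space.indep_vars ?P (\<lambda>_. borel) (\<lambda>i w. h i (w i)) I"
    by (rule prob_space.indep_vars_compose2[OF prob_space_measure_pmf indep_vars_Pi_pmf[OF assms(1)]]) auto
  then have "measure_pmf.expectation (Pi_pmf I dflt (\<lambda>_. N)) (\<lambda>w. \<Prod>i\<in>I. h i (w i)) = (\<Prod>i\<in>I. measure_pmf.expectation (Pi_pmf I dflt (\<lambda>_. N)) (\<lambda>w. h i (w i)))"
    using assms fin False by (intro prob_space.indep_vars_lebesgue_integral prob_space_measure_pmf integrable_measure_pmf_finite) auto
  also have "\<dots> = (\<Prod>i\<in>I. measure_pmf.expectation N (h i))"
  proof (rule prod.cong)
    fix i assume "i \<in> I"
    then have "N = map_pmf (\<lambda>w. w i) (Pi_pmf I dflt (\<lambda>_. N))"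
      using assms(1) by (subst Pi_pmf_component) auto
    then show "measure_pmf.expectation (Pi_pmf I dflt (\<lambda>_. N)) (\<lambda>w. h i (w i)) = measure_pmf.expectation N (h i)"
      by (metis integral_map_pmf)
  qed simp
  finally show ?thesis .
qed simp

section \<open>Comparison of the correlations\<close>

text \<open>Both functions equal their expansions on the cube, and independence of the coordinate
  pairs leaves only equal index sets. All degrees occur here; noise and truncation enter only on the
  Gaussian side.\<close>

lemma expectation_inner_N:
  fixes f g :: "(nat \<Rightarrow> real) \<Rightarrow> real ^ 'l"
  assumes p: "-1 < p1" "p1 < 1" "-1 < p2" "p2 < 1" and \<theta>: "N_valid p1 p2 \<theta>"
  defines "\<rho> \<equiv> (\<theta> - p1 * p2) / (sqrt (1 - p1\<^sup>2) * sqrt (1 - p2\<^sup>2))"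
  shows "(\<integral>w. f (fsts n w) \<bullet> g (snds n w) \<partial>Pi_pmf {..<n} undefined (\<lambda>_. N_dist p1 p2 \<theta>)) =
    (\<Sum>j\<in>UNIV. \<Sum>S\<in>Pow {..<n}. fourier p1 n (\<lambda>z. f z $ j) S * fourier p2 n (\<lambda>z. g z $ j) S * \<rho> ^ card S)"
proof -
  let ?N = "N_dist p1 p2 \<theta>" and ?P = "measure_pmf (Pi_pmf {..<n} undefined (\<lambda>_. N_dist p1 p2 \<theta>))"
  let ?u = "\<lambda>w :: real \<times> real. chi p1 (fst w)" and ?v = "\<lambda>w :: real \<times> real. chi p2 (snd w)"
  let ?F = "\<lambda>j. fourier p1 n (\<lambda>z. f z $ j)" and ?G = "\<lambda>j. fourier p2 n (\<lambda>z. g z $ j)"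
  have set: "set_pmf (Pi_pmf {..<n} undefined (\<lambda>_. ?N)) = PiE_dflt {..<n} undefined (\<lambda>_. set_pmf ?N)"
    by (simp add: set_Pi_pmf comp_def)
  have fin: "finite (set_pmf (Pi_pmf {..<n} undefined (\<lambda>_. ?N)))"
    unfolding set by (intro finite_PiE_dflt finite_N_dist[OF \<theta>]) auto
  have AE: "AE w in ?P. fsts n w \<in> cube n \<and> snds n w \<in> cube n"
    unfolding AE_measure_pmf_iff set using set_N_dist[OF \<theta>]
    by (fastforce simp: PiE_dflt_def fsts_def snds_def cube_def)
  interpret u: std_coords "\<lambda>_. N_borel p1 p2 \<theta>" "\<lambda>w. chi p1 (fst w)" "fourth_bound p1 p2"
    by (rule std_coords_N_fst[OF p \<theta>])
  interpret v: std_coords "\<lambda>_. N_borel p1 p2 \<theta>" "\<lambda>w. chi p2 (snd w)" "fourth_bound p1 p2"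
    by (rule std_coords_N_snd[OF p \<theta>])
  note [measurable] = measurable_fst_snd_borel
  have m: "?u \<in> borel_measurable borel" "?v \<in> borel_measurable borel" unfolding chi_def by measurable
  have EN: "measure_pmf.expectation ?N h = (\<integral>w. h w \<partial>N_borel p1 p2 \<theta>)" if "h \<in> borel_measurable borel" for h :: "real \<times> real \<Rightarrow> real"
    unfolding N_borel_def using that by (subst integral_distr) auto
  have "(\<integral>w. fst w * snd w \<partial>N_borel p1 p2 \<theta>) = \<theta>"
    using N_dist_moments(5)[OF \<theta>] by (subst EN[symmetric]) auto
  then have uv: "(\<integral>w. ?u w * ?v w \<partial>N_borel p1 p2 \<theta>) = \<rho>"
    unfolding \<rho>_def by (rule chi_correlation(2)[OF p u.std_coords_axioms v.std_coords_axioms])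
  have prod: "(\<integral>w. (\<Prod>i<n. h i (w i)) \<partial>?P) = (\<Prod>i<n. measure_pmf.expectation ?N (h i))" for h :: "nat \<Rightarrow> real \<times> real \<Rightarrow> real"
    by (rule expectation_Pi_pmf_prod) (auto intro: finite_N_dist[OF \<theta>])
  have cor: "(\<integral>w. mlin c {..<n} (\<lambda>i. ?u (w i)) * mlin d {..<n} (\<lambda>i. ?v (w i)) \<partial>?P) = (\<Sum>S\<in>Pow {..<n}. c S * d S * \<rho> ^ card S)" for c d
    by (rule mlin_correlation_product(2)[where E = "\<lambda>i. measure_pmf.expectation ?N", OF _ _ prod])
      (auto simp: EN m u.mean v.mean uv intro!: integrable_measure_pmf_finite[OF fin])
  have "(\<integral>w. f (fsts n w) \<bullet> g (snds n w) \<partial>?P) =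
      (\<integral>w. (\<Sum>j\<in>UNIV. mlin (?F j) {..<n} (\<lambda>i. ?u (w i)) * mlin (?G j) {..<n} (\<lambda>i. ?v (w i))) \<partial>?P)"
  proof (rule integral_cong_AE)
    show "AE w in ?P. f (fsts n w) \<bullet> g (snds n w) =
        (\<Sum>j\<in>UNIV. mlin (?F j) {..<n} (\<lambda>i. ?u (w i)) * mlin (?G j) {..<n} (\<lambda>i. ?v (w i)))"
      using AE
    proof eventually_elim
      case (elim w)
      have "f (fsts n w) $ j = mlin (?F j) {..<n} (\<lambda>i. ?u (w i))" for j
        using elim by (subst fourier_expansion[OF p(1,2), of "fsts n w" n "\<lambda>z. f z $ j"]) (auto simp: fsts_def intro: mlin_cong)
      moreover have "g (snds n w) $ j = mlin (?G j) {..<n} (\<lambda>i. ?v (w i))" for j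
        using elim by (subst fourier_expansion[OF p(3,4), of "snds n w" n "\<lambda>z. g z $ j"]) (auto simp: snds_def intro: mlin_cong)
      ultimately show ?case by (simp add: inner_vec_def)
    qed
  qed auto
  also have "\<dots> = (\<Sum>j\<in>UNIV. \<Sum>S\<in>Pow {..<n}. ?F j S * ?G j S * \<rho> ^ card S)"
    by (subst Bochner_Integration.integral_sum) (auto simp: cor intro!: integrable_measure_pmf_finite[OF fin])
  finally show ?thesis .
qed

lemma smoothed_cong: "(\<And>i. i < n \<Longrightarrow> x i = y i) \<Longrightarrow> smoothed p n \<gamma> d f x = smoothed p n \<gamma> d f y"
  unfolding smoothed_def by (auto simp: vec_eq_iff intro!: mlin_cong)

lemma smoothed_measurable:
  assumes "\<And>i. i < n \<Longrightarrow> (\<lambda>w. x w i) \<in> borel_measurable M"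
  shows "(\<lambda>w. smoothed p n \<gamma> d f (x w) :: real ^ 'l) \<in> borel_measurable M"
proof (rule borel_measurable_euclidean_space[THEN iffD2], rule ballI)
  fix b :: "real ^ 'l" assume "b \<in> Basis"
  then obtain j where b: "b = axis j 1" by (auto simp: Basis_vec_def)
  have "(\<lambda>w. \<Prod>i\<in>S. chi p (x w i)) \<in> borel_measurable M" if "S \<in> Pow {..<n}" for S
  proof (rule borel_measurable_prod)
    fix i assume "i \<in> S"
    with that have [measurable]: "(\<lambda>w. x w i) \<in> borel_measurable M" by (intro assms) auto
    show "(\<lambda>w. chi p (x w i)) \<in> borel_measurable M" unfolding chi_def by measurable
  qed
  then show "(\<lambda>w. smoothed p n \<gamma> d f (x w) \<bullet> b) \<in> borel_measurable M"
    unfolding b smoothed_def mlin_def by (auto simp: inner_axis intro!: borel_measurable_sum borel_measurable_times)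
qed

text \<open>With the arguments in this order, \<open>rounded K p \<gamma> d\<close> is itself the
  family of mappings indexed by \<open>n\<close>.\<close>

definition rounded :: "(real ^ 'l) set \<Rightarrow> real \<Rightarrow> real \<Rightarrow> nat \<Rightarrow> nat \<Rightarrow> ((nat \<Rightarrow> real) \<Rightarrow> real ^ 'l) \<Rightarrow> (nat \<Rightarrow> real) \<Rightarrow> real ^ 'l" where
  "rounded K p \<gamma> d n f x = closest_point K (smoothed p n \<gamma> d f x)"

lemma closest_point_measurable:
  fixes K :: "'a::euclidean_space set"
  assumes "closed K" "convex K" "K \<noteq> {}" "h \<in> borel_measurable M"
  shows "(\<lambda>w. closest_point K (h w)) \<in> borel_measurable M"
  by (rule measurable_compose[OF assms(4) borel_measurable_continuous_onI]) (rule continuous_on_closest_point[OF assms(2,1,3)])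

lemma rounded_real_maps:
  assumes "closed K" "convex K"
  shows "rounded K p \<gamma> d n \<in> (cube n \<rightarrow>\<^sub>E K) \<rightarrow> real_maps n K"
proof
  fix f assume f: "f \<in> cube n \<rightarrow>\<^sub>E K"
  \<comment> \<open>The cube is never empty, so the mere existence of \<open>f\<close> makes
    \<open>K\<close> nonempty, which nearest points require.\<close>
  have "(\<lambda>i\<in>{..<n}. 1) \<in> cube n" by (auto simp: cube_def)
  with f have K: "K \<noteq> {}" by auto
  have "rounded K p \<gamma> d n f \<in> borel_measurable (Pi\<^sub>M {..<n} (\<lambda>_. borel))"
    unfolding rounded_def[abs_def]
    by (intro closest_point_measurable assms K smoothed_measurable) measurable
  then show "rounded K p \<gamma> d n f \<in> real_maps n K"
    using closest_point_in_set[OF assms(1) K] by (auto simp: real_maps_def rounded_def)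
qed

text \<open>The bounded quantity is the change of \<open>\<rho> ^ s\<close> when both functions are
  damped and truncated. Up to degree \<open>d1\<close> the damping is negligible by Bernoulli's
  inequality; beyond it \<open>r0 ^ d1 < e\<close> suffices, whatever the damping does. Since
  \<gamma> is tied to \<open>d1\<close> alone, \<open>d\<close> can still be enlarged.\<close>

lemma damping_parameters:
  fixes r0 e :: real
  assumes r0: "0 \<le> r0" "r0 < 1" and e: "0 < e" "e < 1"
  obtains \<gamma> d1 where "0 < \<gamma>" "\<gamma> < 1"
    "\<And>\<rho> d s. \<bar>\<rho>\<bar> \<le> r0 \<Longrightarrow> d1 \<le> d \<Longrightarrow> \<bar>\<rho> ^ s * (1 - (if s \<le> d then \<gamma> ^ s * \<gamma> ^ s else 0))\<bar> \<le> e"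
proof -
  obtain d1 where d1: "r0 ^ d1 < e" using real_arch_pow_inv[OF e(1) r0(2)] by blast
  \<comment> \<open>The factor 2 reflects that both functions are damped; the added 1 avoids a zero
    denominator, and \<open>e < 1\<close> then keeps \<gamma> positive.\<close>
  define \<gamma> where "\<gamma> = 1 - e / (2 * real d1 + 1)"
  have "e / (2 * real d1 + 1) \<le> e / 1" using e by (intro divide_left_mono) auto
  then have \<gamma>: "0 < \<gamma>" "\<gamma> < 1" using e by (auto simp: \<gamma>_def)
  have "1 + real (2 * d1) * (- (e / (2 * real d1 + 1))) \<le> (1 + (- (e / (2 * real d1 + 1)))) ^ (2 * d1)"
    using \<gamma> by (intro Bernoulli_inequality) (simp add: \<gamma>_def)
  moreover have "real (2 * d1) * (e / (2 * real d1 + 1)) \<le> e"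
    using e by (simp add: field_simps)
  ultimately have g1: "1 - \<gamma> ^ (2 * d1) \<le> e" by (simp add: \<gamma>_def)
  have "\<bar>\<rho> ^ s * (1 - (if s \<le> d then \<gamma> ^ s * \<gamma> ^ s else 0))\<bar> \<le> e"
    if \<rho>: "\<bar>\<rho>\<bar> \<le> r0" and d: "d1 \<le> d" for \<rho> d s
  proof -
    let ?t = "1 - (if s \<le> d then \<gamma> ^ s * \<gamma> ^ s else 0)"
    have "\<gamma> ^ s * \<gamma> ^ s \<le> 1" using \<gamma> by (intro mult_le_one power_le_one) auto
    then have t: "0 \<le> ?t" "?t \<le> 1" using \<gamma> by auto
    have pw: "\<bar>\<rho> ^ s\<bar> \<le> r0 ^ s" unfolding power_abs using \<rho> by (intro power_mono) auto
    show ?thesis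
    proof (cases "s \<le> d1")
      case True
      have "\<gamma> ^ (2 * d1) \<le> \<gamma> ^ (2 * s)" using \<gamma> True by (intro power_decreasing) auto
      then have "?t \<le> e" using g1 True d by (simp add: mult_2 power_add)
      moreover have "\<bar>\<rho> ^ s\<bar> \<le> 1" using pw r0 by (meson order.trans power_le_one less_imp_le)
      ultimately have "\<bar>\<rho> ^ s\<bar> * ?t \<le> 1 * e" using t by (intro mult_mono) auto
      then show ?thesis using t by (simp add: abs_mult)
    next
      case False
      have "r0 ^ s \<le> r0 ^ d1" using False r0 by (intro power_decreasing) auto
      then have "\<bar>\<rho> ^ s\<bar> * ?t \<le> e * 1" using pw d1 t e by (intro mult_mono) auto
      then show ?thesis using t by (simp add: abs_mult)
    qed
  qed
  with \<gamma> show thesis by (intro that[of \<gamma> d1]) auto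
qed

lemma unit_box_norm:
  fixes v :: "real ^ 'l"
  assumes "v \<in> unit_box"
  shows "(norm v)\<^sup>2 \<le> CARD('l)"
proof -
  have "(norm v)\<^sup>2 = (\<Sum>j\<in>UNIV. v $ j * v $ j)" unfolding power2_norm_eq_inner inner_vec_def by simp
  also have "\<dots> \<le> (\<Sum>j\<in>(UNIV :: 'l set). 1)"
    using assms by (intro sum_mono mult_le_one) (auto simp: unit_box_def)
  finally show ?thesis by simp
qed

lemma lowdeg_sum_square_le_1:
  assumes p: "-1 < p" "p < 1"
    and \<mu>: "std_coords (\<lambda>_. \<mu>) (\<lambda>w. chi p (X w)) B" "AE w in \<mu>. X w \<in> {1, -1}"
    and f: "f \<in> cube n \<rightarrow>\<^sub>E K" and K: "K \<subseteq> unit_box"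
    and \<gamma>: "0 < \<gamma>" "\<gamma> < 1"
  shows "(\<Sum>S\<in>Pow {..<n}. (fourier p n (\<lambda>z. f z $ j) S)\<^sup>2) \<le> 1"
    and "(\<Sum>S\<in>Pow {..<n}. (lowdeg p n \<gamma> d (\<lambda>z. f z $ j) S)\<^sup>2) \<le> 1"
proof -
  show 1: "(\<Sum>S\<in>Pow {..<n}. (fourier p n (\<lambda>z. f z $ j) S)\<^sup>2) \<le> 1"
    using f K by (intro sum_fourier_square_le_1[OF p \<mu>]) (auto simp: unit_box_def)
  have "(\<Sum>S\<in>Pow {..<n}. (lowdeg p n \<gamma> d (\<lambda>z. f z $ j) S)\<^sup>2) \<le> (\<Sum>S\<in>Pow {..<n}. (fourier p n (\<lambda>z. f z $ j) S)\<^sup>2)"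
    using \<gamma> by (intro sum_mono lowdeg_square_le) auto
  with 1 show "(\<Sum>S\<in>Pow {..<n}. (lowdeg p n \<gamma> d (\<lambda>z. f z $ j) S)\<^sup>2) \<le> 1" by simp
qed

text \<open>With \<open>c = \<delta>\<close>, a squared distance of order
  \<open>\<delta>\<^sup>2\<close> paired with a vector of bounded second moment costs only order
  \<delta>.\<close>

lemma inner_le_weighted_squares:
  fixes x y :: "'a::real_inner"
  assumes "c > 0"
  shows "\<bar>x \<bullet> y\<bar> \<le> ((norm x)\<^sup>2 / c + c * (norm y)\<^sup>2) / 2"
proof -
  have "0 \<le> (norm x - c * norm y)\<^sup>2 / c" using assms by simp
  also have "\<dots> = (norm x)\<^sup>2 / c + c * (norm y)\<^sup>2 - 2 * (norm x * norm y)"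
    using assms by (simp add: field_simps power2_eq_square)
  finally show ?thesis using Cauchy_Schwarz_ineq2[of x y] by simp
qed

text \<open>Off the cube the polynomial is unbounded; this second moment takes the place of the
  pointwise bound that the rounded function has.\<close>

lemma smoothed_norm_square:
  fixes f :: "(nat \<Rightarrow> real) \<Rightarrow> real ^ 'l" and \<gamma> :: real and d n :: nat
  assumes \<nu>: "std_coords (\<lambda>_. \<nu>) (\<lambda>w. chi p (X w)) B"
    and sq: "\<And>j. (\<Sum>S\<in>Pow {..<n}. (lowdeg p n \<gamma> d (\<lambda>z. f z $ j) S)\<^sup>2) \<le> 1"
  defines "N2 \<equiv> \<lambda>w. (norm (smoothed p n \<gamma> d f (\<lambda>i. X (w i))))\<^sup>2"
  shows "integrable (Pi\<^sub>M {..<n} (\<lambda>_. \<nu>)) N2" "(\<integral>w. N2 w \<partial>Pi\<^sub>M {..<n} (\<lambda>_. \<nu>)) \<le> CARD('l)"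
proof -
  interpret std_coords "\<lambda>_. \<nu>" "\<lambda>w. chi p (X w)" B by (rule \<nu>)
  have N2: "N2 = (\<lambda>w. \<Sum>j\<in>UNIV. (mlin (lowdeg p n \<gamma> d (\<lambda>z. f z $ j)) {..<n} (\<lambda>i. chi p (X (w i))))\<^sup>2)"
    unfolding N2_def power2_norm_eq_inner inner_vec_def smoothed_def by (simp add: power2_eq_square)
  have int: "integrable (Pi\<^sub>M {..<n} (\<lambda>_. \<nu>)) (\<lambda>w. (mlin c {..<n} (\<lambda>i. chi p (X (w i))))\<^sup>2)" for c
    by (rule integrable_grows[OF _ grows_power[OF grows_mlin]]) auto
  show "integrable (Pi\<^sub>M {..<n} (\<lambda>_. \<nu>)) N2" unfolding N2 using int by auto
  have "(\<integral>w. N2 w \<partial>Pi\<^sub>M {..<n} (\<lambda>_. \<nu>)) = (\<Sum>j\<in>UNIV. \<Sum>S\<in>Pow {..<n}. (lowdeg p n \<gamma> d (\<lambda>z. f z $ j) S)\<^sup>2)"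
    unfolding N2 using int by (subst Bochner_Integration.integral_sum) (auto simp: mlin_second_moment)
  also have "\<dots> \<le> (\<Sum>j\<in>(UNIV :: 'l set). 1)" using sq by (intro sum_mono)
  finally show "(\<integral>w. N2 w \<partial>Pi\<^sub>M {..<n} (\<lambda>_. \<nu>)) \<le> CARD('l)" by simp
qed

text \<open>The formula has the shape of \<open>expectation_inner_N\<close> with the same \<rho>,
  which reduces the comparison to one of coefficients.\<close>

lemma expectation_inner_smoothed:
  fixes f g :: "(nat \<Rightarrow> real) \<Rightarrow> real ^ 'l" and \<gamma> :: real and d n :: nat
  assumes p: "-1 < p1" "p1 < 1" "-1 < p2" "p2 < 1" and \<theta>: "N_valid p1 p2 \<theta>"
  defines "\<rho> \<equiv> (\<theta> - p1 * p2) / (sqrt (1 - p1\<^sup>2) * sqrt (1 - p2\<^sup>2))"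
    and "\<Omega> \<equiv> Pi\<^sub>M {..<n} (\<lambda>_. bigauss p1 p2 \<theta>)"
    and "Q \<equiv> \<lambda>w. smoothed p1 n \<gamma> d f (\<lambda>i. fst (w i)) \<bullet> smoothed p2 n \<gamma> d g (\<lambda>i. snd (w i))"
  shows "integrable \<Omega> Q"
    and "(\<integral>w. Q w \<partial>\<Omega>) = (\<Sum>j\<in>UNIV. \<Sum>S\<in>Pow {..<n}. lowdeg p1 n \<gamma> d (\<lambda>z. f z $ j) S * lowdeg p2 n \<gamma> d (\<lambda>z. g z $ j) S * \<rho> ^ card S)"
proof -
  interpret u: std_coords "\<lambda>_. bigauss p1 p2 \<theta>" "\<lambda>w. chi p1 (fst w)" "fourth_bound p1 p2"
    by (rule std_coords_bigauss_fst[OF p \<theta>])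
  interpret v: std_coords "\<lambda>_. bigauss p1 p2 \<theta>" "\<lambda>w. chi p2 (snd w)" "fourth_bound p1 p2"
    by (rule std_coords_bigauss_snd[OF p \<theta>])
  note uv = chi_correlation[OF p u.std_coords_axioms v.std_coords_axioms bigauss_moments(5)[OF p \<theta>]]
  have cor: "integrable \<Omega> (\<lambda>w. mlin c {..<n} (\<lambda>i. chi p1 (fst (w i))) * mlin e {..<n} (\<lambda>i. chi p2 (snd (w i))))"
    "(\<integral>w. mlin c {..<n} (\<lambda>i. chi p1 (fst (w i))) * mlin e {..<n} (\<lambda>i. chi p2 (snd (w i))) \<partial>\<Omega>) =
      (\<Sum>S\<in>Pow {..<n}. c S * e S * \<rho> ^ card S)" for c e
    unfolding \<Omega>_def \<rho>_def
    by (rule u.mlin_correlation_PiM[OF finite_lessThan u.integrable_X(1) v.integrable_X(1) uv(1) u.mean v.mean uv(2)])+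
  have Q: "Q = (\<lambda>w. \<Sum>j\<in>UNIV. mlin (lowdeg p1 n \<gamma> d (\<lambda>z. f z $ j)) {..<n} (\<lambda>i. chi p1 (fst (w i))) *
      mlin (lowdeg p2 n \<gamma> d (\<lambda>z. g z $ j)) {..<n} (\<lambda>i. chi p2 (snd (w i))))"
    unfolding Q_def inner_vec_def smoothed_def by simp
  show "integrable \<Omega> Q" unfolding Q using cor(1) by auto
  show "(\<integral>w. Q w \<partial>\<Omega>) = (\<Sum>j\<in>UNIV. \<Sum>S\<in>Pow {..<n}. lowdeg p1 n \<gamma> d (\<lambda>z. f z $ j) S * lowdeg p2 n \<gamma> d (\<lambda>z. g z $ j) S * \<rho> ^ card S)"
    unfolding Q using cor by (subst Bochner_Integration.integral_sum) auto
qed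

text \<open>One factor is rounded at a time, \<open>P \<bullet> Q - F \<bullet> G = (P - F)
  \<bullet> Q + (Q - G) \<bullet> F\<close>. Each part costs
  \<open>(2 * \<delta>\<^sup>2 / \<delta> + \<delta> * CARD('l)) / 2\<close>, where \<open>Q\<close>
  is controlled in mean square and \<open>F\<close> pointwise.\<close>

lemma expectation_inner_rounded:
  fixes f g :: "(nat \<Rightarrow> real) \<Rightarrow> real ^ 'l" and \<gamma> \<delta> :: real and d n :: nat
  assumes p: "-1 < p1" "p1 < 1" "-1 < p2" "p2 < 1" and \<theta>: "N_valid p1 p2 \<theta>"
    and K1: "closed K1" "convex K1" "K1 \<noteq> {}" "K1 \<subseteq> unit_box"
    and K2: "closed K2" "convex K2" "K2 \<noteq> {}" "K2 \<subseteq> unit_box"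
    and f: "f \<in> cube n \<rightarrow>\<^sub>E K1" and g: "g \<in> cube n \<rightarrow>\<^sub>E K2"
    and \<gamma>: "0 < \<gamma>" "\<gamma> < 1" and \<delta>: "\<delta> > 0"
  defines "\<Omega> \<equiv> Pi\<^sub>M {..<n} (\<lambda>_. bigauss p1 p2 \<theta>)"
    and "P \<equiv> \<lambda>w. smoothed p1 n \<gamma> d f (\<lambda>i. fst (w i))"
    and "Q \<equiv> \<lambda>w. smoothed p2 n \<gamma> d g (\<lambda>i. snd (w i))"
  assumes P: "(\<integral>w. (dist (P w) (closest_point K1 (P w)))\<^sup>2 \<partial>\<Omega>) \<le> 2 * \<delta>\<^sup>2"
    and Q: "(\<integral>w. (dist (Q w) (closest_point K2 (Q w)))\<^sup>2 \<partial>\<Omega>) \<le> 2 * \<delta>\<^sup>2"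
  shows "\<bar>(\<integral>w. P w \<bullet> Q w \<partial>\<Omega>) -
      (\<integral>w. rounded K1 p1 \<gamma> d n f (fsts n w) \<bullet> rounded K2 p2 \<gamma> d n g (snds n w) \<partial>\<Omega>)\<bar>
    \<le> \<delta> * (2 + real CARD('l))"
proof -
  interpret u: std_coords "\<lambda>_. bigauss p1 p2 \<theta>" "\<lambda>w. chi p1 (fst w)" "fourth_bound p1 p2"
    by (rule std_coords_bigauss_fst[OF p \<theta>])
  interpret v: std_coords "\<lambda>_. bigauss p1 p2 \<theta>" "\<lambda>w. chi p2 (snd w)" "fourth_bound p1 p2"
    by (rule std_coords_bigauss_snd[OF p \<theta>])
  interpret \<Omega>: prob_space \<Omega> unfolding \<Omega>_def by (intro prob_space_PiM u.prob)
  note [measurable] = measurable_fst_snd_borel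
  define F where "F w = closest_point K1 (P w)" for w
  define G where "G w = closest_point K2 (Q w)" for w
  have rF: "rounded K1 p1 \<gamma> d n f (fsts n w) = F w" for w
    unfolding rounded_def F_def P_def by (rule arg_cong[OF smoothed_cong]) (simp add: fsts_def)
  have rG: "rounded K2 p2 \<gamma> d n g (snds n w) = G w" for w
    unfolding rounded_def G_def Q_def by (rule arg_cong[OF smoothed_cong]) (simp add: snds_def)
  have Pm [measurable]: "P \<in> borel_measurable \<Omega>" unfolding P_def \<Omega>_def by (rule smoothed_measurable) measurable
  have Qm [measurable]: "Q \<in> borel_measurable \<Omega>" unfolding Q_def \<Omega>_def by (rule smoothed_measurable) measurable
  have Fm [measurable]: "F \<in> borel_measurable \<Omega>"
    unfolding F_def[abs_def] by (rule closest_point_measurable[OF K1(1-3) Pm])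
  have Gm [measurable]: "G \<in> borel_measurable \<Omega>"
    unfolding G_def[abs_def] by (rule closest_point_measurable[OF K2(1-3) Qm])
  let ?l = "real CARD('l)"
  have F: "(norm (F w))\<^sup>2 \<le> ?l" for w
    using closest_point_in_set[OF K1(1,3)] K1(4) unfolding F_def by (intro unit_box_norm) auto
  have G: "(norm (G w))\<^sup>2 \<le> ?l" for w
    using closest_point_in_set[OF K2(1,3)] K2(4) unfolding G_def by (intro unit_box_norm) auto
  note lowP = lowdeg_sum_square_le_1(2)[OF p(1,2) std_coords_N_fst[OF p \<theta>] AE_N_fst[OF p \<theta>] f K1(4) \<gamma>]
  note lowQ = lowdeg_sum_square_le_1(2)[OF p(3,4) std_coords_N_snd[OF p \<theta>] AE_N_snd[OF p \<theta>] g K2(4) \<gamma>]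
  have sqP: "integrable \<Omega> (\<lambda>w. (norm (P w))\<^sup>2)"
    unfolding P_def \<Omega>_def by (rule smoothed_norm_square(1)[OF u.std_coords_axioms lowP])
  have sqQ: "integrable \<Omega> (\<lambda>w. (norm (Q w))\<^sup>2)" "(\<integral>w. (norm (Q w))\<^sup>2 \<partial>\<Omega>) \<le> ?l"
    unfolding Q_def \<Omega>_def by (rule smoothed_norm_square[OF v.std_coords_axioms lowQ])+
  have diff: "(norm (x - y))\<^sup>2 \<le> 2 * (norm x)\<^sup>2 + 2 * (norm y)\<^sup>2" for x y :: "real ^ 'l"
  proof -
    have "(norm (x - y))\<^sup>2 \<le> (norm x + norm y)\<^sup>2" by (intro power_mono norm_triangle_ineq4) auto
    also have "\<dots> \<le> 2 * (norm x)\<^sup>2 + 2 * (norm y)\<^sup>2"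
      using zero_le_power2[of "norm x - norm y"] by (simp add: power2_eq_square algebra_simps)
    finally show ?thesis .
  qed
  have iP: "integrable \<Omega> (\<lambda>w. (norm (P w - F w))\<^sup>2)"
  proof (rule Bochner_Integration.integrable_bound)
    show "integrable \<Omega> (\<lambda>w. 2 * (norm (P w))\<^sup>2 + 2 * ?l)" using sqP by simp
    have "(norm (P w - F w))\<^sup>2 \<le> 2 * (norm (P w))\<^sup>2 + 2 * ?l" for w
      using diff[of "P w" "F w"] F[of w] by linarith
    then show "AE w in \<Omega>. norm ((norm (P w - F w))\<^sup>2) \<le> norm (2 * (norm (P w))\<^sup>2 + 2 * ?l)" by simp
  qed measurable
  have iQ: "integrable \<Omega> (\<lambda>w. (norm (Q w - G w))\<^sup>2)"
  proof (rule Bochner_Integration.integrable_bound)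
    show "integrable \<Omega> (\<lambda>w. 2 * (norm (Q w))\<^sup>2 + 2 * ?l)" using sqQ(1) by simp
    have "(norm (Q w - G w))\<^sup>2 \<le> 2 * (norm (Q w))\<^sup>2 + 2 * ?l" for w
      using diff[of "Q w" "G w"] G[of w] by linarith
    then show "AE w in \<Omega>. norm ((norm (Q w - G w))\<^sup>2) \<le> norm (2 * (norm (Q w))\<^sup>2 + 2 * ?l)" by simp
  qed measurable
  have iPQ: "integrable \<Omega> (\<lambda>w. P w \<bullet> Q w)"
    using expectation_inner_smoothed(1)[OF p \<theta>] unfolding P_def Q_def \<Omega>_def .
  have iFG: "integrable \<Omega> (\<lambda>w. F w \<bullet> G w)"
  proof (rule \<Omega>.integrable_const_bound)
    have "\<bar>F w \<bullet> G w\<bar> \<le> ?l" for w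
      using inner_le_weighted_squares[of 1 "F w" "G w"] F[of w] G[of w] by simp
    then show "AE w in \<Omega>. norm (F w \<bullet> G w) \<le> ?l" by simp
  qed measurable
  have pw: "\<bar>P w \<bullet> Q w - F w \<bullet> G w\<bar> \<le>
      ((norm (P w - F w))\<^sup>2 / \<delta> + \<delta> * (norm (Q w))\<^sup>2) / 2 + ((norm (Q w - G w))\<^sup>2 / \<delta> + \<delta> * ?l) / 2" for w
  proof -
    have "P w \<bullet> Q w - F w \<bullet> G w = (P w - F w) \<bullet> Q w + (Q w - G w) \<bullet> F w"
      by (simp add: inner_diff_left inner_diff_right inner_commute)
    then have "\<bar>P w \<bullet> Q w - F w \<bullet> G w\<bar> \<le> \<bar>(P w - F w) \<bullet> Q w\<bar> + \<bar>(Q w - G w) \<bullet> F w\<bar>" by linarith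
    moreover have "\<delta> * (norm (F w))\<^sup>2 \<le> \<delta> * ?l" using F[of w] \<delta> by (intro mult_left_mono) auto
    ultimately show ?thesis
      using inner_le_weighted_squares[OF \<delta>, of "P w - F w" "Q w"]
        inner_le_weighted_squares[OF \<delta>, of "Q w - G w" "F w"] by argo
  qed
  have "\<bar>(\<integral>w. P w \<bullet> Q w \<partial>\<Omega>) - (\<integral>w. F w \<bullet> G w \<partial>\<Omega>)\<bar> = \<bar>\<integral>w. P w \<bullet> Q w - F w \<bullet> G w \<partial>\<Omega>\<bar>"
    using iPQ iFG by simp
  also have "\<dots> \<le> (\<integral>w. \<bar>P w \<bullet> Q w - F w \<bullet> G w\<bar> \<partial>\<Omega>)" by (rule integral_abs_bound)
  also have "\<dots> \<le> (\<integral>w. ((norm (P w - F w))\<^sup>2 / \<delta> + \<delta> * (norm (Q w))\<^sup>2) / 2 + ((norm (Q w - G w))\<^sup>2 / \<delta> + \<delta> * ?l) / 2 \<partial>\<Omega>)"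
    using iPQ iFG iP iQ sqQ(1) pw by (intro integral_mono) auto
  also have "\<dots> = ((\<integral>w. (norm (P w - F w))\<^sup>2 \<partial>\<Omega>) / \<delta> + \<delta> * (\<integral>w. (norm (Q w))\<^sup>2 \<partial>\<Omega>)) / 2 + ((\<integral>w. (norm (Q w - G w))\<^sup>2 \<partial>\<Omega>) / \<delta> + \<delta> * ?l) / 2"
    using iP iQ sqQ(1) by (simp add: \<Omega>.prob_space)
  also have "\<dots> \<le> ((2 * \<delta>\<^sup>2) / \<delta> + \<delta> * ?l) / 2 + ((2 * \<delta>\<^sup>2) / \<delta> + \<delta> * ?l) / 2"
    using P Q sqQ(2) \<delta> unfolding F_def G_def dist_norm
    by (intro add_mono divide_right_mono mult_left_mono) auto
  also have "\<dots> = \<delta> * (2 + ?l)" using \<delta> by (simp add: power2_eq_square algebra_simps)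
  finally show ?thesis unfolding rF rG .
qed

theorem theorem7p3:
  fixes p1 p2 \<epsilon> \<theta>0 :: real
    and K1 K2 :: "(real ^ 'l) set"
  assumes "-1 < p1" "p1 < 1" "-1 < p2" "p2 < 1"
    and "0 < \<epsilon>" "\<epsilon> \<le> 1"
    and "0 \<le> \<theta>0" "\<theta>0 < 1"
    and "closed K1" "convex K1" "K1 \<subseteq> unit_box"
    and "closed K2" "convex K2" "K2 \<subseteq> unit_box"
  shows "\<exists>\<tau>>0. \<exists>T1 T2. \<forall>n\<ge>1.
    T1 n \<in> (cube n \<rightarrow>\<^sub>E K1) \<rightarrow> real_maps n K1 \<and>
    T2 n \<in> (cube n \<rightarrow>\<^sub>E K2) \<rightarrow> real_maps n K2 \<and>
    (\<forall>\<theta> \<in> {-\<theta>0..\<theta>0}. N_valid p1 p2 \<theta> \<longrightarrow>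
      (\<forall>f \<in> cube n \<rightarrow>\<^sub>E K1. \<forall>g \<in> cube n \<rightarrow>\<^sub>E K2.
        (MAX i\<in>{..<n}. max (MAX j. influence p1 n i (\<lambda>z. f z $ j))
                            (MAX j. influence p2 n i (\<lambda>z. g z $ j))) \<le> \<tau> \<longrightarrow>
        \<bar>(\<integral>w. f (fsts n w) \<bullet> g (snds n w) \<partial>Pi_pmf {..<n} undefined (\<lambda>_. N_dist p1 p2 \<theta>))
         - (\<integral>w. T1 n f (fsts n w) \<bullet> T2 n g (snds n w) \<partial>(\<Pi>\<^sub>M i\<in>{..<n}. bigauss p1 p2 \<theta>))\<bar> \<le> \<epsilon>))"
proof (cases "K1 = {} \<or> K2 = {}")
  case True
  \<comment> \<open>Without a pair \<open>(f, g)\<close> only the types of the mappings remain to be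
    checked, and the zero parameters of the witnesses are arbitrary.\<close>
  have "cube n \<noteq> {}" for n by (auto simp: cube_def PiE_eq_empty_iff)
  then have "(cube n \<rightarrow>\<^sub>E K1) = {} \<or> (cube n \<rightarrow>\<^sub>E K2) = {}" for n
    using True by (auto simp: PiE_eq_empty_iff)
  then show ?thesis
    using rounded_real_maps[OF assms(9,10)] rounded_real_maps[OF assms(12,13)]
    by (intro exI[of _ 1] conjI exI[of _ "\<lambda>n. rounded K1 0 0 0 n"] exI[of _ "\<lambda>n. rounded K2 0 0 0 n"] allI impI) auto
next
  case False
  note p = assms(1-4)
  note K1 = assms(9,10) False[simplified, THEN conjunct1] assms(11)
  note K2 = assms(12,13) False[simplified, THEN conjunct2] assms(14)
  let ?l = "real CARD('l)"
  \<comment> \<open>Half of \<epsilon> is for the change of coefficients, \<open>e\<close> for each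
    of the \<open>CARD('l)\<close> components, and half for rounding, which costs
    \<open>\<delta> * (2 + CARD('l))\<close>.\<close>
  define e where "e = \<epsilon> / (2 * ?l)"
  define \<delta> where "\<delta> = \<epsilon> / (2 * (2 + ?l))"
  have l: "?l \<ge> 1" by (simp add: Suc_leI)
  have e: "0 < e" "e < 1"
  proof -
    have "\<epsilon> < 2 * ?l" using assms(6) l by linarith
    then show "0 < e" "e < 1" using assms(5) by (simp_all add: e_def)
  qed
  have \<delta>: "\<delta> > 0" using assms(5) l by (simp add: \<delta>_def)
  obtain r0 where r0: "0 \<le> r0" "r0 < 1"
    "\<And>\<theta>. \<theta> \<in> {-\<theta>0..\<theta>0} \<Longrightarrow> N_valid p1 p2 \<theta> \<Longrightarrow>
      \<bar>(\<theta> - p1 * p2) / (sqrt (1 - p1\<^sup>2) * sqrt (1 - p2\<^sup>2))\<bar> \<le> r0"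
    by (rule correlation_bounded_away_from_1[OF p assms(8)]) blast
  obtain \<gamma> d1 where \<gamma>: "0 < \<gamma>" "\<gamma> < 1" and d1:
    "\<And>\<rho> d s. \<bar>\<rho>\<bar> \<le> r0 \<Longrightarrow> d1 \<le> d \<Longrightarrow> \<bar>\<rho> ^ s * (1 - (if s \<le> d then \<gamma> ^ s * \<gamma> ^ s else 0))\<bar> \<le> e"
    by (rule damping_parameters[OF r0(1,2) e]) blast
  have B: "0 \<le> fourth_bound p1 p2" by (simp add: fourth_bound_def)
  \<comment> \<open>Both measures live on pairs, and \<open>X\<close> is \<open>fst\<close> or
    \<open>snd\<close>; one law of pairs thus serves both functions.\<close>
  define good where "good p K X d \<tau> \<longleftrightarrow> (\<forall>n. \<forall>f \<in> cube n \<rightarrow>\<^sub>E K. \<forall>(\<mu> :: (real \<times> real) measure) (\<nu> :: (real \<times> real) measure).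
    std_coords (\<lambda>_. \<mu>) (\<lambda>w. chi p (X w)) (fourth_bound p1 p2) \<longrightarrow> (AE w in \<mu>. X w \<in> {1, -1}) \<longrightarrow>
    std_coords (\<lambda>_. \<nu>) (\<lambda>w. chi p (X w)) (fourth_bound p1 p2) \<longrightarrow>
    (\<forall>i<n. \<forall>j. influence p n i (\<lambda>z. f z $ j) \<le> \<tau>) \<longrightarrow>
    (\<integral>w. (dist (smoothed p n \<gamma> d f (\<lambda>i. X (w i)))
      (closest_point K (smoothed p n \<gamma> d f (\<lambda>i. X (w i)))))\<^sup>2 \<partial>Pi\<^sub>M {..<n} (\<lambda>_. \<nu>)) \<le> 2 * \<delta>\<^sup>2)"
    for p and K :: "(real ^ 'l) set" and X d \<tau>
  obtain da where "\<forall>d\<ge>da. \<exists>\<tau>>0. good p1 K1 fst d \<tau>"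
    using rounding[OF p(1,2) K1 \<delta> \<gamma> B, where ?'a = "real \<times> real"] unfolding good_def by meson
  moreover obtain db where "\<forall>d\<ge>db. \<exists>\<tau>>0. good p2 K2 snd d \<tau>"
    using rounding[OF p(3,4) K2 \<delta> \<gamma> B, where ?'a = "real \<times> real"] unfolding good_def by meson
  \<comment> \<open>Both functions are truncated at the same degree, as the factor in
    \<open>d1\<close> presupposes.\<close>
  moreover define d where "d = max d1 (max da db)"
  ultimately obtain \<tau>1 \<tau>2 where \<tau>: "\<tau>1 > 0" "\<tau>2 > 0" and good1: "good p1 K1 fst d \<tau>1" and good2: "good p2 K2 snd d \<tau>2"
    by (meson max.cobounded1 max.cobounded2 order.trans)
  have d: "d1 \<le> d" by (simp add: d_def)
  define \<tau> where "\<tau> = min \<tau>1 \<tau>2"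
  have main: "\<bar>(\<integral>w. f (fsts n w) \<bullet> g (snds n w) \<partial>Pi_pmf {..<n} undefined (\<lambda>_. N_dist p1 p2 \<theta>))
      - (\<integral>w. rounded K1 p1 \<gamma> d n f (fsts n w) \<bullet> rounded K2 p2 \<gamma> d n g (snds n w) \<partial>Pi\<^sub>M {..<n} (\<lambda>_. bigauss p1 p2 \<theta>))\<bar> \<le> \<epsilon>"
    if n: "n \<ge> 1" and \<theta>: "\<theta> \<in> {-\<theta>0..\<theta>0}" "N_valid p1 p2 \<theta>"
      and f: "f \<in> cube n \<rightarrow>\<^sub>E K1" and g: "g \<in> cube n \<rightarrow>\<^sub>E K2"
      and inf: "(MAX i\<in>{..<n}. max (MAX j. influence p1 n i (\<lambda>z. f z $ j))
                            (MAX j. influence p2 n i (\<lambda>z. g z $ j))) \<le> \<tau>" for n \<theta> f g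
  proof -
    define \<rho> where "\<rho> = (\<theta> - p1 * p2) / (sqrt (1 - p1\<^sup>2) * sqrt (1 - p2\<^sup>2))"
    have \<rho>: "\<bar>\<rho>\<bar> \<le> r0" unfolding \<rho>_def by (rule r0(3)[OF \<theta>])
    have infl: "influence p1 n i (\<lambda>z. f z $ j) \<le> \<tau>" "influence p2 n i (\<lambda>z. g z $ j) \<le> \<tau>" if "i < n" for i j
    proof -
      have "max (MAX j. influence p1 n i (\<lambda>z. f z $ j)) (MAX j. influence p2 n i (\<lambda>z. g z $ j)) \<le> \<tau>"
        using that by (intro order.trans[OF Max_ge inf]) auto
      moreover have "influence p1 n i (\<lambda>z. f z $ j) \<le> (MAX j. influence p1 n i (\<lambda>z. f z $ j))"
        "influence p2 n i (\<lambda>z. g z $ j) \<le> (MAX j. influence p2 n i (\<lambda>z. g z $ j))"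
        by (auto intro: Max_ge)
      ultimately show "influence p1 n i (\<lambda>z. f z $ j) \<le> \<tau>" "influence p2 n i (\<lambda>z. g z $ j) \<le> \<tau>" by auto
    qed
    let ?\<Omega> = "Pi\<^sub>M {..<n} (\<lambda>_. bigauss p1 p2 \<theta>)"
    let ?P = "\<lambda>w. smoothed p1 n \<gamma> d f (\<lambda>i. fst (w i))" and ?Q = "\<lambda>w. smoothed p2 n \<gamma> d g (\<lambda>i. snd (w i))"
    let ?F = "\<lambda>j. fourier p1 n (\<lambda>z. f z $ j)" and ?G = "\<lambda>j. fourier p2 n (\<lambda>z. g z $ j)"
    have "(\<integral>w. (dist (?P w) (closest_point K1 (?P w)))\<^sup>2 \<partial>?\<Omega>) \<le> 2 * \<delta>\<^sup>2"
      using good1[unfolded good_def, rule_format, OF f std_coords_N_fst[OF p \<theta>(2)] AE_N_fst[OF p \<theta>(2)]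
          std_coords_bigauss_fst[OF p \<theta>(2)]] infl(1) by (force simp: \<tau>_def)
    moreover have "(\<integral>w. (dist (?Q w) (closest_point K2 (?Q w)))\<^sup>2 \<partial>?\<Omega>) \<le> 2 * \<delta>\<^sup>2"
      using good2[unfolded good_def, rule_format, OF g std_coords_N_snd[OF p \<theta>(2)] AE_N_snd[OF p \<theta>(2)]
          std_coords_bigauss_snd[OF p \<theta>(2)]] infl(2) by (force simp: \<tau>_def)
    ultimately have "\<bar>(\<integral>w. ?P w \<bullet> ?Q w \<partial>?\<Omega>) -
        (\<integral>w. rounded K1 p1 \<gamma> d n f (fsts n w) \<bullet> rounded K2 p2 \<gamma> d n g (snds n w) \<partial>?\<Omega>)\<bar> \<le> \<delta> * (2 + ?l)"
      by (rule expectation_inner_rounded[OF p \<theta>(2) K1 K2 f g \<gamma> \<delta>])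
    moreover have "\<delta> * (2 + ?l) = \<epsilon> / 2"
    proof -
      have "a / (2 * x) * x = a / 2" if "x > 0" for a x :: real using that by simp
      then show ?thesis unfolding \<delta>_def using l by (metis add_pos_nonneg of_nat_0_le_iff zero_less_numeral)
    qed
    moreover have "\<bar>(\<integral>w. f (fsts n w) \<bullet> g (snds n w) \<partial>Pi_pmf {..<n} undefined (\<lambda>_. N_dist p1 p2 \<theta>))
        - (\<integral>w. ?P w \<bullet> ?Q w \<partial>?\<Omega>)\<bar> \<le> \<epsilon> / 2"
    proof -
      have sq1: "(\<Sum>S\<in>Pow {..<n}. (?F j S)\<^sup>2) \<le> 1" for j
        by (rule lowdeg_sum_square_le_1(1)[OF p(1,2) std_coords_N_fst[OF p \<theta>(2)] AE_N_fst[OF p \<theta>(2)] f K1(4) \<gamma>])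
      have sq2: "(\<Sum>S\<in>Pow {..<n}. (?G j S)\<^sup>2) \<le> 1" for j
        by (rule lowdeg_sum_square_le_1(1)[OF p(3,4) std_coords_N_snd[OF p \<theta>(2)] AE_N_snd[OF p \<theta>(2)] g K2(4) \<gamma>])
      \<comment> \<open>The power of \<rho> has to stay attached: a coefficient of degree above
        \<open>d\<close> is removed entirely, and only this power makes its loss small.\<close>
      have coeff: "\<bar>?F j S * ?G j S * \<rho> ^ card S
          - lowdeg p1 n \<gamma> d (\<lambda>z. f z $ j) S * lowdeg p2 n \<gamma> d (\<lambda>z. g z $ j) S * \<rho> ^ card S\<bar>
          \<le> e * (((?F j S)\<^sup>2 + (?G j S)\<^sup>2) / 2)" for j S
      proof -
        have "?F j S * ?G j S * \<rho> ^ card S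
            - lowdeg p1 n \<gamma> d (\<lambda>z. f z $ j) S * lowdeg p2 n \<gamma> d (\<lambda>z. g z $ j) S * \<rho> ^ card S
          = (\<rho> ^ card S * (1 - (if card S \<le> d then \<gamma> ^ card S * \<gamma> ^ card S else 0))) * (?F j S * ?G j S)"
          by (simp add: lowdeg_def algebra_simps)
        also have "\<bar>\<dots>\<bar> \<le> e * \<bar>?F j S * ?G j S\<bar>"
          unfolding abs_mult[of _ "?F j S * ?G j S"] by (intro mult_right_mono d1 \<rho> d) simp
        also have "\<dots> \<le> e * (((?F j S)\<^sup>2 + (?G j S)\<^sup>2) / 2)"
        proof (intro mult_left_mono)
          have "\<bar>a * b\<bar> \<le> (a\<^sup>2 + b\<^sup>2) / 2" for a b :: real
            using inner_le_weighted_squares[of 1 a b] by simp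
          then show "\<bar>?F j S * ?G j S\<bar> \<le> ((?F j S)\<^sup>2 + (?G j S)\<^sup>2) / 2" .
        qed (use e in simp)
        finally show ?thesis .
      qed
      have "\<bar>(\<integral>w. f (fsts n w) \<bullet> g (snds n w) \<partial>Pi_pmf {..<n} undefined (\<lambda>_. N_dist p1 p2 \<theta>))
          - (\<integral>w. ?P w \<bullet> ?Q w \<partial>?\<Omega>)\<bar>
        \<le> (\<Sum>j\<in>UNIV. \<Sum>S\<in>Pow {..<n}. e * (((?F j S)\<^sup>2 + (?G j S)\<^sup>2) / 2))"
        unfolding expectation_inner_N[OF p \<theta>(2)] expectation_inner_smoothed(2)[OF p \<theta>(2)] \<rho>_def[symmetric]
          sum_subtractf[symmetric]
        by (intro order.trans[OF sum_abs] sum_mono coeff)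
      also have "\<dots> = (\<Sum>j\<in>UNIV. e * (((\<Sum>S\<in>Pow {..<n}. (?F j S)\<^sup>2) + (\<Sum>S\<in>Pow {..<n}. (?G j S)\<^sup>2)) / 2))"
        by (simp add: sum_distrib_left sum.distrib sum_divide_distrib add_divide_distrib distrib_left)
      also have "\<dots> \<le> (\<Sum>j\<in>(UNIV :: 'l set). e * ((1 + 1) / 2))"
        using sq1 sq2 e by (intro sum_mono mult_left_mono divide_right_mono add_mono) auto
      also have "\<dots> = \<epsilon> / 2" using l by (simp add: e_def)
      finally show ?thesis .
    qed
    ultimately show ?thesis by linarith
  qed
  show ?thesis
    using \<tau> rounded_real_maps[OF K1(1,2)] rounded_real_maps[OF K2(1,2)] main
    by (intro exI[of _ \<tau>] conjI exI[of _ "rounded K1 p1 \<gamma> d"] exI[of _ "rounded K2 p2 \<gamma> d"] allI impI ballI)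
      (auto simp: \<tau>_def)
qed

end
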